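(* Let $(G,S)$ be the Cayley graph of a group of polynomial growth with homogeneous dimension $N\ge 3$, let $\alpha\in(0,N)$ and $p>\frac{N+\alpha}{N-2}$, and let $$K:=\sup_{u\in D^{1,2}(G),\ \lVert u\rVert_{D^{1,2}}=1}\ \sum_{x\in G}\left(R_\alpha\ast|u|^p\right)(x)\,|u(x)|^p .$$ Let $\{u_n\}\subset D^{1,2}(G)$ be a maximizing sequence, i.e. $\lVert u_n\rVert_{D^{1,2}}=1$ for all $n$ and $\sum_{x\in G}(R_\alpha\ast|u_n|^p)(x)|u_n(x)|^p\to K$ as $n\to\infty$. Then there exist a sequence $\{x_n\}\subset G$ and a function $v\in D^{1,2}(G)$ such that the translated sequence $v_n(x):=u_n(x_nx)$ contains a subsequence that converges to $v$ in $D^{1,2}(G)$. Moreover $v$ is a maximizer for $K$, i.e. $\lVert v\rVert_{D^{1,2}}=1$ and $\sum_{x\in G}(R_\alpha\ast|v|^p)(x)|v(x)|^p=K$.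
   Context: $G$ is a group with a finite symmetric generating set $S=S^{-1}$. The Cayley graph $(G,S)$ has vertex set $G$, and $x\sim y$ iff $x=ys$ for some $s\in S$. $d^S$ is the word (graph) metric, $e$ is the unit element, and $\beta_S(n)=\#\{x\in G: d^S(e,x)\le n\}$. $G$ has polynomial growth with homogeneous dimension $N\in\mathbb N$ if there are constants $C_1,C_2>0$ with $C_1n^N\le\beta_S(n)\le C_2n^N$ for all $n\ge1$. For $u:G\to\mathbb R$ put $\nabla_{xy}u=u(y)-u(x)$ for $x\sim y$, $\Delta u(x)=\sum_{y\sim x}(u(y)-u(x))$, and $\lVert u\rVert_{D^{1,2}}=\big(\sum_{x\in G}\sum_{y\sim x}|\nabla_{xy}u|^2\big)^{1/2}$. $D^{1,2}(G)=\{u\in\ell^{2N/(N-2)}(G):\lVert u\rVert_{D^{1,2}}<\infty\}$, normed by $\lVert\cdot\rVert_{D^{1,2}}$. Let $k_t(x,y)$ be the heat kernel of $\Delta$, i.e. the kernel of the semigroup $e^{t\Delta}$. The Green's function of the fractional Laplacian $(-\Delta)^{\alpha/2}$ is $$R_\alpha(x,y)=\frac1{\Gamma(\alpha/2)}\int_0^\infty k_t(x,y)\,t^{-1+\alpha/2}\,dt,\qquad x,y\in G.$$ The nonlocal term is taken off the diagonal: $(R_\alpha\ast f)(x)=\sum_{y\in G,\,y\ne x}R_\alpha(x,y)f(y)$. *)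

theory Defs
  imports "HOL-Analysis.Analysis" "HOL-Algebra.Generated_Groups"
begin

text \<open>Functions on the group are total functions of type \<open>'a \<Rightarrow> real\<close>, of which only the values on
  \<open>carrier G\<close> matter: adjacency forces both endpoints into the carrier, and all sums range over the
  carrier.\<close>

definition cayley_edges :: "('a, 'b) monoid_scheme \<Rightarrow> 'a set \<Rightarrow> ('a \<times> 'a) set" where
  "cayley_edges G S =
     {(x, y). x \<in> carrier G \<and> y \<in> carrier G \<and> (\<exists>s\<in>S. x = y \<otimes>\<^bsub>G\<^esub> s)}"

definition word_dist :: "('a, 'b) monoid_scheme \<Rightarrow> 'a set \<Rightarrow> 'a \<Rightarrow> 'a \<Rightarrow> nat" where
  "word_dist G S x y = (LEAST n. (x, y) \<in> cayley_edges G S ^^ n)"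

definition growth :: "('a, 'b) monoid_scheme \<Rightarrow> 'a set \<Rightarrow> nat \<Rightarrow> nat" where
  "growth G S n = card {x \<in> carrier G. word_dist G S \<one>\<^bsub>G\<^esub> x \<le> n}"

definition polynomial_growth :: "('a, 'b) monoid_scheme \<Rightarrow> 'a set \<Rightarrow> nat \<Rightarrow> bool" where
  "polynomial_growth G S N \<longleftrightarrow>
     (\<exists>C1 C2 :: real. C1 > 0 \<and> C2 > 0 \<and>
        (\<forall>n\<ge>1. C1 * real n ^ N \<le> real (growth G S n) \<and> real (growth G S n) \<le> C2 * real n ^ N))"

definition laplacian :: "('a, 'b) monoid_scheme \<Rightarrow> 'a set \<Rightarrow> ('a \<Rightarrow> real) \<Rightarrow> 'a \<Rightarrow> real" where
  "laplacian G S u x = (\<Sum>y | (y, x) \<in> cayley_edges G S. u y - u x)"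

text \<open>The squared Dirichlet norm is \<open>\<Sum>x. grad_sq G S u x\<close>, so every edge is counted twice.\<close>

definition grad_sq :: "('a, 'b) monoid_scheme \<Rightarrow> 'a set \<Rightarrow> ('a \<Rightarrow> real) \<Rightarrow> 'a \<Rightarrow> real" where
  "grad_sq G S u x = (\<Sum>y | (y, x) \<in> cayley_edges G S. \<bar>u y - u x\<bar>\<^sup>2)"

definition D12_norm :: "('a, 'b) monoid_scheme \<Rightarrow> 'a set \<Rightarrow> ('a \<Rightarrow> real) \<Rightarrow> real" where
  "D12_norm G S u = sqrt (\<Sum>\<^sub>\<infinity>x\<in>carrier G. grad_sq G S u x)"

definition ell :: "('a, 'b) monoid_scheme \<Rightarrow> real \<Rightarrow> ('a \<Rightarrow> real) set" where
  "ell G q = {u. (\<lambda>x. \<bar>u x\<bar> powr q) summable_on carrier G}"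

definition D12 :: "('a, 'b) monoid_scheme \<Rightarrow> 'a set \<Rightarrow> nat \<Rightarrow> ('a \<Rightarrow> real) set" where
  "D12 G S N = {u \<in> ell G (2 * real N / (real N - 2)). grad_sq G S u summable_on carrier G}"

text \<open>The Laplacian of a Cayley graph of finite degree is a bounded operator, so \<open>e\<^sup>t\<^sup>\<Delta>\<close> is given by
  its exponential series; its kernel is obtained by applying it to point masses.\<close>

definition heat_semigroup ::
  "('a, 'b) monoid_scheme \<Rightarrow> 'a set \<Rightarrow> real \<Rightarrow> ('a \<Rightarrow> real) \<Rightarrow> 'a \<Rightarrow> real" where
  "heat_semigroup G S t u x = (\<Sum>k. t ^ k / fact k * (laplacian G S ^^ k) u x)"

definition heat_kernel ::
  "('a, 'b) monoid_scheme \<Rightarrow> 'a set \<Rightarrow> real \<Rightarrow> 'a \<Rightarrow> 'a \<Rightarrow> real" where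
  "heat_kernel G S t x y = heat_semigroup G S t (indicator {y}) x"

definition frac_green ::
  "('a, 'b) monoid_scheme \<Rightarrow> 'a set \<Rightarrow> real \<Rightarrow> 'a \<Rightarrow> 'a \<Rightarrow> real" where
  "frac_green G S \<alpha> x y =
     1 / Gamma (\<alpha> / 2) * (LBINT t:{0<..}. heat_kernel G S t x y * t powr (-1 + \<alpha> / 2))"

text \<open>The sums below have nonnegative terms (the heat kernel is nonnegative and only
  \<open>f = \<bar>u\<bar>\<^sup>p\<close> is used), so they are taken in \<open>[0, \<infinity>]\<close>, where they and the supremum always exist.\<close>

definition green_conv ::
  "('a, 'b) monoid_scheme \<Rightarrow> 'a set \<Rightarrow> real \<Rightarrow> ('a \<Rightarrow> real) \<Rightarrow> 'a \<Rightarrow> ennreal" where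
  "green_conv G S \<alpha> f x = (\<Sum>\<^sub>\<infinity>y\<in>carrier G - {x}. ennreal (frac_green G S \<alpha> x y * f y))"

definition HLS_energy ::
  "('a, 'b) monoid_scheme \<Rightarrow> 'a set \<Rightarrow> real \<Rightarrow> real \<Rightarrow> ('a \<Rightarrow> real) \<Rightarrow> ennreal" where
  "HLS_energy G S \<alpha> p u =
     (\<Sum>\<^sub>\<infinity>x\<in>carrier G. green_conv G S \<alpha> (\<lambda>y. \<bar>u y\<bar> powr p) x * ennreal (\<bar>u x\<bar> powr p))"

definition HLS_sup ::
  "('a, 'b) monoid_scheme \<Rightarrow> 'a set \<Rightarrow> nat \<Rightarrow> real \<Rightarrow> real \<Rightarrow> ennreal" where
  "HLS_sup G S N \<alpha> p = (SUP u\<in>{u \<in> D12 G S N. D12_norm G S u = 1}. HLS_energy G S \<alpha> p u)"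

end

theory Submission
  imports Defs "HOL-Complex_Analysis.Great_Picard"
begin

text \<open>Translation differences are controlled by the word length times the Dirichlet norm. Combined
  with the lower volume bound, this gives a Faber--Krahn inequality, hence the Sobolev inequality by
  dyadic truncation, and a Nash-type inequality, hence the decay \<open>k powr (- N / 2)\<close> of the lazy walk
  after \<open>k\<close> steps. Since Green's function is an explicit positive combination of these transition
  probabilities, interpolating each of them separately replaces the Hardy--Littlewood--Sobolev
  inequality: strict supercriticality of \<open>p\<close> leaves room for a nonendpoint exponent.

  The same room makes the energy small when \<open>u\<close> is uniformly small, so a maximizing sequence can be
  translated so that a subsequence converges pointwise to some \<open>v \<noteq> 0\<close> of squared norm \<open>E \<le> 1\<close>.
  Instead of a Brezis--Lieb splitting, near-maximality is tested against finitely supported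
  multiplicative variations, which yields \<open>K * E \<le> energy v\<close>. Together with
  \<open>energy v \<le> K * E powr p\<close> and \<open>p > 1\<close> this forces \<open>E = 1\<close>; so no mass is lost, \<open>v\<close> is a
  maximizer, and the convergence is strong.\<close>

section \<open>Cayley graphs\<close>

text \<open>A kernel bounded by \<open>M\<close> with row and column sums at most 1 can be
  interpolated between l^2, by Schur's test, and l^1: its bilinear form is of size
  \<open>M powr \<theta>\<close> on l^q with \<open>q = 2 / (1 + \<theta>)\<close>. Summing over the
  steps \<open>k\<close>, with coefficients of order \<open>k powr (\<alpha> / 2 - 1)\<close> and
  \<open>M\<close> of order \<open>k powr (- N / 2)\<close>, requires
  \<open>\<theta> > \<alpha> / N\<close>; the Sobolev inequality puts
  \<open>\<bar>u\<bar> powr p\<close> into l^q as soon as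
  \<open>1 + \<theta> \<le> p * (N - 2) / N\<close>. As \<open>\<alpha> < N\<close>, some
  \<open>\<theta> < 1\<close> satisfies both exactly when
  \<open>p > (N + \<alpha>) / (N - 2)\<close>.

  The obstacle is that pointwise convergence does not control energy escaping to infinity. Damping
  \<open>un\<close> on a finite set changes its squared norm by a finite sum and lowers its energy
  by at most a sum of finitely many potentials, so the escaping part is never estimated. The energy
  has degree \<open>2 * p\<close> and the squared norm degree 2; the first-order terms in the
  maximality inequality therefore share the factor \<open>2 * p\<close>, and its cancellation leaves
  the constant \<open>K\<close> itself in the limit inequality.\<close>

lemma summable_on_bounded:
  fixes f :: "'a \<Rightarrow> real"
  assumes "\<And>x. x \<in> A \<Longrightarrow> 0 \<le> f x"
    and "\<And>F. finite F \<Longrightarrow> F \<subseteq> A \<Longrightarrow> sum f F \<le> C"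
  shows "f summable_on A" and "infsum f A \<le> C"
proof -
  show *: "f summable_on A"
    by (rule nonneg_bdd_above_summable_on) (use assms in \<open>auto intro!: bdd_aboveI2\<close>)
  show "infsum f A \<le> C"
    by (rule infsum_le_finite_sums[OF *]) (use assms in auto)
qed

text \<open>Markov's inequality for counting measure. Finiteness is a separate claim because
  \<open>card\<close> of an infinite set is 0, so the second bound alone would not exclude an
  infinite level set.\<close>

lemma summable_on_finite_super_level:
  fixes f :: "'a \<Rightarrow> real"
  assumes "f summable_on A" and nn: "\<And>x. x \<in> A \<Longrightarrow> 0 \<le> f x" and "c > 0"
  shows "finite {x \<in> A. c \<le> f x}" and "real (card {x \<in> A. c \<le> f x}) * c \<le> infsum f A"
proof -
  have *: "real (card F) * c \<le> infsum f A" if "finite F" "F \<subseteq> {x \<in> A. c \<le> f x}" for F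
  proof -
    have "real (card F) * c = (\<Sum>x\<in>F. c)" by simp
    also have "\<dots> \<le> sum f F" by (rule sum_mono) (use that in auto)
    also have "\<dots> \<le> infsum f A"
      by (rule finite_sum_le_infsum[OF assms(1)]) (use that nn in auto)
    finally show ?thesis .
  qed
  have "card F \<le> nat \<lceil>infsum f A / c\<rceil>" if "finite F" "F \<subseteq> {x \<in> A. c \<le> f x}" for F
  proof -
    have "real (card F) \<le> infsum f A / c"
      using *[OF that] \<open>c > 0\<close> by (simp add: field_simps)
    then show ?thesis using real_nat_ceiling_ge[of "infsum f A / c"] by linarith
  qed
  then show fin: "finite {x \<in> A. c \<le> f x}"
    by (meson finite_if_finite_subsets_card_bdd)
  show "real (card {x \<in> A. c \<le> f x}) * c \<le> infsum f A" using *[OF fin] by simp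
qed

locale cayley_graph = group G for G (structure) +
  fixes S :: "'a set"
  assumes S_closed: "S \<subseteq> carrier G" and finite_S: "finite S"
    and inv_S: "\<And>s. s \<in> S \<Longrightarrow> inv s \<in> S"
    and generate_S: "generate G S = carrier G"
begin

lemma S_carrier [simp]: "s \<in> S \<Longrightarrow> s \<in> carrier G"
  using S_closed by auto

lemma neighbours:
  "x \<in> carrier G \<Longrightarrow> {y. (y, x) \<in> cayley_edges G S} = (\<lambda>s. x \<otimes> s) ` S"
  by (auto simp: cayley_edges_def)

lemma sum_neighbours:
  assumes "x \<in> carrier G"
  shows "(\<Sum>y | (y, x) \<in> cayley_edges G S. f y) = (\<Sum>s\<in>S. f (x \<otimes> s))"
proof -
  have "inj_on (\<lambda>s. x \<otimes> s) S"
    using assms S_closed by (auto intro!: inj_onI)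
  then show ?thesis
    using assms by (simp add: neighbours sum.reindex)
qed

lemma grad_sq_eq:
  "x \<in> carrier G \<Longrightarrow> grad_sq G S u x = (\<Sum>s\<in>S. (u (x \<otimes> s) - u x)\<^sup>2)"
  unfolding grad_sq_def by (simp add: sum_neighbours)

lemma laplacian_eq:
  "x \<in> carrier G \<Longrightarrow> laplacian G S u x = (\<Sum>s\<in>S. u (x \<otimes> s) - u x)"
  unfolding laplacian_def by (simp add: sum_neighbours)

lemma grad_sq_nonneg [simp]: "0 \<le> grad_sq G S u x"
  unfolding grad_sq_def by (rule sum_nonneg) auto

lemma D12_norm_nonneg [simp]: "0 \<le> D12_norm G S u"
  unfolding D12_norm_def by (simp add: infsum_nonneg)

lemma D12_norm_power2: "(D12_norm G S u)\<^sup>2 = (\<Sum>\<^sub>\<infinity>x\<in>carrier G. grad_sq G S u x)"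
  unfolding D12_norm_def by (simp add: infsum_nonneg)

lemma finite_sum_grad_sq_le:
  assumes "grad_sq G S u summable_on carrier G" "finite A" "A \<subseteq> carrier G"
  shows "(\<Sum>x\<in>A. grad_sq G S u x) \<le> (D12_norm G S u)\<^sup>2"
  unfolding D12_norm_power2 using assms by (intro finite_sum_le_infsum) auto

lemma inj_on_right_mult: "g \<in> carrier G \<Longrightarrow> A \<subseteq> carrier G \<Longrightarrow> inj_on (\<lambda>x. x \<otimes> g) A"
  by (auto intro!: inj_onI simp: subset_iff)

lemma bij_right_mult: "g \<in> carrier G \<Longrightarrow> bij_betw (\<lambda>x. x \<otimes> g) (carrier G) (carrier G)"
proof (rule bij_betw_byWitness[where f' = "\<lambda>x. x \<otimes> inv g"])
qed (auto simp: m_assoc)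

lemma bij_left_mult: "g \<in> carrier G \<Longrightarrow> bij_betw (\<lambda>x. g \<otimes> x) (carrier G) (carrier G)"
proof (rule bij_betw_byWitness[where f' = "\<lambda>x. inv g \<otimes> x"])
qed (auto simp: m_assoc[symmetric])

lemma infsum_left_mult:
  "g \<in> carrier G \<Longrightarrow> (\<Sum>\<^sub>\<infinity>x\<in>carrier G. f (g \<otimes> x)) = infsum f (carrier G)"
  by (rule infsum_reindex_bij_betw[OF bij_left_mult])

lemma summable_on_left_mult:
  "g \<in> carrier G \<Longrightarrow> (\<lambda>x. f (g \<otimes> x)) summable_on carrier G \<longleftrightarrow> f summable_on carrier G"
  by (rule summable_on_reindex_bij_betw[OF bij_left_mult])

text \<open>Edges are preserved by left multiplication, so one length serves all starting points;
  this uniformity is what lets two paths be concatenated. The lemma ensures that the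
  \<open>LEAST\<close> in \<open>word_dist\<close> is taken over a nonempty set.\<close>

lemma path_right_mult:
  assumes "g \<in> carrier G"
  shows "\<exists>n. \<forall>x\<in>carrier G. (x, x \<otimes> g) \<in> cayley_edges G S ^^ n"
proof -
  have "g \<in> generate G S" using assms generate_S by simp
  then show ?thesis
  proof induction
    case one
    then show ?case by (intro exI[of _ 0]) auto
  next
    case (incl h)
    have "(x, x \<otimes> h) \<in> cayley_edges G S ^^ 1" if "x \<in> carrier G" for x
      using incl that inv_S[OF incl]
      by (auto simp: cayley_edges_def m_assoc intro!: bexI[of _ "inv h"])
    then show ?case by blast
  next
    case (inv h)
    have "(x, x \<otimes> inv h) \<in> cayley_edges G S ^^ 1" if "x \<in> carrier G" for x
      using inv that by (auto simp: cayley_edges_def m_assoc intro!: bexI[of _ h])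
    then show ?case by blast
  next
    case (eng h1 h2)
    then obtain m n where
      m: "\<forall>x\<in>carrier G. (x, x \<otimes> h1) \<in> cayley_edges G S ^^ m" and
      n: "\<forall>x\<in>carrier G. (x, x \<otimes> h2) \<in> cayley_edges G S ^^ n" by blast
    have h: "h1 \<in> carrier G" "h2 \<in> carrier G" using eng generate_S by auto
    have "(x, x \<otimes> (h1 \<otimes> h2)) \<in> cayley_edges G S ^^ (m + n)" if "x \<in> carrier G" for x
      unfolding relpow_add using that h m n
      by (auto simp: m_assoc[symmetric] intro!: relcompI[of x "x \<otimes> h1"])
    then show ?case by blast
  qed
qed

lemma word_dist_path:
  assumes "g \<in> carrier G"
  shows "(\<one>, g) \<in> cayley_edges G S ^^ word_dist G S \<one> g"
proof -
  have "\<exists>n. (\<one>, g) \<in> cayley_edges G S ^^ n"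
    using path_right_mult[OF assms] assms by (metis l_one one_closed)
  then show ?thesis unfolding word_dist_def by (rule LeastI_ex)
qed

text \<open>Minkowski's inequality along a path from \<open>\<one>\<close> to \<open>g\<close>:
  right multiplication by the part of the path already walked only reindexes the finite set, so each
  edge costs at most one Dirichlet norm.\<close>

lemma L2_set_right_mult_path:
  assumes "grad_sq G S u summable_on carrier G"
  shows "(\<one>, g) \<in> cayley_edges G S ^^ n \<Longrightarrow> finite A \<Longrightarrow> A \<subseteq> carrier G \<Longrightarrow>
    L2_set (\<lambda>x. u (x \<otimes> g) - u x) A \<le> real n * D12_norm G S u"
proof (induction n arbitrary: g A)
  case 0
  then have "L2_set (\<lambda>x. u (x \<otimes> g) - u x) A = L2_set (\<lambda>x. 0) A"
    by (intro L2_set_cong) auto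
  then show ?case by (simp add: L2_set_def)
next
  case (Suc n)
  obtain g' where g': "(\<one>, g') \<in> cayley_edges G S ^^ n" "(g', g) \<in> cayley_edges G S"
    using Suc.prems by auto
  then obtain s where s: "g' \<in> carrier G" "g \<in> carrier G" "s \<in> S" "g' = g \<otimes> s"
    by (auto simp: cayley_edges_def)
  define A' where "A' = (\<lambda>x. x \<otimes> g') ` A"
  have g: "g = g' \<otimes> inv s" using s by (simp add: m_assoc)
  have A': "finite A'" "A' \<subseteq> carrier G" using Suc.prems s by (auto simp: A'_def)
  have "L2_set (\<lambda>x. u (x \<otimes> g) - u (x \<otimes> g')) A = sqrt (\<Sum>y\<in>A'. (u (y \<otimes> inv s) - u y)\<^sup>2)"
  proof -
    have "x \<otimes> g = (x \<otimes> g') \<otimes> inv s" if "x \<in> A" for x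
      using that Suc.prems s(1,3) by (subst g) (simp add: m_assoc subsetD)
    then show ?thesis
      unfolding A'_def L2_set_def using Suc.prems s(1)
      by (subst sum.reindex) (auto intro!: inj_on_right_mult)
  qed
  also have "\<dots> \<le> sqrt (\<Sum>y\<in>A'. grad_sq G S u y)"
  proof (intro real_sqrt_le_mono sum_mono)
    fix y assume "y \<in> A'"
    then have y: "y \<in> carrier G" using A' by auto
    show "(u (y \<otimes> inv s) - u y)\<^sup>2 \<le> grad_sq G S u y"
      unfolding grad_sq_eq[OF y] by (rule member_le_sum) (use s inv_S finite_S in auto)
  qed
  also have "\<dots> \<le> sqrt ((D12_norm G S u)\<^sup>2)"
    by (intro real_sqrt_le_mono finite_sum_grad_sq_le assms A')
  finally have 1: "L2_set (\<lambda>x. u (x \<otimes> g) - u (x \<otimes> g')) A \<le> D12_norm G S u" by simp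
  have "L2_set (\<lambda>x. u (x \<otimes> g) - u x) A
      = L2_set (\<lambda>x. (u (x \<otimes> g) - u (x \<otimes> g')) + (u (x \<otimes> g') - u x)) A" by simp
  also have "\<dots> \<le> L2_set (\<lambda>x. u (x \<otimes> g) - u (x \<otimes> g')) A + L2_set (\<lambda>x. u (x \<otimes> g') - u x) A"
    by (rule L2_set_triangle_ineq)
  also have "\<dots> \<le> D12_norm G S u + real n * D12_norm G S u"
    by (intro add_mono 1 Suc.IH g' Suc.prems)
  finally show ?case by (simp add: algebra_simps)
qed

section \<open>Volume of word balls\<close>

definition word_ball :: "nat \<Rightarrow> 'a set" where
  "word_ball n = {x \<in> carrier G. word_dist G S \<one> x \<le> n}"

lemma word_ball_carrier: "g \<in> word_ball n \<Longrightarrow> g \<in> carrier G"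
  by (simp add: word_ball_def)

lemma growth_eq: "growth G S n = card (word_ball n)"
  by (simp add: growth_def word_ball_def)

lemma sum_sq_right_mult_le:
  assumes "grad_sq G S u summable_on carrier G" "g \<in> word_ball n" "finite A" "A \<subseteq> carrier G"
  shows "(\<Sum>x\<in>A. (u (x \<otimes> g) - u x)\<^sup>2) \<le> (real n)\<^sup>2 * (D12_norm G S u)\<^sup>2"
proof -
  have g: "g \<in> carrier G" "word_dist G S \<one> g \<le> n" using assms by (auto simp: word_ball_def)
  have "L2_set (\<lambda>x. u (x \<otimes> g) - u x) A \<le> real (word_dist G S \<one> g) * D12_norm G S u"
    by (rule L2_set_right_mult_path[OF assms(1) word_dist_path]) (use assms g in auto)
  also have "\<dots> \<le> real n * D12_norm G S u"
    using g by (intro mult_right_mono) auto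
  finally have "(L2_set (\<lambda>x. u (x \<otimes> g) - u x) A)\<^sup>2 \<le> (real n * D12_norm G S u)\<^sup>2"
    by (intro power_mono) auto
  then show ?thesis by (simp add: L2_set_def sum_nonneg power_mult_distrib)
qed

end

locale polynomial_growth_cayley_graph = cayley_graph +
  fixes N :: nat
  assumes growth: "polynomial_growth G S N" and N3: "N \<ge> 3"
begin

lemma growth_lower:
  obtains C where "C > 0" "\<And>n. n \<ge> 1 \<Longrightarrow> C * real n ^ N \<le> real (growth G S n)"
  using growth unfolding polynomial_growth_def by blast

text \<open>The lower volume bound makes \<open>card\<close> positive, and \<open>card\<close> of an
  infinite set is 0. Radius 0 is left out because the growth bounds start at radius 1.\<close>

lemma finite_word_ball: "n \<ge> 1 \<Longrightarrow> finite (word_ball n)"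
proof -
  assume n: "n \<ge> 1"
  obtain C where C: "C > 0" "\<And>n. n \<ge> 1 \<Longrightarrow> C * real n ^ N \<le> real (growth G S n)"
    using growth_lower by blast
  have "0 < C * real n ^ N" using C n by simp
  also have "\<dots> \<le> real (growth G S n)" using C n by blast
  finally show ?thesis by (metis card.infinite growth_eq less_irrefl of_nat_0)
qed

lemma radius_of_volume:
  obtains C where "C > 0"
    "\<And>M. M \<ge> 1 \<Longrightarrow> \<exists>n\<ge>1. M \<le> real (card (word_ball n)) \<and> real n \<le> C * M powr (1 / real N)"
proof -
  obtain c where c: "c > 0" "\<And>n. n \<ge> 1 \<Longrightarrow> c * real n ^ N \<le> real (growth G S n)"
    using growth_lower by blast
  \<comment> \<open>The summand 1 absorbs rounding the radius up to an integer, since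
    \<open>1 \<le> M powr (1 / real N)\<close>.\<close>
  define C where "C = (1 / c) powr (1 / real N) + 1"
  have N: "N > 0" using N3 by simp
  have "\<exists>n\<ge>1. M \<le> real (card (word_ball n)) \<and> real n \<le> C * M powr (1 / real N)" if "M \<ge> 1" for M
  proof -
    define x where "x = (M / c) powr (1 / real N)"
    define n where "n = nat \<lceil>x\<rceil>"
    have x: "x > 0" using that c by (simp add: x_def)
    then have n: "n \<ge> 1" "x \<le> real n" "real n \<le> x + 1" by (auto simp: n_def) linarith+
    have "M = c * x ^ N"
      using that c N x by (simp add: x_def powr_realpow[symmetric] powr_powr)
    also have "\<dots> \<le> c * real n ^ N" using c x n by (intro mult_left_mono power_mono) auto
    also have "\<dots> \<le> real (card (word_ball n))" using c n by (simp add: growth_eq)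
    finally have 1: "M \<le> real (card (word_ball n))" .
    have "x = (1 / c) powr (1 / real N) * M powr (1 / real N)"
      using that c by (simp add: x_def powr_mult[symmetric])
    moreover have "1 \<le> M powr (1 / real N)" using that by (simp add: ge_one_powr_ge_zero)
    ultimately have "real n \<le> C * M powr (1 / real N)"
      using n unfolding C_def by (simp add: distrib_right)
    with 1 n show ?thesis by blast
  qed
  moreover have "C > 0" by (simp add: C_def add_nonneg_pos)
  ultimately show ?thesis using that by blast
qed

end

section \<open>Sobolev inequality\<close>

lemma sum_power2_le_power2_sum:
  fixes d :: "'i \<Rightarrow> real"
  assumes "\<And>i. i \<in> J \<Longrightarrow> 0 \<le> d i" "finite J"
  shows "(\<Sum>i\<in>J. (d i)\<^sup>2) \<le> (\<Sum>i\<in>J. d i)\<^sup>2"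
proof -
  have "(\<Sum>i\<in>J. (d i)\<^sup>2) \<le> (\<Sum>i\<in>J. d i * (\<Sum>j\<in>J. d j))"
    using assms by (intro sum_mono) (auto simp: power2_eq_square intro!: mult_left_mono member_le_sum)
  then show ?thesis by (simp add: power2_eq_square sum_distrib_right)
qed

lemma has_sum_sum_finite:
  fixes f :: "'i \<Rightarrow> 'a \<Rightarrow> 'b::topological_comm_monoid_add"
  assumes "finite J" "\<And>i. i \<in> J \<Longrightarrow> (f i has_sum s i) A"
  shows "((\<lambda>x. \<Sum>i\<in>J. f i x) has_sum (\<Sum>i\<in>J. s i)) A"
  using assms by (induction J rule: finite_induct) (auto intro: has_sum_add)

text \<open>The truncation of \<open>a - 2 powr k\<close> to the interval from 0 to
  \<open>2 powr k\<close>, as in Maz'ya's truncation method; written as a difference of two minima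
  it telescopes in \<open>k\<close>.\<close>

definition slab :: "int \<Rightarrow> real \<Rightarrow> real" where
  "slab k a = min a (2 powr (real_of_int k + 1)) - min a (2 powr real_of_int k)"

lemma slab_mono: "b \<le> a \<Longrightarrow> slab k b \<le> slab k a"
proof -
  have "2 powr (real_of_int k + 1) = 2 * 2 powr real_of_int k" by (simp add: powr_add)
  then show "b \<le> a \<Longrightarrow> slab k b \<le> slab k a" using powr_gt_zero[of 2 "real_of_int k"] unfolding slab_def by linarith
qed

lemma slab_eq_0: "a \<le> 2 powr real_of_int k \<Longrightarrow> slab k a = 0"
proof -
  have "2 powr (real_of_int k + 1) = 2 * 2 powr real_of_int k" by (simp add: powr_add)
  then show "a \<le> 2 powr real_of_int k \<Longrightarrow> slab k a = 0" using powr_gt_zero[of 2 "real_of_int k"] unfolding slab_def by linarith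
qed

lemma slab_eq_max: "2 powr (real_of_int k + 1) \<le> a \<Longrightarrow> slab k a = 2 powr real_of_int k"
proof -
  have "2 powr (real_of_int k + 1) = 2 * 2 powr real_of_int k" by (simp add: powr_add)
  then show "2 powr (real_of_int k + 1) \<le> a \<Longrightarrow> slab k a = 2 powr real_of_int k"
    using powr_gt_zero[of 2 "real_of_int k"] unfolding slab_def by linarith
qed

lemma sum_slab:
  "(\<Sum>k\<in>{m..<m + int n}. slab k a) =
     min a (2 powr (real_of_int m + real n)) - min a (2 powr real_of_int m)"
proof (induction n)
  case (Suc n)
  have "{m..<m + int (Suc n)} = insert (m + int n) {m..<m + int n}" by auto
  then show ?case using Suc by (simp add: slab_def add_ac)
qed simp

text \<open>The increments of all slabs have the same sign and telescope to at most
  \<open>a - b\<close>; for numbers of one sign the sum of squares is at most the square of the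
  sum.\<close>

lemma sum_slab_diff_power2_le:
  assumes "finite J"
  shows "(\<Sum>k\<in>J. (slab k a - slab k b)\<^sup>2) \<le> (a - b)\<^sup>2"
proof -
  have *: "(\<Sum>k\<in>J. (slab k a - slab k b)\<^sup>2) \<le> (a - b)\<^sup>2" if "b \<le> a" for a b
  proof -
    \<comment> \<open>Telescoping needs consecutive indices. Inserting 0 keeps \<open>Min\<close>
      and \<open>Max\<close> meaningful when \<open>J\<close> is empty.\<close>
    obtain m n where J: "J \<subseteq> {m..<m + int n}"
    proof -
      have "J \<subseteq> {Min (insert 0 J)..<Min (insert 0 J) + int (nat (Max (insert 0 J) + 1 - Min (insert 0 J)))}"
        using assms by (auto simp: Min_le) (smt (verit) Max_ge Min_le finite.insertI insertI1 insertI2 int_nat_eq)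
      then show ?thesis using that by blast
    qed
    have "(\<Sum>k\<in>J. slab k a - slab k b) \<le> (\<Sum>k\<in>{m..<m + int n}. slab k a - slab k b)"
      using J slab_mono[OF that] by (intro sum_mono2) auto
    also have "\<dots> = (min a (2 powr (real_of_int m + real n)) - min b (2 powr (real_of_int m + real n)))
        - (min a (2 powr real_of_int m) - min b (2 powr real_of_int m))"
      by (simp add: sum_subtractf sum_slab)
    also have "\<dots> \<le> a - b" using that by (auto simp: min_def)
    finally have "(\<Sum>k\<in>J. slab k a - slab k b) \<le> a - b" .
    moreover have "0 \<le> (\<Sum>k\<in>J. slab k a - slab k b)"
      using slab_mono[OF that] by (intro sum_nonneg) auto
    ultimately have "(\<Sum>k\<in>J. slab k a - slab k b)\<^sup>2 \<le> (a - b)\<^sup>2"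
      by (rule power_mono)
    moreover have "(\<Sum>k\<in>J. (slab k a - slab k b)\<^sup>2) \<le> (\<Sum>k\<in>J. slab k a - slab k b)\<^sup>2"
      using assms slab_mono[OF that] by (intro sum_power2_le_power2_sum) auto
    ultimately show ?thesis by linarith
  qed
  show ?thesis
    using *[of b a] *[of a b] by (cases "b \<le> a") (auto simp: power2_commute)
qed

section \<open>Dirichlet energy of dyadic truncations\<close>

context cayley_graph
begin

lemma sum_grad_sq_slab_le:
  assumes "x \<in> carrier G" "finite J"
  shows "(\<Sum>k\<in>J. grad_sq G S (\<lambda>x. slab k \<bar>u x\<bar>) x) \<le> grad_sq G S u x"
proof -
  have "(\<Sum>k\<in>J. grad_sq G S (\<lambda>x. slab k \<bar>u x\<bar>) x)
      = (\<Sum>s\<in>S. \<Sum>k\<in>J. (slab k \<bar>u (x \<otimes> s)\<bar> - slab k \<bar>u x\<bar>)\<^sup>2)"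
    using assms by (simp add: grad_sq_eq sum.swap[of _ S])
  also have "\<dots> \<le> (\<Sum>s\<in>S. (\<bar>u (x \<otimes> s)\<bar> - \<bar>u x\<bar>)\<^sup>2)"
    by (intro sum_mono sum_slab_diff_power2_le assms)
  also have "\<dots> \<le> (\<Sum>s\<in>S. (u (x \<otimes> s) - u x)\<^sup>2)"
    by (intro sum_mono) (metis abs_triangle_ineq3 power2_le_iff_abs_le power2_abs abs_le_square_iff)
  finally show ?thesis using assms by (simp add: grad_sq_eq)
qed

lemma summable_grad_sq_slab:
  assumes "grad_sq G S u summable_on carrier G"
  shows "grad_sq G S (\<lambda>x. slab k \<bar>u x\<bar>) summable_on carrier G"
  using sum_grad_sq_slab_le[of _ "{k}" u]
  by (intro summable_on_comparison_test[OF assms]) auto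

lemma sum_D12_norm_slab_le:
  assumes "grad_sq G S u summable_on carrier G" "finite J"
  shows "(\<Sum>k\<in>J. (D12_norm G S (\<lambda>x. slab k \<bar>u x\<bar>))\<^sup>2) \<le> (D12_norm G S u)\<^sup>2"
proof -
  have "(\<Sum>k\<in>J. (D12_norm G S (\<lambda>x. slab k \<bar>u x\<bar>))\<^sup>2)
      = (\<Sum>\<^sub>\<infinity>x\<in>carrier G. \<Sum>k\<in>J. grad_sq G S (\<lambda>x. slab k \<bar>u x\<bar>) x)"
    unfolding D12_norm_power2 using assms
    by (intro infsumI[symmetric] has_sum_sum_finite has_sum_infsum summable_grad_sq_slab)
  also have "\<dots> \<le> (\<Sum>\<^sub>\<infinity>x\<in>carrier G. grad_sq G S u x)"
    using assms by (intro infsum_mono sum_grad_sq_slab_le summable_on_comparison_test[OF assms(1)] sum_nonneg) auto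
  finally show ?thesis by (simp add: D12_norm_power2)
qed

end

context polynomial_growth_cayley_graph
begin

text \<open>A Faber--Krahn inequality: for \<open>x\<close> in \<open>B\<close>, at least half of the translates \<open>x \<otimes> g\<close>, with \<open>g\<close>
  in a word ball of volume at least \<open>2 * card A\<close>, leave \<open>A\<close>.\<close>

lemma faber_krahn:
  obtains C where "C > 0"
    "\<And>f A B h. \<lbrakk>grad_sq G S f summable_on carrier G; finite A; A \<subseteq> carrier G;
        \<And>x. x \<in> carrier G - A \<Longrightarrow> f x = 0; B \<subseteq> A; \<And>x. x \<in> B \<Longrightarrow> f x = h\<rbrakk> \<Longrightarrow>
      real (card B) * h\<^sup>2 \<le> C * real (card A) powr (2 / real N) * (D12_norm G S f)\<^sup>2"
proof -
  obtain C0 where C0: "C0 > 0"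
    "\<And>M. M \<ge> 1 \<Longrightarrow> \<exists>n\<ge>1. M \<le> real (card (word_ball n)) \<and> real n \<le> C0 * M powr (1 / real N)"
    using radius_of_volume by blast
  define C where "C = 2 * (C0 * 2 powr (1 / real N))\<^sup>2"
  have "real (card B) * h\<^sup>2 \<le> C * real (card A) powr (2 / real N) * (D12_norm G S f)\<^sup>2"
    if f: "grad_sq G S f summable_on carrier G" and A: "finite A" "A \<subseteq> carrier G"
      and f0: "\<And>x. x \<in> carrier G - A \<Longrightarrow> f x = 0" and B: "B \<subseteq> A" and fh: "\<And>x. x \<in> B \<Longrightarrow> f x = h"
    for f A B h
  proof (cases "A = {}")
    case True
    then show ?thesis using B by simp
  next
    case False
    then have "card A \<ge> 1" using A by (simp add: Suc_le_eq card_gt_0_iff)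
    then obtain n where n: "n \<ge> 1" "2 * real (card A) \<le> real (card (word_ball n))"
      "real n \<le> C0 * (2 * real (card A)) powr (1 / real N)"
      using C0(2)[of "2 * real (card A)"] by auto
    define W where "W = word_ball n"
    have W: "finite W" "W \<subseteq> carrier G" "card W > 0"
      using n finite_word_ball \<open>card A \<ge> 1\<close> by (auto simp: W_def word_ball_carrier)
    have "real (card W) / 2 * h\<^sup>2 \<le> (\<Sum>g\<in>W. (f (x \<otimes> g) - f x)\<^sup>2)" if x: "x \<in> B" for x
    proof -
      have xc: "x \<in> carrier G" using x A B by auto
      define V where "V = {g \<in> W. x \<otimes> g \<in> A}"
      have "inj_on (\<lambda>g. x \<otimes> g) V"
        using W xc by (auto simp: V_def subset_iff intro!: inj_onI)
      then have "card V \<le> card A" by (rule card_inj_on_le) (auto simp: V_def A)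
      moreover have "card (W - V) = card W - card V" using W by (intro card_Diff_subset) (auto simp: V_def)
      ultimately have "real (card W) / 2 \<le> real (card (W - V))" using n unfolding W_def by simp
      then have "real (card W) / 2 * h\<^sup>2 \<le> real (card (W - V)) * h\<^sup>2" by (rule mult_right_mono) simp
      also have "\<dots> = (\<Sum>g\<in>W - V. (f (x \<otimes> g) - f x)\<^sup>2)"
        using fh[OF x] W xc by (simp add: V_def f0 subset_iff)
      also have "\<dots> \<le> (\<Sum>g\<in>W. (f (x \<otimes> g) - f x)\<^sup>2)"
        using W by (intro sum_mono2) auto
      finally show ?thesis .
    qed
    \<comment> \<open>The double sum over \<open>B\<close> and \<open>W\<close> is bounded below for
      each \<open>x\<close> and, after exchanging the sums, above for each \<open>g\<close>;
      dividing by \<open>card W\<close> leaves only the radius of the ball.\<close>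
    then have "real (card B) * (real (card W) / 2 * h\<^sup>2) \<le> (\<Sum>x\<in>B. \<Sum>g\<in>W. (f (x \<otimes> g) - f x)\<^sup>2)"
      by (rule sum_bounded_below)
    also have "\<dots> = (\<Sum>g\<in>W. \<Sum>x\<in>B. (f (x \<otimes> g) - f x)\<^sup>2)" by (rule sum.swap)
    also have "\<dots> \<le> (\<Sum>g\<in>W. (real n)\<^sup>2 * (D12_norm G S f)\<^sup>2)"
      using A B by (intro sum_mono sum_sq_right_mult_le f) (auto simp: W_def intro: finite_subset)
    finally have "real (card W) * (real (card B) * h\<^sup>2)
        \<le> real (card W) * (2 * (real n)\<^sup>2 * (D12_norm G S f)\<^sup>2)"
      by (simp add: mult_ac)
    then have "real (card B) * h\<^sup>2 \<le> 2 * (real n)\<^sup>2 * (D12_norm G S f)\<^sup>2"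
      using W(3) by (simp only: mult_le_cancel_left_pos of_nat_0_less_iff)
    also have "\<dots> \<le> 2 * (C0 * (2 * real (card A)) powr (1 / real N))\<^sup>2 * (D12_norm G S f)\<^sup>2"
      using n by (intro mult_right_mono mult_left_mono power_mono) auto
    also have "\<dots> = C * real (card A) powr (2 / real N) * (D12_norm G S f)\<^sup>2"
      by (simp add: C_def powr_mult power_mult_distrib power2_eq_square powr_add[symmetric])
    finally show ?thesis .
  qed
  moreover have "C > 0" using C0 by (simp add: C_def)
  ultimately show ?thesis using that by blast
qed

abbreviation crit :: real where "crit \<equiv> 2 * real N / (real N - 2)"

lemma crit_gt_2: "crit > 2"
  using N3 by (simp add: field_simps)

text \<open>The truncations of \<open>\<bar>u\<bar>\<close> to dyadic slabs have Dirichlet energies adding up to at most that of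
  \<open>u\<close>; applying the Faber--Krahn inequality to each of them bounds the dyadic level sets.\<close>

theorem sobolev:
  obtains C where "C > 0"
    "\<And>u. u \<in> D12 G S N \<Longrightarrow>
       (\<Sum>\<^sub>\<infinity>x\<in>carrier G. \<bar>u x\<bar> powr crit) \<le> C * ((D12_norm G S u)\<^sup>2) powr (real N / (real N - 2))"
proof -
  obtain C0 where C0: "C0 > 0"
    "\<And>f A B h. \<lbrakk>grad_sq G S f summable_on carrier G; finite A; A \<subseteq> carrier G;
        \<And>x. x \<in> carrier G - A \<Longrightarrow> f x = 0; B \<subseteq> A; \<And>x. x \<in> B \<Longrightarrow> f x = h\<rbrakk> \<Longrightarrow>
      real (card B) * h\<^sup>2 \<le> C0 * real (card A) powr (2 / real N) * (D12_norm G S f)\<^sup>2"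
    using faber_krahn by blast
  define \<nu> where "\<nu> = real N / (real N - 2)"
  have crit_eq: "crit * (2 / real N) = crit - 2" "crit > 0"
    using N3 by (auto simp: field_simps)
  \<comment> \<open>One factor \<open>2 powr crit\<close> rounds \<open>\<bar>u x\<bar>\<close> up
    to the next power of 2, the other shifts the level from \<open>k\<close> to \<open>k + 1\<close>
    in \<open>step\<close>.\<close>
  define L where "L = 2 powr crit * (C0 * 2 powr crit)"
  have L: "L > 0" using C0 by (simp add: L_def)
  have "(\<Sum>\<^sub>\<infinity>x\<in>carrier G. \<bar>u x\<bar> powr crit) \<le> L powr \<nu> * ((D12_norm G S u)\<^sup>2) powr \<nu>"
    if u: "u \<in> D12 G S N" for u
  proof -
    define Z where "Z = (\<Sum>\<^sub>\<infinity>x\<in>carrier G. \<bar>u x\<bar> powr crit)"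
    define E where "E = (D12_norm G S u)\<^sup>2"
    have su: "(\<lambda>x. \<bar>u x\<bar> powr crit) summable_on carrier G" and
      gu: "grad_sq G S u summable_on carrier G"
      using u by (auto simp: D12_def ell_def)
    define A where "A k = {x \<in> carrier G. 2 powr real_of_int k < \<bar>u x\<bar>}" for k
    define a where "a k = real (card (A k)) * 2 powr (crit * real_of_int k)" for k
    define e where "e k = (D12_norm G S (\<lambda>x. slab k \<bar>u x\<bar>))\<^sup>2" for k
    have A: "finite (A k)" and aZ: "a k \<le> Z" for k
    proof -
      let ?c = "2 powr (crit * real_of_int k)"
      have sub: "A k \<subseteq> {x \<in> carrier G. ?c \<le> \<bar>u x\<bar> powr crit}"
      proof
        fix x assume x: "x \<in> A k"
        have "?c = (2 powr real_of_int k) powr crit" by (simp add: powr_powr mult.commute)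
        also have "\<dots> \<le> \<bar>u x\<bar> powr crit" using x crit_eq by (intro powr_mono2) (auto simp: A_def)
        finally show "x \<in> {x \<in> carrier G. ?c \<le> \<bar>u x\<bar> powr crit}" using x by (simp add: A_def)
      qed
      have fin: "finite {x \<in> carrier G. ?c \<le> \<bar>u x\<bar> powr crit}"
        and le: "real (card {x \<in> carrier G. ?c \<le> \<bar>u x\<bar> powr crit}) * ?c \<le> Z"
        unfolding Z_def by (rule summable_on_finite_super_level[OF su]; simp)+
      show "finite (A k)" using sub fin by (rule finite_subset)
      have "a k \<le> real (card {x \<in> carrier G. ?c \<le> \<bar>u x\<bar> powr crit}) * ?c"
        unfolding a_def using card_mono[OF fin sub] by (intro mult_right_mono) auto
      with le show "a k \<le> Z" by linarith
    qed
    have Z0: "Z \<ge> 0" unfolding Z_def by (rule infsum_nonneg) simp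
    \<comment> \<open>Slab \<open>k\<close> vanishes off \<open>A k\<close> and equals
      \<open>2 powr k\<close> on \<open>A (k + 1)\<close>. The weight in \<open>a\<close> is the one
      for which the powers of \<open>2 powr k\<close> cancel, by
      \<open>crit * (2 / N) = crit - 2\<close>; the volume factor is then at most a power of
      \<open>Z\<close>, independently of \<open>k\<close>.\<close>
    have step: "a (k + 1) \<le> C0 * 2 powr crit * Z powr (2 / real N) * e k" for k
    proof -
      have 1: "real (card (A (k + 1))) * (2 powr real_of_int k)\<^sup>2 \<le>
          C0 * real (card (A k)) powr (2 / real N) * e k"
        unfolding e_def
      proof (rule C0(2))
        show "grad_sq G S (\<lambda>x. slab k \<bar>u x\<bar>) summable_on carrier G"
          by (rule summable_grad_sq_slab[OF gu])
        show "finite (A k)" by (rule A)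
        show "A (k + 1) \<subseteq> A k"
        proof
          fix x assume "x \<in> A (k + 1)"
          moreover have "2 powr (real_of_int k + 1) = 2 * 2 powr real_of_int k" by (simp add: powr_add)
          ultimately show "x \<in> A k" using powr_gt_zero[of 2 "real_of_int k"]
            unfolding A_def mem_Collect_eq of_int_add of_int_1 by linarith
        qed
      qed (auto simp: A_def intro!: slab_eq_0 slab_eq_max)
      have eq: "2 powr (crit * real_of_int (k + 1))
          = (2 powr real_of_int k)\<^sup>2 * (2 powr crit * 2 powr (crit * real_of_int k * (2 / real N)))"
      proof -
        have "crit * real_of_int (k + 1) = 2 * real_of_int k + (crit + crit * real_of_int k * (2 / real N))"
        proof -
          have "c * (y + 1) = 2 * y + (c + c * y * m)" if "c * m = c - 2" for c y m :: real
          proof -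
            have "c * y * m = (c - 2) * y" using that by (metis mult.assoc mult.commute)
            then show ?thesis by (simp add: algebra_simps)
          qed
          from this[OF crit_eq(1)] show ?thesis by simp
        qed
        then show ?thesis
          by (simp only: powr_add[symmetric] powr_power) (simp add: powr_add[symmetric] powr_power mult.commute)
      qed
      have "a (k + 1) = real (card (A (k + 1))) * (2 powr real_of_int k)\<^sup>2
          * (2 powr crit * 2 powr (crit * real_of_int k * (2 / real N)))"
        unfolding a_def eq by (simp only: mult.assoc)
      also have "\<dots> \<le> C0 * real (card (A k)) powr (2 / real N) * e k
          * (2 powr crit * 2 powr (crit * real_of_int k * (2 / real N)))"
        by (intro mult_right_mono 1) auto
      also have "\<dots> = C0 * 2 powr crit * (a k) powr (2 / real N) * e k"
        unfolding a_def by (simp add: powr_mult powr_powr mult_ac)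
      also have "\<dots> \<le> C0 * 2 powr crit * Z powr (2 / real N) * e k"
        using C0 aZ[of k] by (intro mult_right_mono mult_left_mono powr_mono2) (auto simp: a_def e_def)
      finally show ?thesis .
    qed
    have "Z \<le> L * Z powr (2 / real N) * E"
      unfolding Z_def
    proof (rule infsum_le_finite_sums[OF su])
      fix F assume F: "finite F" "F \<subseteq> carrier G"
      define F0 where "F0 = {x \<in> F. u x \<noteq> 0}"
      \<comment> \<open>The ceiling minus 1 puts \<open>\<bar>u x\<bar>\<close> into an interval
        open on the left and closed on the right, matching the strict inequality in
        \<open>A k\<close>.\<close>
      define \<kappa> where "\<kappa> x = \<lceil>log 2 \<bar>u x\<bar>\<rceil> - 1" for x
      have \<kappa>: "2 powr real_of_int (\<kappa> x) < \<bar>u x\<bar>" "\<bar>u x\<bar> \<le> 2 powr (real_of_int (\<kappa> x) + 1)"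
        if "x \<in> F0" for x
      proof -
        have "\<bar>u x\<bar> = 2 powr (log 2 \<bar>u x\<bar>)" using that by (simp add: F0_def)
        moreover have "real_of_int (\<kappa> x) < log 2 \<bar>u x\<bar>" "log 2 \<bar>u x\<bar> \<le> real_of_int (\<kappa> x) + 1"
          unfolding \<kappa>_def by linarith+
        ultimately show "2 powr real_of_int (\<kappa> x) < \<bar>u x\<bar>" "\<bar>u x\<bar> \<le> 2 powr (real_of_int (\<kappa> x) + 1)"
          by (metis one_less_numeral_iff powr_less_cancel_iff semiring_norm(76))
             (metis \<open>\<bar>u x\<bar> = 2 powr (log 2 \<bar>u x\<bar>)\<close> \<open>log 2 \<bar>u x\<bar> \<le> real_of_int (\<kappa> x) + 1\<close>
                one_le_numeral powr_mono)
      qed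
      have F0: "finite F0" using F by (simp add: F0_def)
      define J where "J = \<kappa> ` F0"
      have J: "finite J" using F0 by (simp add: J_def)
      have "(\<Sum>x\<in>F. \<bar>u x\<bar> powr crit) = (\<Sum>x\<in>F0. \<bar>u x\<bar> powr crit)"
        unfolding F0_def using F by (intro sum.mono_neutral_right) auto
      also have "\<dots> \<le> (\<Sum>x\<in>F0. 2 powr crit * 2 powr (crit * real_of_int (\<kappa> x)))"
      proof (rule sum_mono)
        fix x assume x: "x \<in> F0"
        have "\<bar>u x\<bar> powr crit \<le> (2 powr (real_of_int (\<kappa> x) + 1)) powr crit"
          using \<kappa>[OF x] crit_eq by (intro powr_mono2) auto
        also have "\<dots> = 2 powr crit * 2 powr (crit * real_of_int (\<kappa> x))"
          by (simp only: powr_powr powr_add[symmetric] distrib_right mult_1 add.commute mult.commute)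
        finally show "\<bar>u x\<bar> powr crit \<le> 2 powr crit * 2 powr (crit * real_of_int (\<kappa> x))" .
      qed
      also have "\<dots> = (\<Sum>k\<in>J. \<Sum>x\<in>{x\<in>F0. \<kappa> x = k}. 2 powr crit * 2 powr (crit * real_of_int (\<kappa> x)))"
        unfolding J_def by (rule sum.image_gen[OF F0])
      also have "\<dots> \<le> (\<Sum>k\<in>J. 2 powr crit * a k)"
      proof (rule sum_mono)
        fix k assume "k \<in> J"
        have "card {x\<in>F0. \<kappa> x = k} \<le> card (A k)"
          using \<kappa> F by (intro card_mono A) (auto simp: A_def F0_def)
        then have "real (card {x\<in>F0. \<kappa> x = k}) * (2 powr crit * 2 powr (crit * real_of_int k))
            \<le> real (card (A k)) * (2 powr crit * 2 powr (crit * real_of_int k))"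
          by (intro mult_right_mono) auto
        then show "(\<Sum>x\<in>{x\<in>F0. \<kappa> x = k}. 2 powr crit * 2 powr (crit * real_of_int (\<kappa> x))) \<le> 2 powr crit * a k"
          by (simp add: a_def mult_ac)
      qed
      also have "\<dots> \<le> (\<Sum>k\<in>J. 2 powr crit * (C0 * 2 powr crit * Z powr (2 / real N) * e (k - 1)))"
      proof (intro sum_mono mult_left_mono)
        fix k show "a k \<le> C0 * 2 powr crit * Z powr (2 / real N) * e (k - 1)" using step[of "k - 1"] by simp
      qed auto
      also have "\<dots> = L * Z powr (2 / real N) * (\<Sum>k\<in>J. e (k - 1))"
        unfolding L_def by (subst sum_distrib_left) (simp only: mult_ac)
      also have "(\<Sum>k\<in>J. e (k - 1)) = (\<Sum>k\<in>(\<lambda>k. k - 1) ` J. e k)"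
        by (subst sum.reindex) (auto intro: inj_onI)
      also have "L * Z powr (2 / real N) * \<dots> \<le> L * Z powr (2 / real N) * E"
        unfolding e_def E_def using J L by (intro mult_left_mono sum_D12_norm_slab_le gu) auto
      finally show "(\<Sum>x\<in>F. \<bar>u x\<bar> powr crit) \<le> L * (\<Sum>\<^sub>\<infinity>x\<in>carrier G. \<bar>u x\<bar> powr crit) powr (2 / real N) * E"
        by (simp add: Z_def)
    qed
    \<comment> \<open>\<open>Z\<close> is a finite sum since \<open>u\<close> lies in
      \<open>ell G crit\<close>, so a power of it may be cancelled; \<open>\<nu>\<close> is the
      reciprocal of \<open>1 - 2 / real N\<close>.\<close>
    have "Z \<le> (L * E) powr \<nu>"
    proof (cases "Z = 0")
      case False
      then have Z: "Z > 0" using Z0 by simp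
      have "Z powr (1 - 2 / real N) * Z powr (2 / real N) \<le> (L * E) * Z powr (2 / real N)"
        using \<open>Z \<le> L * Z powr (2 / real N) * E\<close> Z by (simp add: powr_add[symmetric] mult_ac)
      then have "Z powr (1 - 2 / real N) \<le> L * E" using Z by simp
      then have "(Z powr (1 - 2 / real N)) powr \<nu> \<le> (L * E) powr \<nu>"
        using N3 by (intro powr_mono2) (auto simp: \<nu>_def)
      moreover have "(1 - 2 / real N) * \<nu> = 1" using N3 by (simp add: \<nu>_def field_simps)
      ultimately show ?thesis using Z by (simp add: powr_powr)
    qed simp
    also have "\<dots> = L powr \<nu> * E powr \<nu>" using L by (simp add: powr_mult E_def)
    finally show ?thesis by (simp add: Z_def E_def)
  qed
  moreover have "L powr \<nu> > 0" using L by simp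
  ultimately show ?thesis using that unfolding \<nu>_def by blast
qed

end

section \<open>Lazy random walk and its decay\<close>

context polynomial_growth_cayley_graph
begin

text \<open>A subset of \<open>{\<one>}\<close> generates the trivial group, which cannot grow. The
  generator gives \<open>deg > 0\<close>, and two distinct adjacent points for the positivity of the
  supremum.\<close>

lemma nontrivial_generator:
  obtains s where "s \<in> S" "s \<noteq> \<one>"
proof -
  have "\<not> S \<subseteq> {\<one>}"
  proof
    assume "S \<subseteq> {\<one>}"
    then have "S = {} \<or> S = {\<one>}" by auto
    then have "carrier G = {\<one>}" using generate_S generate_empty generate_one by metis
    then have *: "growth G S n \<le> 1" for n
      unfolding growth_def by (metis (no_types, lifting) card.insert card_mono empty_iff finite.emptyI
          finite.insertI mem_Collect_eq One_nat_def card.empty subsetI)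
    obtain C where C: "C > 0" "\<And>n. n \<ge> 1 \<Longrightarrow> C * real n ^ N \<le> real (growth G S n)"
      using growth_lower by blast
    obtain n :: nat where n: "1 / C < real n" using reals_Archimedean2 by blast
    then have n1: "n \<ge> 1" using C(1) by (cases n) (auto simp: field_simps)
    have "real n \<le> real n ^ N" using n1 N3 self_le_power[of "real n" N] by simp
    moreover have "C * real n ^ N \<le> 1" using C(2)[OF n1] *[of n] by linarith
    ultimately have "C * real n \<le> 1" using C(1) by (meson mult_left_mono order_trans less_imp_le)
    then show False using n C(1) by (simp add: field_simps)
  qed
  then show ?thesis using that by blast
qed

lemma S_nonempty: "S \<noteq> {}"
  using nontrivial_generator by blast

abbreviation deg :: real where "deg \<equiv> real (card S)"

lemma deg_pos: "deg > 0"
  using S_nonempty finite_S by (simp add: card_gt_0_iff)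

text \<open>The lazy walk has \<open>\<Delta> = 2 * deg * (lazy - 1)\<close>, and laziness avoids parity obstructions in the
  decay of its transition probabilities.\<close>

definition lazy :: "('a \<Rightarrow> real) \<Rightarrow> 'a \<Rightarrow> real" where
  "lazy u x = u x + laplacian G S u x / (2 * deg)"

definition walk :: "nat \<Rightarrow> 'a \<Rightarrow> real" where
  "walk k = (lazy ^^ k) (indicator {\<one>})"

lemma lazy_eq:
  "x \<in> carrier G \<Longrightarrow> lazy u x = (\<Sum>s\<in>S. u x + u (x \<otimes> s)) / (2 * deg)"
  using deg_pos by (simp add: lazy_def laplacian_eq sum_subtractf sum.distrib field_simps)

lemma walk_0: "walk 0 x = indicator {\<one>} x"
  by (simp add: walk_def)

lemma walk_Suc:
  "x \<in> carrier G \<Longrightarrow> walk (Suc k) x = (\<Sum>s\<in>S. walk k x + walk k (x \<otimes> s)) / (2 * deg)"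
  by (simp add: walk_def lazy_eq)

text \<open>Steps multiply on the right, so the walk started at \<open>y\<close> is a left translate
  of the walk started at \<open>\<one>\<close>.\<close>

lemma lazy_power_indicator:
  "x \<in> carrier G \<Longrightarrow> y \<in> carrier G \<Longrightarrow> (lazy ^^ k) (indicator {y}) x = walk k (inv y \<otimes> x)"
proof (induction k arbitrary: x)
  case 0
  have "inv y \<otimes> x = \<one> \<longleftrightarrow> x = y"
    using 0 by (metis inv_closed inv_equality inv_inv l_inv)
  then show ?case by (simp add: walk_0 indicator_def)
next
  case (Suc k)
  have "inv y \<otimes> (x \<otimes> s) = inv y \<otimes> x \<otimes> s" if "s \<in> S" for s
    using Suc.prems that by (simp add: m_assoc)
  then show ?case using Suc by (simp add: lazy_eq walk_Suc)
qed

lemma walk_nonneg: "x \<in> carrier G \<Longrightarrow> 0 \<le> walk k x"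
  by (induction k arbitrary: x) (auto simp: walk_0 walk_Suc intro!: divide_nonneg_nonneg sum_nonneg)

text \<open>Steps on the left commute with steps on the right, so the induction only has to exchange
  two sums; the base case is that \<open>x \<otimes> s = \<one>\<close> and
  \<open>s \<otimes> x = \<one>\<close> are equivalent. Inversion exchanges the two sides, which is
  how \<open>walk_inv\<close> uses this.\<close>

lemma walk_Suc_left:
  "x \<in> carrier G \<Longrightarrow> walk (Suc k) x = (\<Sum>s\<in>S. walk k x + walk k (s \<otimes> x)) / (2 * deg)"
proof (induction k arbitrary: x)
  case 0
  have "x \<otimes> s = \<one> \<longleftrightarrow> s \<otimes> x = \<one>" if "s \<in> S" for s
    using 0 that by (metis S_carrier inv_comm)
  then show ?case using 0 by (simp add: walk_Suc walk_0 indicator_def)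
next
  case (Suc k)
  have "walk (Suc (Suc k)) x = (\<Sum>s\<in>S. walk (Suc k) x + walk (Suc k) (x \<otimes> s)) / (2 * deg)"
    using Suc.prems by (rule walk_Suc)
  also have "\<dots> = (\<Sum>s\<in>S. (\<Sum>t\<in>S. walk k x + walk k (t \<otimes> x)) / (2 * deg)
      + (\<Sum>t\<in>S. walk k (x \<otimes> s) + walk k (t \<otimes> (x \<otimes> s))) / (2 * deg)) / (2 * deg)"
    using Suc by simp
  also have "\<dots> = (\<Sum>s\<in>S. \<Sum>t\<in>S. (walk k x + walk k (t \<otimes> x))
      + (walk k (x \<otimes> s) + walk k (t \<otimes> (x \<otimes> s)))) / (2 * deg) / (2 * deg)"
    by (simp add: add_divide_distrib[symmetric] sum_divide_distrib[symmetric] sum.distrib)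
  also have "(\<Sum>s\<in>S. \<Sum>t\<in>S. (walk k x + walk k (t \<otimes> x))
      + (walk k (x \<otimes> s) + walk k (t \<otimes> (x \<otimes> s))))
    = (\<Sum>t\<in>S. \<Sum>s\<in>S. (walk k x + walk k (x \<otimes> s))
      + (walk k (t \<otimes> x) + walk k (t \<otimes> x \<otimes> s)))"
    using Suc.prems by (subst sum.swap) (auto intro!: sum.cong simp: m_assoc)
  also have "\<dots> / (2 * deg) / (2 * deg) = (\<Sum>t\<in>S. (\<Sum>s\<in>S. walk k x + walk k (x \<otimes> s)) / (2 * deg)
      + (\<Sum>s\<in>S. walk k (t \<otimes> x) + walk k (t \<otimes> x \<otimes> s)) / (2 * deg)) / (2 * deg)"
    by (simp add: add_divide_distrib[symmetric] sum_divide_distrib[symmetric] sum.distrib)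
  also have "\<dots> = (\<Sum>s\<in>S. walk (Suc k) x + walk (Suc k) (s \<otimes> x)) / (2 * deg)"
    using Suc.prems by (simp add: walk_Suc)
  finally show ?case .
qed

lemma walk_inv: "x \<in> carrier G \<Longrightarrow> walk k (inv x) = walk k x"
proof (induction k arbitrary: x)
  case 0
  have "inv x = \<one> \<longleftrightarrow> x = \<one>" using 0 by (metis inv_inv inv_one)
  then show ?case by (simp add: walk_0 indicator_def)
next
  case (Suc k)
  have bij: "bij_betw (\<lambda>s. inv s) S S"
    by (rule bij_betw_byWitness[where f' = "\<lambda>s. inv s"]) (auto simp: inv_S)
  have "inv x \<otimes> s = inv (inv s \<otimes> x)" if "s \<in> S" for s
    using that Suc.prems by (simp add: inv_mult_group)
  then have "walk (Suc k) (inv x) = (\<Sum>s\<in>S. walk k x + walk k (inv s \<otimes> x)) / (2 * deg)"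
    using Suc by (simp add: walk_Suc)
  also have "(\<Sum>s\<in>S. walk k x + walk k (inv s \<otimes> x)) = (\<Sum>s\<in>S. walk k x + walk k (s \<otimes> x))"
    by (rule sum.reindex_bij_betw[OF bij])
  finally show ?case using Suc.prems by (simp add: walk_Suc_left)
qed

definition walk_support :: "nat \<Rightarrow> 'a set" where
  "walk_support k = {x \<in> carrier G. walk k x \<noteq> 0}"

text \<open>One step enlarges the support by finitely many points. Finite support makes sums with a
  factor \<open>walk k\<close> converge trivially, and later confines short walks to a finite set in
  \<open>kern_tail\<close>.\<close>

lemma finite_walk_support: "finite (walk_support k)"
proof (induction k)
  case 0
  have "walk_support 0 \<subseteq> {\<one>}" by (auto simp: walk_support_def walk_0 indicator_def)
  then show ?case by (rule finite_subset) simp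
next
  case (Suc k)
  have "walk_support (Suc k) \<subseteq> walk_support k \<union> (\<Union>s\<in>S. (\<lambda>x. x \<otimes> inv s) ` walk_support k)"
  proof
    fix x assume x: "x \<in> walk_support (Suc k)"
    then have xc: "x \<in> carrier G" and "(\<Sum>s\<in>S. walk k x + walk k (x \<otimes> s)) \<noteq> 0"
      by (auto simp: walk_support_def walk_Suc)
    then obtain s where s: "s \<in> S" "walk k x + walk k (x \<otimes> s) \<noteq> 0"
      by (meson sum.neutral)
    then have "walk k x \<noteq> 0 \<or> walk k (x \<otimes> s) \<noteq> 0" by auto
    then show "x \<in> walk_support k \<union> (\<Union>s\<in>S. (\<lambda>x. x \<otimes> inv s) ` walk_support k)"
    proof
      assume "walk k (x \<otimes> s) \<noteq> 0"
      then have "x \<otimes> s \<in> walk_support k" "x = x \<otimes> s \<otimes> inv s"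
        using xc s by (auto simp: walk_support_def m_assoc)
      then show ?thesis using s by blast
    qed (auto simp: walk_support_def xc)
  qed
  then show ?case by (rule finite_subset) (use Suc finite_S in auto)
qed

lemma summable_walk:
  "(\<And>x. x \<in> carrier G \<Longrightarrow> walk k x = 0 \<Longrightarrow> f x = 0) \<Longrightarrow> (f :: 'a \<Rightarrow> real) summable_on carrier G"
  by (rule finite_nonzero_values_imp_summable_on)
     (rule finite_subset[OF _ finite_walk_support[of k]], auto simp: walk_support_def)

lemma has_sum_right_mult:
  "g \<in> carrier G \<Longrightarrow> ((\<lambda>x. f (x \<otimes> g)) has_sum c) (carrier G) \<longleftrightarrow> (f has_sum c) (carrier G)"
  by (rule has_sum_reindex_bij_betw[OF bij_right_mult])

lemma has_sum_walk: "(walk k has_sum 1) (carrier G)"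
proof (induction k)
  case 0
  have "((\<lambda>x. 1 :: real) has_sum 1) {\<one>}" by (simp add: has_sum_finite_iff)
  then show ?case
    by (rule has_sum_cong_neutral[THEN iffD1, rotated -1]) (auto simp: walk_0 indicator_def)
next
  case (Suc k)
  have "((\<lambda>x. \<Sum>s\<in>S. walk k x + walk k (x \<otimes> s)) has_sum (\<Sum>s\<in>S. 1 + 1)) (carrier G)"
    using Suc finite_S by (intro has_sum_sum_finite has_sum_add) (auto simp: has_sum_right_mult)
  then have "((\<lambda>x. (\<Sum>s\<in>S. walk k x + walk k (x \<otimes> s)) / (2 * deg)) has_sum
      ((\<Sum>s\<in>S. 1 + 1) / (2 * deg))) (carrier G)"
    by (rule has_sum_divide_const)
  then show ?case using deg_pos by (simp add: has_sum_cong[of _ "walk (Suc k)"] walk_Suc)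
qed

lemma sum_walk_le_1: "finite F \<Longrightarrow> F \<subseteq> carrier G \<Longrightarrow> sum (walk k) F \<le> 1"
  using finite_sum_le_has_sum[OF has_sum_walk[of k]] walk_nonneg by auto

lemma walk_le_1: "x \<in> carrier G \<Longrightarrow> walk k x \<le> 1"
  using sum_walk_le_1[of "{x}"] by simp

text \<open>The Chapman-Kolmogorov equation in its left-invariant form, summed over the finite
  support of the first factor.\<close>

lemma walk_add:
  "z \<in> carrier G \<Longrightarrow> walk (j + k) z = (\<Sum>y\<in>walk_support j. walk j y * walk k (inv y \<otimes> z))"
proof (induction k arbitrary: z)
  case 0
  have "inv y \<otimes> z = \<one> \<longleftrightarrow> y = z" if "y \<in> walk_support j" for y
    using 0 that by (metis (lifting) inv_closed inv_equality inv_inv l_inv mem_Collect_eq walk_support_def)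
  then have "(\<Sum>y\<in>walk_support j. walk j y * walk 0 (inv y \<otimes> z)) = (\<Sum>y\<in>walk_support j. if y = z then walk j y else 0)"
    by (intro sum.cong) (auto simp: walk_0 indicator_def)
  then show ?case using 0 by (simp add: finite_walk_support) (auto simp: walk_support_def)
next
  case (Suc k)
  have *: "walk (Suc k) (inv y \<otimes> z)
      = (\<Sum>s\<in>S. walk k (inv y \<otimes> z) + walk k (inv y \<otimes> (z \<otimes> s))) / (2 * deg)"
    if "y \<in> walk_support j" for y
    using that Suc.prems by (simp add: walk_Suc walk_support_def m_assoc)
  have "(\<Sum>y\<in>walk_support j. walk j y * walk (Suc k) (inv y \<otimes> z))
      = (\<Sum>y\<in>walk_support j. \<Sum>s\<in>S. walk j y * walk k (inv y \<otimes> z) + walk j y * walk k (inv y \<otimes> (z \<otimes> s))) / (2 * deg)"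
    unfolding sum_divide_distrib[of _ "walk_support j"]
    by (rule sum.cong) (simp_all add: * sum_distrib_left distrib_left)
  also have "\<dots> = (\<Sum>s\<in>S. walk (j + k) z + walk (j + k) (z \<otimes> s)) / (2 * deg)"
    using Suc by (subst sum.swap) (simp add: sum.distrib)
  finally show ?case using Suc.prems by (simp add: walk_Suc)
qed

text \<open>The probability that two independent walks are at the same point after \<open>k\<close>
  steps; by symmetry and Chapman-Kolmogorov also the return probability after \<open>2 * k\<close>
  steps. It is the squared l^2 norm of Nash's argument.\<close>

definition collision :: "nat \<Rightarrow> real" where
  "collision k = (\<Sum>\<^sub>\<infinity>x\<in>carrier G. (walk k x)\<^sup>2)"

lemma summable_walk_power2: "(\<lambda>x. (walk k x)\<^sup>2) summable_on carrier G"
  by (rule summable_walk) simp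

lemma has_sum_walk_power2: "((\<lambda>x. (walk k x)\<^sup>2) has_sum collision k) (carrier G)"
  unfolding collision_def using summable_walk_power2 by (rule has_sum_infsum)

lemma sum_walk_power2_le: "finite F \<Longrightarrow> F \<subseteq> carrier G \<Longrightarrow> (\<Sum>x\<in>F. (walk k x)\<^sup>2) \<le> collision k"
  using finite_sum_le_has_sum[OF has_sum_walk_power2[of k]] by auto

text \<open>In the Chapman-Kolmogorov sum each product is at most half the sum of the squares, and
  both families of squares sum to at most \<open>collision k\<close>. Pointwise decay is thereby
  reduced to decay of \<open>collision\<close>.\<close>

lemma walk_even_le_collision:
  assumes "z \<in> carrier G"
  shows "walk (k + k) z \<le> collision k"
proof -
  let ?F = "walk_support k"
  have F: "finite ?F" "?F \<subseteq> carrier G"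
    by (rule finite_walk_support) (auto simp: walk_support_def)
  have "walk (k + k) z \<le> (\<Sum>y\<in>?F. ((walk k y)\<^sup>2 + (walk k (inv y \<otimes> z))\<^sup>2) / 2)"
    unfolding walk_add[OF assms]
  proof (rule sum_mono)
    fix y
    have "0 \<le> (walk k y - walk k (inv y \<otimes> z))\<^sup>2" by simp
    then show "walk k y * walk k (inv y \<otimes> z) \<le> ((walk k y)\<^sup>2 + (walk k (inv y \<otimes> z))\<^sup>2) / 2"
      by (simp add: power2_diff)
  qed
  also have "\<dots> = ((\<Sum>y\<in>?F. (walk k y)\<^sup>2) + (\<Sum>y\<in>?F. (walk k (inv y \<otimes> z))\<^sup>2)) / 2"
    by (simp add: sum.distrib sum_divide_distrib[symmetric])
  also have "(\<Sum>y\<in>?F. (walk k (inv y \<otimes> z))\<^sup>2) = (\<Sum>x\<in>(\<lambda>y. inv y \<otimes> z) ` ?F. (walk k x)\<^sup>2)"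
  proof (subst sum.reindex)
    show "inj_on (\<lambda>y. inv y \<otimes> z) ?F"
      using F assms by (intro inj_onI) (metis inv_closed inv_inv right_cancel subsetD)
  qed simp
  also have "((\<Sum>y\<in>?F. (walk k y)\<^sup>2) + \<dots>) / 2 \<le> (collision k + collision k) / 2"
    using F assms by (intro divide_right_mono add_mono sum_walk_power2_le) auto
  finally show ?thesis by simp
qed

lemma walk_odd_le_collision:
  assumes "z \<in> carrier G"
  shows "walk (Suc (k + k)) z \<le> collision k"
proof -
  have "(\<Sum>s\<in>S. walk (k + k) z + walk (k + k) (z \<otimes> s)) \<le> (\<Sum>s\<in>S. collision k + collision k)"
    using assms by (intro sum_mono add_mono walk_even_le_collision) auto
  then show ?thesis using assms deg_pos by (simp add: walk_Suc field_simps)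
qed

lemma summable_grad_sq_walk: "grad_sq G S (walk k) summable_on carrier G"
proof -
  have "((\<lambda>x. \<Sum>s\<in>S. 2 * (walk k (x \<otimes> s))\<^sup>2 + 2 * (walk k x)\<^sup>2) has_sum
      (\<Sum>s\<in>S. 2 * collision k + 2 * collision k)) (carrier G)"
    using finite_S by (intro has_sum_sum_finite has_sum_add has_sum_cmult_right)
       (auto intro: has_sum_walk_power2 simp: has_sum_right_mult[of _ "\<lambda>x. (walk k x)\<^sup>2"])
  then have "(\<lambda>x. \<Sum>s\<in>S. 2 * (walk k (x \<otimes> s))\<^sup>2 + 2 * (walk k x)\<^sup>2) summable_on carrier G"
    by (rule has_sum_imp_summable)
  then show ?thesis
  proof (rule summable_on_comparison_test)
    fix x assume x: "x \<in> carrier G"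
    have "(a - b)\<^sup>2 \<le> 2 * a\<^sup>2 + 2 * b\<^sup>2" for a b :: real
      using zero_le_power2[of "a + b"] by (simp add: power2_diff power2_sum)
    then show "grad_sq G S (walk k) x \<le> (\<Sum>s\<in>S. 2 * (walk k (x \<otimes> s))\<^sup>2 + 2 * (walk k x)\<^sup>2)"
      unfolding grad_sq_eq[OF x] by (intro sum_mono) auto
  qed auto
qed

text \<open>Jensen's inequality for the mean over \<open>S\<close>, then \<open>((a + b) /
  2)\<^sup>2 = (a\<^sup>2 + b\<^sup>2) / 2 - (a - b)\<^sup>2 / 4\<close>. The lazy half step is what
  provides the gradient term.\<close>

lemma collision_Suc_le:
  "collision (Suc k) \<le> collision k - (D12_norm G S (walk k))\<^sup>2 / (4 * deg)"
proof (rule has_sum_mono[OF has_sum_walk_power2])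
  let ?R = "\<lambda>x. (\<Sum>s\<in>S. (walk k x)\<^sup>2 + (walk k (x \<otimes> s))\<^sup>2) / (2 * deg) + - (grad_sq G S (walk k) x / (4 * deg))"
  have "(?R has_sum ((\<Sum>s\<in>S. collision k + collision k) / (2 * deg)
      + - ((D12_norm G S (walk k))\<^sup>2 / (4 * deg)))) (carrier G)"
    unfolding D12_norm_power2 using finite_S
    by (intro has_sum_add has_sum_uminusI has_sum_divide_const has_sum_sum_finite)
       (auto intro: has_sum_walk_power2 has_sum_infsum summable_grad_sq_walk
          simp: has_sum_right_mult[of _ "\<lambda>x. (walk k x)\<^sup>2"])
  then show "(?R has_sum (collision k - (D12_norm G S (walk k))\<^sup>2 / (4 * deg))) (carrier G)"
    using deg_pos by simp
  fix x assume x: "x \<in> carrier G"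
  let ?h = "\<lambda>s. (walk k x + walk k (x \<otimes> s)) / 2"
  have "(\<Sum>s\<in>S. ?h s)\<^sup>2 \<le> deg * (\<Sum>s\<in>S. (?h s)\<^sup>2)"
    using sum_squared_le_sum_of_squares[of ?h S] by (simp add: finite_S mult.commute)
  then have "(\<Sum>s\<in>S. ?h s)\<^sup>2 / deg\<^sup>2 \<le> deg * (\<Sum>s\<in>S. (?h s)\<^sup>2) / deg\<^sup>2"
    by (rule divide_right_mono) simp
  moreover have "walk (Suc k) x = (\<Sum>s\<in>S. ?h s) / deg"
    using x by (simp add: walk_Suc sum_divide_distrib[symmetric])
  ultimately have "(walk (Suc k) x)\<^sup>2 \<le> (\<Sum>s\<in>S. (?h s)\<^sup>2) / deg"
    using deg_pos by (simp add: power_divide power2_eq_square)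
  also have "(\<Sum>s\<in>S. (?h s)\<^sup>2) =
      (\<Sum>s\<in>S. ((walk k x)\<^sup>2 + (walk k (x \<otimes> s))\<^sup>2) / 2 - (walk k (x \<otimes> s) - walk k x)\<^sup>2 / 4)"
    by (intro sum.cong refl) (simp add: power2_eq_square field_simps)
  also have "\<dots> / deg = ?R x"
    using deg_pos x
    by (simp add: grad_sq_eq sum_subtractf sum_divide_distrib[symmetric] diff_divide_distrib)
  finally show "(walk (Suc k) x)\<^sup>2 \<le> ?R x" .
qed

text \<open>Expanding the square, \<open>collision k\<close> exceeds the correlation at shift
  \<open>g\<close> by half of the squared translation difference. Averaged over the ball, the
  correlations contribute at most the inverse volume, because the walk has total mass 1.\<close>

lemma collision_le_ball:
  assumes n: "n \<ge> 1" and pos: "card (word_ball n) > 0"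
  shows "collision k \<le> 1 / real (card (word_ball n)) + (real n)\<^sup>2 * (D12_norm G S (walk k))\<^sup>2 / 2"
proof -
  let ?W = "word_ball n" and ?f = "walk k"
  define c where "c g = (\<Sum>\<^sub>\<infinity>x\<in>carrier G. ?f x * ?f (x \<otimes> g))" for g
  have c: "((\<lambda>x. ?f x * ?f (x \<otimes> g)) has_sum c g) (carrier G)" for g
    unfolding c_def by (intro has_sum_infsum summable_walk[of k]) simp
  have W: "finite ?W" "?W \<subseteq> carrier G" using finite_word_ball[OF n] word_ball_carrier by auto
  have "2 * collision k - 2 * c g \<le> (real n)\<^sup>2 * (D12_norm G S ?f)\<^sup>2" if g: "g \<in> ?W" for g
  proof -
    have "((\<lambda>x. ((?f (x \<otimes> g))\<^sup>2 + (?f x)\<^sup>2) + - (2 * (?f x * ?f (x \<otimes> g)))) has_sum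
        ((collision k + collision k) + - (2 * c g))) (carrier G)"
      using g by (intro has_sum_add has_sum_uminusI has_sum_cmult_right c has_sum_walk_power2)
        (simp add: has_sum_right_mult[of _ "\<lambda>x. (walk k x)\<^sup>2"] has_sum_walk_power2 word_ball_carrier)
    then have "((\<lambda>x. (?f (x \<otimes> g) - ?f x)\<^sup>2) has_sum (2 * collision k - 2 * c g)) (carrier G)"
      by (simp add: power2_diff algebra_simps)
    then show ?thesis
      by (rule has_sum_le_finite_sums) (intro sum_sq_right_mult_le summable_grad_sq_walk g)
  qed
  then have "(\<Sum>g\<in>?W. 2 * collision k - 2 * c g) \<le> (\<Sum>g\<in>?W. (real n)\<^sup>2 * (D12_norm G S ?f)\<^sup>2)"
    by (rule sum_mono)
  moreover have "(\<Sum>g\<in>?W. c g) \<le> 1"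
  proof (rule has_sum_mono[OF has_sum_sum_finite[OF W(1) c] has_sum_walk[of k]])
    fix x assume x: "x \<in> carrier G"
    have "inj_on (\<lambda>g. x \<otimes> g) ?W" using W x by (auto simp: subset_iff intro!: inj_onI)
    then have "(\<Sum>g\<in>?W. ?f (x \<otimes> g)) = (\<Sum>y\<in>(\<lambda>g. x \<otimes> g) ` ?W. ?f y)" by (simp add: sum.reindex)
    also have "\<dots> \<le> 1" using W x by (intro sum_walk_le_1) auto
    finally show "(\<Sum>g\<in>?W. ?f x * ?f (x \<otimes> g)) \<le> ?f x"
      using walk_nonneg[OF x, of k] by (simp add: sum_distrib_left[symmetric] mult_left_le)
  qed
  ultimately have "2 * real (card ?W) * collision k
      \<le> real (card ?W) * ((real n)\<^sup>2 * (D12_norm G S ?f)\<^sup>2) + 2"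
    by (simp add: sum_subtractf sum_distrib_left[symmetric])
  then show ?thesis using pos by (simp add: field_simps)
qed

lemma collision_0: "collision 0 = 1"
proof -
  have "((\<lambda>x. (walk 0 x)\<^sup>2) has_sum 1) (carrier G)"
    by (rule has_sum_cong[THEN iffD2, OF _ has_sum_walk[of 0]]) (simp add: walk_0 indicator_def)
  then show ?thesis using has_sum_walk_power2 has_sum_unique by blast
qed

lemma collision_pos: "collision k > 0"
proof -
  have "\<exists>x\<in>carrier G. walk k x \<noteq> 0"
    using has_sum_walk[of k] by (metis has_sum_0 has_sum_unique zero_neq_one)
  then obtain x where x: "x \<in> carrier G" "walk k x \<noteq> 0" by blast
  then have "0 < (walk k x)\<^sup>2" by simp
  also have "\<dots> \<le> collision k" using sum_walk_power2_le[of "{x}"] x by simp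
  finally show ?thesis .
qed

lemma collision_le_1: "collision k \<le> 1"
proof (induction k)
  case (Suc k)
  have "collision (Suc k) \<le> collision k"
    using collision_Suc_le[of k] deg_pos by (smt (verit) divide_nonneg_pos zero_le_power2)
  then show ?case using Suc by simp
qed (simp add: collision_0)

text \<open>Nash's argument in discrete time: one step lowers \<open>a = collision k\<close> by at
  least a multiple of \<open>a powr (1 + 2 / N)\<close>. As for the differential equation
  \<open>a' = - c * a powr (1 + 2 / N)\<close>, the quantity that grows linearly is
  \<open>a powr (- 2 / N)\<close>.\<close>

lemma collision_decay:
  obtains c where "c > 0" "\<And>k. 1 + c * real k \<le> collision k powr (- 2 / real N)"
proof -
  obtain C where C: "C > 0"
    "\<And>M. M \<ge> 1 \<Longrightarrow> \<exists>n\<ge>1. M \<le> real (card (word_ball n)) \<and> real n \<le> C * M powr (1 / real N)"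
    using radius_of_volume by blast
  define c where "c = 1 / (4 * deg * (C * 2 powr (1 / real N))\<^sup>2)"
  have c: "c > 0" using C deg_pos by (simp add: c_def)
  have step: "collision (Suc k) \<le> collision k * (1 - c * collision k powr (2 / real N))" for k
  proof -
    let ?a = "collision k" and ?E = "(D12_norm G S (walk k))\<^sup>2"
    \<comment> \<open>A ball of volume at least \<open>2 / ?a\<close> makes the first term of
      \<open>collision_le_ball\<close> at most \<open>?a / 2\<close>, so it is absorbed on the
      left.\<close>
    have "2 / ?a \<ge> 1" using collision_pos[of k] collision_le_1[of k] by (simp add: field_simps)
    then obtain n where n: "n \<ge> 1" "2 / ?a \<le> real (card (word_ball n))" "real n \<le> C * (2 / ?a) powr (1 / real N)"
      using C(2) by blast
    have W: "real (card (word_ball n)) > 0" using n \<open>2 / ?a \<ge> 1\<close> by linarith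
    have "1 / real (card (word_ball n)) \<le> ?a / 2"
      using n(2) W collision_pos[of k] by (simp add: field_simps)
    then have 1: "?a \<le> (real n)\<^sup>2 * ?E" using collision_le_ball[OF n(1), of k] W by simp
    have "(real n)\<^sup>2 \<le> (C * (2 / ?a) powr (1 / real N))\<^sup>2" using n by (intro power_mono) auto
    also have "\<dots> = (C * 2 powr (1 / real N))\<^sup>2 / ?a powr (2 / real N)"
      using collision_pos[of k]
      by (simp add: powr_divide power_divide power_mult_distrib power2_eq_square powr_add[symmetric])
    finally have "?a \<le> (C * 2 powr (1 / real N))\<^sup>2 / ?a powr (2 / real N) * ?E"
      using 1 by (smt (verit) mult_right_mono zero_le_power2)
    then have "c * (?a * ?a powr (2 / real N)) \<le> ?E / (4 * deg)"
      using collision_pos[of k] C deg_pos by (simp add: c_def field_simps)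
    then show ?thesis using collision_Suc_le[of k] by (simp add: algebra_simps)
  qed
  define c' where "c' = c * (2 / real N)"
  have "1 + c' * real k \<le> collision k powr (- 2 / real N)" for k
  proof (induction k)
    case (Suc k)
    let ?a = "collision k" and ?b = "collision (Suc k)"
    define z where "z = c * ?a powr (2 / real N)"
    have a: "?a > 0" and b: "?b > 0" by (rule collision_pos)+
    \<comment> \<open>Replacing \<open>1 - z\<close> by \<open>exp (- z)\<close> makes the negative
      power explicit: it becomes \<open>exp (z * (2 / real N))\<close>, which is at least
      \<open>1 + z * (2 / real N)\<close>.\<close>
    have "?b \<le> ?a * exp (- z)"
      using step[of k] exp_ge_add_one_self[of "- z"] a
      unfolding z_def by (smt (verit) mult_left_mono)
    then have "(?a * exp (- z)) powr (- 2 / real N) \<le> ?b powr (- 2 / real N)"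
      using b N3 by (intro powr_mono2') auto
    moreover have "(?a * exp (- z)) powr (- 2 / real N) = ?a powr (- 2 / real N) * exp (z * (2 / real N))"
      using a by (simp add: powr_mult exp_powr_real)
    moreover have "?a powr (- 2 / real N) * exp (z * (2 / real N)) \<ge> ?a powr (- 2 / real N) * (1 + z * (2 / real N))"
      using exp_ge_add_one_self[of "z * (2 / real N)"] by (intro mult_left_mono) auto
    moreover have "?a powr (- 2 / real N) * z = c"
    proof -
      have "?a powr (- 2 / real N) * ?a powr (2 / real N) = 1"
        using a by (simp add: powr_add[symmetric])
      then show ?thesis by (simp add: z_def mult_ac)
    qed
    then have "?a powr (- 2 / real N) * (1 + z * (2 / real N)) = ?a powr (- 2 / real N) + c'"
      by (simp add: c'_def algebra_simps)
    ultimately have "?a powr (- 2 / real N) + c' \<le> ?b powr (- 2 / real N)" by linarith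
    then show ?case using Suc by (simp add: algebra_simps)
  qed (simp add: collision_0)
  moreover have "c' > 0" using c N3 by (simp add: c'_def)
  ultimately show ?thesis using that by blast
qed

theorem walk_decay:
  obtains C where "C > 0"
    "\<And>k x. x \<in> carrier G \<Longrightarrow> walk k x \<le> C * real (Suc k) powr (- real N / 2)"
proof -
  obtain c where c: "c > 0" "\<And>k. 1 + c * real k \<le> collision k powr (- 2 / real N)"
    using collision_decay by blast
  \<comment> \<open>Halving accounts for passing from \<open>k\<close> to \<open>k div 2\<close>;
    the minimum with 1 compares \<open>1 + c * j\<close> with a multiple of
    \<open>1 + j\<close>.\<close>
  define m where "m = min 1 c / 2"
  have m: "m > 0" using c by (simp add: m_def)
  have "walk k x \<le> m powr (- real N / 2) * real (Suc k) powr (- real N / 2)" if x: "x \<in> carrier G" for k x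
  proof -
    define j where "j = k div 2"
    have k: "k = j + j \<or> k = Suc (j + j)" unfolding j_def by linarith
    then have "walk k x \<le> collision j"
      using walk_even_le_collision[OF x] walk_odd_le_collision[OF x] by auto
    also have "collision j = (collision j powr (- 2 / real N)) powr (- real N / 2)"
      using N3 collision_pos[of j] by (simp add: powr_powr)
    also have "\<dots> \<le> (m * real (Suc k)) powr (- real N / 2)"
    proof (rule powr_mono2')
      have "m * real (Suc k) \<le> m * (2 + 2 * real j)" using k m by (intro mult_left_mono) auto
      also have "\<dots> = min 1 c * 1 + min 1 c * real j" by (simp add: m_def algebra_simps)
      also have "\<dots> \<le> 1 * 1 + c * real j" by (intro add_mono mult_right_mono) auto
      also have "\<dots> \<le> collision j powr (- 2 / real N)" using c(2)[of j] by simp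
      finally show "m * real (Suc k) \<le> collision j powr (- 2 / real N)" .
    qed (use m in auto)
    also have "\<dots> = m powr (- real N / 2) * real (Suc k) powr (- real N / 2)"
      using m by (simp add: powr_mult)
    finally show ?thesis .
  qed
  moreover have "m powr (- real N / 2) > 0" using m by simp
  ultimately show ?thesis using that by blast
qed

end

section \<open>Green's function as a series over the walk\<close>

text \<open>Pascal's rule for iterated differences, the inductive step in the binomial expansion of
  the powers of \<open>lazy - 1\<close>.\<close>

lemma forward_difference_Suc:
  fixes F :: "nat \<Rightarrow> real"
  shows "(\<Sum>i\<le>k. (-1) ^ (k + i) * real (k choose i) * (F (Suc i) - F i))
       = (\<Sum>i\<le>Suc k. (-1) ^ (Suc k + i) * real (Suc k choose i) * F i)"
proof -
  define b where "b i = (-1) ^ (k + i) * real (k choose i) * F i" for i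
  have "(\<Sum>i\<le>k. b (Suc i)) = (\<Sum>i\<le>Suc k. b i) - b 0"
    by (simp only: sum.atMost_Suc_shift)
  also have "(\<Sum>i\<le>Suc k. b i) = (\<Sum>i\<le>k. b i)" by (simp add: b_def)
  finally have 1: "(\<Sum>i\<le>k. b (Suc i)) = (\<Sum>i\<le>k. b i) - b 0" .
  have "(\<Sum>i\<le>Suc k. (-1) ^ (Suc k + i) * real (Suc k choose i) * F i)
      = - b 0 + (\<Sum>i\<le>k. (-1) ^ (k + i) * real (k choose i) * F (Suc i) - b (Suc i))"
    by (subst sum.atMost_Suc_shift) (simp add: b_def algebra_simps)
  also have "\<dots> = (\<Sum>i\<le>k. (-1) ^ (k + i) * real (k choose i) * F (Suc i)) - (\<Sum>i\<le>k. b i)"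
    using 1 by (simp add: sum_subtractf)
  also have "\<dots> = (\<Sum>i\<le>k. (-1) ^ (k + i) * real (k choose i) * (F (Suc i) - F i))"
    by (simp add: b_def sum_subtractf[symmetric] right_diff_distrib)
  finally show ?thesis by simp
qed

context polynomial_growth_cayley_graph
begin

lemma laplacian_eq_lazy: "laplacian G S u x = 2 * deg * (lazy u x - u x)"
  using deg_pos by (simp add: lazy_def)

lemma lazy_sum:
  "lazy (\<lambda>x. \<Sum>i\<in>I. a i * f i x) x = (\<Sum>i\<in>I. a i * lazy (f i) x)"
proof -
  have "laplacian G S (\<lambda>x. \<Sum>i\<in>I. a i * f i x) x = (\<Sum>i\<in>I. a i * laplacian G S (f i) x)"
    unfolding laplacian_def sum_distrib_left
    by (subst sum.swap) (simp add: sum_subtractf[symmetric] right_diff_distrib)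
  then show ?thesis
    by (simp add: lazy_def sum.distrib[symmetric] sum_divide_distrib distrib_left)
qed

lemma laplacian_power:
  "(laplacian G S ^^ k) u x
    = (2 * deg) ^ k * (\<Sum>i\<le>k. (-1) ^ (k + i) * real (k choose i) * (lazy ^^ i) u x)"
proof (induction k arbitrary: x)
  case (Suc k)
  define a where "a i = (2 * deg) ^ k * ((-1) ^ (k + i) * real (k choose i))" for i
  have IH: "(laplacian G S ^^ k) u = (\<lambda>x. \<Sum>i\<le>k. a i * (lazy ^^ i) u x)"
    by (rule ext) (simp only: Suc.IH a_def sum_distrib_left mult.assoc)
  have "(laplacian G S ^^ Suc k) u x
      = 2 * deg * ((\<Sum>i\<le>k. a i * lazy ((lazy ^^ i) u) x) - (\<Sum>i\<le>k. a i * (lazy ^^ i) u x))"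
    unfolding funpow.simps comp_def IH laplacian_eq_lazy lazy_sum ..
  also have "\<dots> = (2 * deg) ^ Suc k * (\<Sum>i\<le>k. (-1) ^ (k + i) * real (k choose i) *
      ((lazy ^^ Suc i) u x - (lazy ^^ i) u x))"
    by (simp add: a_def sum_subtractf[symmetric] sum_distrib_left right_diff_distrib mult.assoc)
  also have "\<dots> = (2 * deg) ^ Suc k * (\<Sum>i\<le>Suc k. (-1) ^ (Suc k + i) * real (Suc k choose i) * (lazy ^^ i) u x)"
    by (simp only: forward_difference_Suc[of k "\<lambda>i. (lazy ^^ i) u x"])
  finally show ?case .
qed simp

lemma summable_poisson:
  assumes "\<And>k. \<bar>w k\<bar> \<le> 1"
  shows "summable (\<lambda>k. norm (s ^ k / fact k * w k :: real))"
proof (rule summable_comparison_test')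
  show "summable (\<lambda>k. \<bar>s\<bar> ^ k / fact k)"
    using summable_exp_generic[of "\<bar>s\<bar>"] by (simp add: divide_inverse mult.commute)
  fix k :: nat
  show "norm (norm (s ^ k / fact k * w k)) \<le> \<bar>s\<bar> ^ k / fact k"
    using assms[of k] by (simp add: abs_mult power_abs divide_right_mono mult_left_le)
qed

text \<open>Since \<open>\<Delta> = 2 * deg * (lazy - 1)\<close>, the heat semigroup is the Poissonised lazy walk.\<close>

lemma heat_kernel_eq:
  assumes x: "x \<in> carrier G" and y: "y \<in> carrier G"
  shows "heat_kernel G S t x y
    = exp (- (2 * deg * t)) * (\<Sum>k. (2 * deg * t) ^ k / fact k * walk k (inv y \<otimes> x))"
proof -
  define s where "s = 2 * deg * t"
  define w where "w k = walk k (inv y \<otimes> x)" for k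
  have w: "\<bar>w k\<bar> \<le> 1" for k
    using x y walk_nonneg[of "inv y \<otimes> x" k] walk_le_1[of "inv y \<otimes> x" k] by (simp add: w_def)
  \<comment> \<open>The \<open>k\<close>-th Cauchy coefficient of the product with the series of
    \<open>exp (- s)\<close> is the binomial expansion of the \<open>k\<close>-th power of the
    Laplacian.\<close>
  have "(\<lambda>k. \<Sum>i\<le>k. (s ^ i / fact i * w i) * ((- s) ^ (k - i) / fact (k - i))) sums
      ((\<Sum>k. s ^ k / fact k * w k) * (\<Sum>k. (- s) ^ k / fact k))"
    using summable_poisson[of w s] w summable_poisson[of "\<lambda>_. 1" "- s"]
    by (intro Cauchy_product_sums) auto
  moreover have "(\<Sum>k. (- s) ^ k / fact k) = exp (- s)"
    by (simp add: exp_def divide_inverse mult.commute)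
  moreover have "(\<Sum>i\<le>k. (s ^ i / fact i * w i) * ((- s) ^ (k - i) / fact (k - i)))
      = t ^ k / fact k * (laplacian G S ^^ k) (indicator {y}) x" for k
  proof -
    have "(s ^ i / fact i * w i) * ((- s) ^ (k - i) / fact (k - i))
        = s ^ k / fact k * ((-1) ^ (k + i) * real (k choose i) * w i)" if "i \<le> k" for i
    proof -
      have "(- s) ^ (k - i) = (-1) ^ (k - i) * s ^ (k - i)" by (rule power_minus)
      moreover have "(-1 :: real) ^ (k - i) = (-1) ^ (k + i)"
        using that by (simp add: minus_one_power_iff)
      moreover have "s ^ k = s ^ i * s ^ (k - i)" using that by (simp add: power_add[symmetric])
      ultimately show ?thesis using that by (simp add: binomial_fact)
    qed
    then have "(\<Sum>i\<le>k. (s ^ i / fact i * w i) * ((- s) ^ (k - i) / fact (k - i)))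
        = s ^ k / fact k * (\<Sum>i\<le>k. (-1) ^ (k + i) * real (k choose i) * w i)"
      by (simp add: sum_distrib_left)
    then show ?thesis
      using lazy_power_indicator[OF x y] by (simp add: laplacian_power s_def w_def power_mult_distrib)
  qed
  ultimately show ?thesis
    unfolding heat_kernel_def heat_semigroup_def by (simp add: sums_iff s_def w_def)
qed

end

text \<open>The substitution \<open>\<Lambda> * t\<close> in the Gamma integral. The nonnegative
  integral is used so that series and integral can later be exchanged without a dominating
  function.\<close>

lemma nn_integral_poisson_Gamma:
  fixes \<Lambda> z :: real
  assumes \<Lambda>: "\<Lambda> > 0" and z: "z > 0"
  shows "(\<integral>\<^sup>+t. ennreal (indicator {0<..} t * (exp (- (\<Lambda> * t)) * ((\<Lambda> * t) ^ k / fact k) * t powr (z - 1))) \<partial>lborel)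
       = ennreal (\<Lambda> powr (- z) * Gamma (z + real k) / fact k)"
proof -
  define s where "s = z + real k"
  have s: "s > 0" using z by (simp add: s_def)
  let ?f = "\<lambda>t. ennreal (indicator {0..} t * t powr (s - 1) / exp t)"
  have "ennreal (Gamma s) = (\<integral>\<^sup>+t. ?f t \<partial>lborel)" by (rule Gamma_conv_nn_integral_real[OF s])
  also have "\<dots> = ennreal \<bar>\<Lambda>\<bar> * (\<integral>\<^sup>+t. ?f (0 + \<Lambda> * t) \<partial>lborel)"
    using \<Lambda> by (intro nn_integral_real_affine) auto
  finally have G: "ennreal (Gamma s) = ennreal \<Lambda> * (\<integral>\<^sup>+t. ?f (\<Lambda> * t) \<partial>lborel)" using \<Lambda> by simp
  have *: "indicator {0<..} t * (exp (- (\<Lambda> * t)) * ((\<Lambda> * t) ^ k / fact k) * t powr (z - 1))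
      = \<Lambda> powr (1 - z) / fact k * (indicator {0..} (\<Lambda> * t) * (\<Lambda> * t) powr (s - 1) / exp (\<Lambda> * t))" for t
  proof (cases "t > 0")
    case True
    then have "(\<Lambda> * t) powr (s - 1) = (\<Lambda> * t) ^ k * (\<Lambda> powr (z - 1) * t powr (z - 1))"
      using \<Lambda> by (simp add: s_def powr_mult[symmetric] powr_realpow[symmetric] powr_add[symmetric] algebra_simps)
    moreover have "\<Lambda> powr (1 - z) * \<Lambda> powr (z - 1) = 1" using \<Lambda> by (simp add: powr_add[symmetric])
    ultimately show ?thesis
      using True \<Lambda> by (simp add: exp_minus field_simps)
  next
    case False
    \<comment> \<open>At \<open>t = 0\<close> the indicators of \<open>{0<..}\<close> and
      \<open>{0..}\<close> differ, but \<open>0 powr (s - 1) = 0\<close>.\<close>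
    then show ?thesis using \<Lambda> by (cases "t = 0") (auto simp: mult_le_0_iff zero_le_mult_iff)
  qed
  have "(\<integral>\<^sup>+t. ennreal (indicator {0<..} t * (exp (- (\<Lambda> * t)) * ((\<Lambda> * t) ^ k / fact k) * t powr (z - 1))) \<partial>lborel)
      = (\<integral>\<^sup>+t. ennreal (\<Lambda> powr (1 - z) / fact k) * ?f (\<Lambda> * t) \<partial>lborel)"
    unfolding * by (intro nn_integral_cong ennreal_mult') simp
  also have "\<dots> = ennreal (\<Lambda> powr (1 - z) / fact k) * (\<integral>\<^sup>+t. ?f (\<Lambda> * t) \<partial>lborel)"
    by (rule nn_integral_cmult) measurable
  also have "ennreal (\<Lambda> powr (1 - z) / fact k) = ennreal (\<Lambda> powr (- z) / fact k) * ennreal \<Lambda>"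
    using \<Lambda> powr_add[of \<Lambda> 1 "- z"] by (simp add: ennreal_mult'[symmetric] mult.commute)
  also have "\<dots> * (\<integral>\<^sup>+t. ?f (\<Lambda> * t) \<partial>lborel) = ennreal (\<Lambda> powr (- z) / fact k) * ennreal (Gamma s)"
    by (simp only: G mult.assoc)
  also have "\<dots> = ennreal (\<Lambda> powr (- z) * Gamma s / fact k)"
    by (simp add: ennreal_mult'[symmetric])
  finally show ?thesis by (simp add: s_def)
qed

section \<open>Coefficients and weights of the Green series\<close>

locale hls_setting = polynomial_growth_cayley_graph +
  fixes \<alpha> p :: real
  assumes \<alpha>: "0 < \<alpha>" "\<alpha> < real N" and p: "p > (real N + \<alpha>) / (real N - 2)"
begin

text \<open>Coefficients of the binomial series of
  \<open>(2 * deg * (1 - z)) powr (- \<alpha> / 2)\<close> in powers of \<open>z\<close>; with the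
  lazy step in place of \<open>z\<close> this is the negative Laplacian to the power
  \<open>- \<alpha> / 2\<close>.\<close>

definition green_coeff :: "nat \<Rightarrow> real" where
  "green_coeff k = (2 * deg) powr (- \<alpha> / 2) * (pochhammer (\<alpha> / 2) k / fact k)"

lemma green_coeff_pos: "green_coeff k > 0"
  using deg_pos \<alpha> by (simp add: green_coeff_def pochhammer_pos)

text \<open>The sequence \<open>rGamma_series\<close> converges to the reciprocal Gamma function,
  hence is bounded. Its \<open>k\<close>-th member contains \<open>pochhammer z (k + 1)\<close>,
  whence the factor \<open>z + real k\<close> that has to be traded for one power of
  \<open>k\<close>.\<close>

lemma green_coeff_bound:
  obtains C where "C > 0" "\<And>k. k \<ge> 1 \<Longrightarrow> green_coeff k \<le> C * real k powr (\<alpha> / 2 - 1)"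
proof -
  define z where "z = \<alpha> / 2"
  have z: "z > 0" using \<alpha> by (simp add: z_def)
  have "Bseq (rGamma_series z)"
    using rGamma_series_LIMSEQ[of z] by (intro convergent_imp_Bseq) (auto simp: convergent_def)
  then obtain B where B: "B > 0" "\<And>n. \<bar>rGamma_series z n\<bar> \<le> B" by (auto simp: Bseq_def)
  have "green_coeff k \<le> (2 * deg) powr (- z) * B * real k powr (z - 1)" if k: "k \<ge> 1" for k
  proof -
    have "pochhammer z (k + 1) / (fact k * exp (z * ln (real k))) \<le> B"
    proof -
      have "rGamma_series z k \<le> B" using B(2)[of k] by linarith
      then show ?thesis by (simp add: rGamma_series_def)
    qed
    moreover have "exp (z * ln (real k)) = real k powr z" using k by (simp add: powr_def)
    ultimately have "pochhammer z k * (z + real k) / (fact k * real k powr z) \<le> B"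
      by (simp add: pochhammer_Suc)
    then have "pochhammer z k / fact k * (z + real k) \<le> B * real k powr z"
      using k by (simp add: field_simps)
    moreover have "pochhammer z k / fact k * real k \<le> pochhammer z k / fact k * (z + real k)"
      using z by (intro mult_left_mono) (auto simp: pochhammer_nonneg)
    ultimately have "pochhammer z k / fact k * real k \<le> B * real k powr z" by linarith
    also have "real k powr z = real k powr (z - 1) * real k" using k powr_add[of "real k" "z - 1" 1] by simp
    finally have "pochhammer z k / fact k * real k \<le> B * real k powr (z - 1) * real k" by (simp only: mult.assoc)
    then have "pochhammer z k / fact k \<le> B * real k powr (z - 1)"
      using k by (simp only: mult_le_cancel_right_pos of_nat_0_less_iff Suc_le_eq One_nat_def)
    then have "(2 * deg) powr (- z) * (pochhammer z k / fact k) \<le> (2 * deg) powr (- z) * (B * real k powr (z - 1))"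
      by (rule mult_left_mono) simp
    then show ?thesis by (simp add: green_coeff_def z_def mult.assoc)
  qed
  moreover have "(2 * deg) powr (- z) * B > 0" using B deg_pos by simp
  ultimately show ?thesis using that unfolding z_def by blast
qed

text \<open>The midpoint of the admissible interval. The cap at 1 keeps the exponents
  \<open>(1 - \<theta>) / 2\<close> of the geometric mean positive.\<close>

definition \<theta> :: real where
  "\<theta> = (\<alpha> / real N + min 1 (p * (real N - 2) / real N - 1)) / 2"

lemma \<theta>: "\<alpha> / real N < \<theta>" "0 < \<theta>" "\<theta> < 1" "1 + \<theta> < p * (real N - 2) / real N"
proof -
  have N: "real N - 2 > 0" using N3 by simp
  have "(real N + \<alpha>) / real N < p * (real N - 2) / real N"
    using p N by (intro divide_strict_right_mono) (auto simp: field_simps)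
  moreover have "(real N + \<alpha>) / real N = 1 + \<alpha> / real N" using N by (simp add: add_divide_distrib)
  ultimately have 1: "\<alpha> / real N < p * (real N - 2) / real N - 1" by linarith
  have 2: "\<alpha> / real N < 1" "0 < \<alpha> / real N" using \<alpha> N by auto
  have gen: "a < (a + min 1 b) / 2 \<and> 0 < (a + min 1 b) / 2 \<and> (a + min 1 b) / 2 < 1 \<and> 1 + (a + min 1 b) / 2 < b + 1"
    if "0 < a" "a < 1" "a < b" for a b :: real
    using that by (auto simp: min_def)
  show "\<alpha> / real N < \<theta>" "0 < \<theta>" "\<theta> < 1" "1 + \<theta> < p * (real N - 2) / real N"
    using gen[OF 2(2,1) 1] by (simp_all add: \<theta>_def)
qed

definition walk_sup :: "nat \<Rightarrow> real" where
  "walk_sup k = (SUP x\<in>carrier G. walk k x)"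

lemma walk_le_walk_sup: "x \<in> carrier G \<Longrightarrow> walk k x \<le> walk_sup k"
  unfolding walk_sup_def by (rule cSUP_upper) (auto intro!: bdd_aboveI2 walk_le_1)

lemma walk_sup_nonneg: "0 \<le> walk_sup k"
  using walk_le_walk_sup[of \<one> k] walk_nonneg[of \<one> k] by simp

definition green_weight :: "nat \<Rightarrow> real" where
  "green_weight k = green_coeff k * walk_sup k powr \<theta>"

lemma green_weight_nonneg: "0 \<le> green_weight k"
  using green_coeff_pos[of k] by (simp add: green_weight_def)

text \<open>The terms are at most of order
  \<open>k powr (\<alpha> / 2 - 1 - N * \<theta> / 2)\<close>, summable because
  \<open>\<theta> > \<alpha> / N\<close>. The decay of the walk enters the nonlocal estimates only
  through this sum.\<close>

lemma summable_green_weight: "summable green_weight"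
proof -
  obtain C where C: "C > 0" "\<And>k. k \<ge> 1 \<Longrightarrow> green_coeff k \<le> C * real k powr (\<alpha> / 2 - 1)"
    using green_coeff_bound by blast
  obtain D where D: "D > 0" "\<And>k x. x \<in> carrier G \<Longrightarrow> walk k x \<le> D * real (Suc k) powr (- real N / 2)"
    using walk_decay by blast
  let ?e = "\<alpha> / 2 - 1 + (- real N / 2) * \<theta>"
  show ?thesis
  proof (rule summable_comparison_test'[where N = 1])
    have "\<alpha> < real N * \<theta>" using \<theta>(1) N3 by (simp add: field_simps)
    then have "?e < -1" by simp
    then show "summable (\<lambda>k. C * D powr \<theta> * real k powr ?e)"
      by (intro summable_mult) (simp add: summable_real_powr_iff)
    fix k :: nat assume k: "k \<ge> 1"
    have "walk_sup k \<le> D * real k powr (- real N / 2)"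
      unfolding walk_sup_def
    proof (rule cSUP_least)
      fix x assume "x \<in> carrier G"
      then have "walk k x \<le> D * real (Suc k) powr (- real N / 2)" by (rule D)
      also have "\<dots> \<le> D * real k powr (- real N / 2)"
        using D k by (intro mult_left_mono powr_mono2') auto
      finally show "walk k x \<le> D * real k powr (- real N / 2)" .
    qed auto
    then have "walk_sup k powr \<theta> \<le> (D * real k powr (- real N / 2)) powr \<theta>"
      using \<theta> walk_sup_nonneg by (intro powr_mono2) auto
    also have "\<dots> = D powr \<theta> * real k powr ((- real N / 2) * \<theta>)"
      using D by (simp add: powr_mult powr_powr)
    finally have "green_weight k \<le> C * real k powr (\<alpha> / 2 - 1) * (D powr \<theta> * real k powr ((- real N / 2) * \<theta>))"
      unfolding green_weight_def using C k green_coeff_pos[of k] by (intro mult_mono) auto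
    also have "\<dots> = C * D powr \<theta> * (real k powr (\<alpha> / 2 - 1) * real k powr ((- real N / 2) * \<theta>))"
      by (simp only: mult_ac)
    also have "\<dots> = C * D powr \<theta> * real k powr ?e" by (simp only: powr_add)
    finally show "norm (green_weight k) \<le> C * D powr \<theta> * real k powr ?e"
      using green_weight_nonneg[of k] by simp
  qed
qed

lemma green_term_le: "x \<in> carrier G \<Longrightarrow> green_coeff k * walk k x \<le> green_weight k"
proof -
  assume x: "x \<in> carrier G"
  have "walk k x \<le> walk k x powr \<theta>"
    using walk_nonneg[OF x, of k] walk_le_1[OF x, of k] \<theta> powr_mono'[of \<theta> 1 "walk k x"] by simp
  also have "\<dots> \<le> walk_sup k powr \<theta>"
    using walk_nonneg[OF x] walk_le_walk_sup[OF x] \<theta> by (intro powr_mono2) auto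
  finally show ?thesis unfolding green_weight_def using green_coeff_pos[of k] by (simp add: mult_left_mono)
qed

lemma summable_green_term: "x \<in> carrier G \<Longrightarrow> summable (\<lambda>k. green_coeff k * walk k x)"
  using green_term_le walk_nonneg green_coeff_pos
  by (intro summable_comparison_test'[OF summable_green_weight]) (auto simp: abs_mult less_imp_le)

text \<open>Integrating the Poissonised walk against \<open>t powr (\<alpha> / 2 - 1)\<close> term
  by term gives Gamma integrals; all terms are nonnegative, so Tonelli's theorem justifies the
  exchange.\<close>

lemma frac_green_eq:
  assumes x: "x \<in> carrier G" and y: "y \<in> carrier G"
  shows "frac_green G S \<alpha> x y = (\<Sum>k. green_coeff k * walk k (inv y \<otimes> x))"
proof -
  define z where "z = \<alpha> / 2"
  define \<Lambda> where "\<Lambda> = 2 * deg"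
  define w where "w k = walk k (inv y \<otimes> x)" for k
  have z: "z > 0" and \<Lambda>: "\<Lambda> > 0" using \<alpha> deg_pos by (auto simp: z_def \<Lambda>_def)
  have w: "0 \<le> w k" "w k \<le> 1" for k using x y by (auto simp: w_def walk_nonneg walk_le_1)
  let ?q = "\<lambda>k t. indicator {0<..} t * (exp (- (\<Lambda> * t)) * ((\<Lambda> * t) ^ k / fact k) * t powr (z - 1)) :: real"
  have q: "0 \<le> ?q k t" for k t using \<Lambda> by (auto simp: indicator_def)
  have qw: "0 \<le> ?q k t * w k" for k t by (rule mult_nonneg_nonneg[OF q w(1)])
  have sq: "summable (\<lambda>k. ?q k t * w k)"
    and hk: "indicator {0<..} t *\<^sub>R (heat_kernel G S t x y * t powr (-1 + \<alpha> / 2)) = (\<Sum>k. ?q k t * w k)" for t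
  proof -
    have s: "summable (\<lambda>k. (\<Lambda> * t) ^ k / fact k * w k)"
      by (rule summable_norm_cancel[OF summable_poisson]) (use w in simp)
    have eq: "?q k t * w k = (indicator {0<..} t * exp (- (\<Lambda> * t)) * t powr (z - 1)) * ((\<Lambda> * t) ^ k / fact k * w k)" for k
      by (simp add: mult_ac)
    show "summable (\<lambda>k. ?q k t * w k)" unfolding eq by (rule summable_mult[OF s])
    show "indicator {0<..} t *\<^sub>R (heat_kernel G S t x y * t powr (-1 + \<alpha> / 2)) = (\<Sum>k. ?q k t * w k)"
      unfolding eq suminf_mult[OF s] heat_kernel_eq[OF x y]
      by (simp add: z_def \<Lambda>_def w_def mult_ac)
  qed
  define c where "c k = \<Lambda> powr (- z) * Gamma (z + real k) / fact k * w k" for k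
  have G0: "Gamma z > 0" using z by (rule Gamma_real_pos)
  have c: "c k = Gamma z * (green_coeff k * w k)" for k
  proof -
    have "z \<notin> \<int>\<^sub>\<le>\<^sub>0" using z by (auto elim!: nonpos_Ints_cases)
    then have "pochhammer z k = Gamma (z + real k) / Gamma z" by (rule pochhammer_Gamma)
    then show ?thesis using G0 by (simp add: c_def green_coeff_def z_def \<Lambda>_def)
  qed
  have c0: "0 \<le> c k" for k using w green_coeff_pos[of k] G0 by (simp add: c)
  \<comment> \<open>Convergence is essential: a divergent integral would become 0 under
    \<open>enn2real\<close>, and the identity would fail.\<close>
  have sc: "summable c"
    unfolding c w_def using x y by (intro summable_mult summable_green_term) auto
  have "(LBINT t:{0<..}. heat_kernel G S t x y * t powr (-1 + \<alpha> / 2)) = (LBINT t. (\<Sum>k. ?q k t * w k))"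
    unfolding set_lebesgue_integral_def by (simp only: hk)
  also have "\<dots> = enn2real (\<integral>\<^sup>+t. ennreal (\<Sum>k. ?q k t * w k) \<partial>lborel)"
  proof (rule integral_eq_nn_integral)
    show "(\<lambda>t. \<Sum>k. ?q k t * w k) \<in> borel_measurable lborel" by measurable
    show "AE t in lborel. 0 \<le> (\<Sum>k. ?q k t * w k)"
      by (intro AE_I2 suminf_nonneg sq qw)
  qed
  also have "(\<integral>\<^sup>+t. ennreal (\<Sum>k. ?q k t * w k) \<partial>lborel) = (\<integral>\<^sup>+t. (\<Sum>k. ennreal (?q k t * w k)) \<partial>lborel)"
    by (intro nn_integral_cong suminf_ennreal2[symmetric] sq qw)
  also have "\<dots> = (\<Sum>k. \<integral>\<^sup>+t. ennreal (?q k t * w k) \<partial>lborel)"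
    by (rule nn_integral_suminf) measurable
  also have "\<dots> = (\<Sum>k. ennreal (c k))"
  proof (rule arg_cong[of _ _ suminf], rule ext)
    fix k
    have "(\<integral>\<^sup>+t. ennreal (?q k t * w k) \<partial>lborel) = (\<integral>\<^sup>+t. ennreal (?q k t) * ennreal (w k) \<partial>lborel)"
      using w by (simp only: ennreal_mult'')
    also have "\<dots> = (\<integral>\<^sup>+t. ennreal (?q k t) \<partial>lborel) * ennreal (w k)"
      by (rule nn_integral_multc) measurable
    also have "\<dots> = ennreal (c k)"
      unfolding nn_integral_poisson_Gamma[OF \<Lambda> z] c_def using w by (simp only: ennreal_mult'')
    finally show "(\<integral>\<^sup>+t. ennreal (?q k t * w k) \<partial>lborel) = ennreal (c k)" .
  qed
  also have "\<dots> = ennreal (suminf c)" by (rule suminf_ennreal2[OF c0 sc])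
  also have "enn2real \<dots> = suminf c" using c0 sc by (simp add: suminf_nonneg)
  also have "\<dots> = Gamma z * (\<Sum>k. green_coeff k * w k)"
    unfolding c w_def using x y by (intro suminf_mult summable_green_term) auto
  finally show ?thesis
    unfolding frac_green_def using G0 by (simp add: z_def w_def)
qed

end

section \<open>The nonlocal energy\<close>

lemma ennreal_infsum:
  fixes f :: "'a \<Rightarrow> real"
  assumes "f summable_on A" "\<And>x. x \<in> A \<Longrightarrow> 0 \<le> f x"
  shows "(\<Sum>\<^sub>\<infinity>x\<in>A. ennreal (f x)) = ennreal (infsum f A)"
proof -
  have "(\<Sum>\<^sub>\<infinity>x\<in>A. ennreal (f x)) = (SUP F\<in>{F. finite F \<and> F \<subseteq> A}. \<Sum>x\<in>F. ennreal (f x))"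
    by (rule nonneg_infsum_complete) simp
  also have "\<dots> = (SUP F\<in>{F. finite F \<and> F \<subseteq> A}. ennreal (sum f F))"
    by (intro SUP_cong refl sum_ennreal assms(2)) auto
  also have "\<dots> = ennreal (infsum f A)"
    using infsum_nonneg_is_SUPREMUM_ennreal[OF assms] by simp
  finally show ?thesis .
qed

text \<open>Each factor is at most the corresponding power of \<open>a + b + c\<close>, and the
  exponents add up to 1.\<close>

lemma geometric_mean_le_sum:
  fixes a b c \<theta> :: real
  assumes "0 < \<theta>" "\<theta> < 1" "0 \<le> a" "0 \<le> b" "0 \<le> c"
  shows "a powr \<theta> * b powr ((1 - \<theta>) / 2) * c powr ((1 - \<theta>) / 2) \<le> a + b + c"
proof (cases "a + b + c = 0")
  case True
  then have "a = 0" using assms by simp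
  then show ?thesis using True by simp
next
  case False
  let ?m = "a + b + c"
  have m: "?m > 0" using False assms by linarith
  have "a powr \<theta> * b powr ((1 - \<theta>) / 2) * c powr ((1 - \<theta>) / 2)
      \<le> ?m powr \<theta> * ?m powr ((1 - \<theta>) / 2) * ?m powr ((1 - \<theta>) / 2)"
    using assms by (intro mult_mono powr_mono2) auto
  also have "\<dots> = ?m powr (\<theta> + (1 - \<theta>) / 2 + (1 - \<theta>) / 2)" by (simp only: powr_add)
  also have "\<dots> = ?m" using m by (simp add: field_simps)
  finally show ?thesis .
qed

context hls_setting
begin

text \<open>Determined by \<open>1 / expo = (1 - \<theta>) / 2 + \<theta>\<close>, the interpolated
  exponent between l^2 and l^1.\<close>

definition expo :: real where "expo = 2 / (1 + \<theta>)"

lemma expo: "expo > 0" "p > 0" "p * expo > crit"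
proof -
  have N: "real N - 2 > 0" using N3 by simp
  show "expo > 0" using \<theta> by (simp add: expo_def)
  have "0 < (real N + \<alpha>) / (real N - 2)" using \<alpha> N by simp
  then show "p > 0" using p by linarith
  have "real N * (1 + \<theta>) < p * (real N - 2)" using \<theta>(4) N by (simp add: field_simps)
  then show "p * expo > crit" using \<theta> N by (simp add: expo_def field_simps)
qed

text \<open>Interpolation of the walk kernel: with \<open>w \<le> M\<close>, the product \<open>w * f * g\<close> is
  \<open>w powr \<theta> \<le> M powr \<theta>\<close> times the weighted geometric mean of \<open>f powr expo * g powr expo\<close>,
  \<open>w * f powr expo\<close> and \<open>w * g powr expo\<close>, each of which is summable in both variables.\<close>

lemma interpolation:
  fixes w M f g :: real
  assumes "0 \<le> w" "w \<le> M" "0 \<le> f" "0 \<le> g"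
  shows "w * f * g \<le> M powr \<theta> * (f powr expo * g powr expo + w * f powr expo + w * g powr expo)"
proof -
  have e: "expo * \<theta> + expo * ((1 - \<theta>) / 2) = 1"
  proof -
    have "expo * \<theta> + expo * ((1 - \<theta>) / 2) = expo * ((1 + \<theta>) / 2)" by (simp add: field_simps)
    then show ?thesis using \<theta> by (simp add: expo_def)
  qed
  have pow: "h powr (expo * \<theta>) * h powr (expo * ((1 - \<theta>) / 2)) = h" if "0 \<le> h" for h
    using that e by (simp add: powr_add[symmetric])
  have w: "w powr \<theta> * (w powr ((1 - \<theta>) / 2) * w powr ((1 - \<theta>) / 2)) = w"
    using assms by (simp add: powr_add[symmetric] field_simps)
  let ?s = "(1 - \<theta>) / 2"
  have "w * f * g = (w powr \<theta> * (w powr ?s * w powr ?s))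
      * (f powr (expo * \<theta>) * f powr (expo * ?s)) * (g powr (expo * \<theta>) * g powr (expo * ?s))"
    using assms by (simp only: pow w)
  also have "\<dots> = w powr \<theta> * ((f powr expo * g powr expo) powr \<theta>
      * (w * f powr expo) powr ?s * (w * g powr expo) powr ?s)"
    using assms by (simp add: powr_mult powr_powr mult_ac)
  also have "\<dots> \<le> M powr \<theta> * (f powr expo * g powr expo + w * f powr expo + w * g powr expo)"
    using assms \<theta> by (intro mult_mono geometric_mean_le_sum powr_mono2) auto
  finally show ?thesis .
qed

section \<open>Bilinear estimates for the walk kernel\<close>

lemma sum_walk_row_le_1:
  assumes "finite B" "B \<subseteq> carrier G" "x \<in> carrier G"
  shows "(\<Sum>y\<in>B. walk k (inv y \<otimes> x)) \<le> 1"
proof -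
  have "(\<Sum>y\<in>B. walk k (inv y \<otimes> x)) = sum (walk k) ((\<lambda>y. inv y \<otimes> x) ` B)"
  proof (subst sum.reindex)
    show "inj_on (\<lambda>y. inv y \<otimes> x) B"
      using assms by (intro inj_onI) (metis inv_closed inv_inv right_cancel subsetD)
  qed simp
  also have "\<dots> \<le> 1" using assms by (intro sum_walk_le_1) auto
  finally show ?thesis .
qed

lemma sum_walk_column_le_1:
  assumes "finite A" "A \<subseteq> carrier G" "y \<in> carrier G"
  shows "(\<Sum>x\<in>A. walk k (inv y \<otimes> x)) \<le> 1"
proof -
  have "(\<Sum>x\<in>A. walk k (inv y \<otimes> x)) = sum (walk k) ((\<lambda>x. inv y \<otimes> x) ` A)"
  proof (subst sum.reindex)
    show "inj_on (\<lambda>x. inv y \<otimes> x) A"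
      using assms by (intro inj_on_subset[OF bij_betw_imp_inj_on[OF bij_left_mult]]) auto
  qed simp
  also have "\<dots> \<le> 1" using assms by (intro sum_walk_le_1) auto
  finally show ?thesis .
qed

text \<open>A bound on the power sum, not on the norm, stated through finite partial sums so that
  one number \<open>X\<close> serves a whole sequence and its pointwise limit without summability
  side conditions.\<close>

definition pow_bounded :: "('a \<Rightarrow> real) \<Rightarrow> real \<Rightarrow> bool" where
  "pow_bounded f X \<longleftrightarrow> (\<forall>x\<in>carrier G. 0 \<le> f x) \<and>
     (\<forall>A. finite A \<and> A \<subseteq> carrier G \<longrightarrow> (\<Sum>x\<in>A. f x powr expo) \<le> X)"

lemma pow_boundedD:
  assumes "pow_bounded f X"
  shows "x \<in> carrier G \<Longrightarrow> 0 \<le> f x"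
    and "finite A \<Longrightarrow> A \<subseteq> carrier G \<Longrightarrow> (\<Sum>x\<in>A. f x powr expo) \<le> X"
    and "0 \<le> X"
proof -
  show "x \<in> carrier G \<Longrightarrow> 0 \<le> f x" using assms by (auto simp: pow_bounded_def)
  show "finite A \<Longrightarrow> A \<subseteq> carrier G \<Longrightarrow> (\<Sum>x\<in>A. f x powr expo) \<le> X" for A
    using assms by (auto simp: pow_bounded_def)
  from this[of "{}"] show "0 \<le> X" by simp
qed

lemma pow_bounded_indicator:
  assumes "x \<in> carrier G"
  shows "pow_bounded (indicator {x}) 1"
proof -
  have "(\<Sum>y\<in>A. indicat_real {x} y powr expo) \<le> 1" if "finite A" for A
  proof -
    have "(\<Sum>y\<in>A. indicat_real {x} y powr expo) = (\<Sum>y\<in>A. if y = x then 1 else 0)"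
      by (rule sum.cong) (auto simp: indicator_def)
    then show ?thesis using that by simp
  qed
  then show ?thesis by (auto simp: pow_bounded_def)
qed

text \<open>\<open>interpolation\<close> summed over both variables, with row and column sums of the
  walk at most 1. The bound is not homogeneous, but it is finite and tends to 0 with
  \<open>X\<close> and \<open>Y\<close>.\<close>

lemma walk_bilinear_le:
  assumes f: "pow_bounded f X" and g: "pow_bounded g Y"
    and A: "finite A" "A \<subseteq> carrier G" and B: "finite B" "B \<subseteq> carrier G"
  shows "(\<Sum>x\<in>A. \<Sum>y\<in>B. walk k (inv y \<otimes> x) * f x * g y) \<le> walk_sup k powr \<theta> * (X * Y + X + Y)"
proof -
  let ?w = "\<lambda>x y. walk k (inv y \<otimes> x)"
  have f0: "0 \<le> f x" and g0: "0 \<le> g x" if "x \<in> carrier G" for x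
    using pow_boundedD(1)[OF f that] pow_boundedD(1)[OF g that] by auto
  have sf: "(\<Sum>x\<in>A. f x powr expo) \<le> X" and sg: "(\<Sum>y\<in>B. g y powr expo) \<le> Y"
    using pow_boundedD(2)[OF f A] pow_boundedD(2)[OF g B] by auto
  have "(\<Sum>x\<in>A. \<Sum>y\<in>B. ?w x y * f x * g y) \<le>
      (\<Sum>x\<in>A. \<Sum>y\<in>B. walk_sup k powr \<theta> *
         (f x powr expo * g y powr expo + ?w x y * f x powr expo + ?w x y * g y powr expo))"
    using A B f0 g0
    by (intro sum_mono interpolation walk_nonneg walk_le_walk_sup) auto
  also have "\<dots> = walk_sup k powr \<theta> * ((\<Sum>x\<in>A. f x powr expo) * (\<Sum>y\<in>B. g y powr expo)
      + (\<Sum>x\<in>A. f x powr expo * (\<Sum>y\<in>B. ?w x y)) + (\<Sum>y\<in>B. g y powr expo * (\<Sum>x\<in>A. ?w x y)))"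
  proof -
    have "(\<Sum>x\<in>A. \<Sum>y\<in>B. ?w x y * g y powr expo) = (\<Sum>y\<in>B. g y powr expo * (\<Sum>x\<in>A. ?w x y))"
      by (subst sum.swap) (simp add: sum_distrib_left mult.commute)
    moreover have "(\<Sum>x\<in>A. \<Sum>y\<in>B. ?w x y * f x powr expo) = (\<Sum>x\<in>A. f x powr expo * (\<Sum>y\<in>B. ?w x y))"
      by (simp add: sum_distrib_left mult.commute)
    ultimately show ?thesis
      by (simp add: sum_distrib_left[symmetric] sum.distrib sum_product)
  qed
  also have "\<dots> \<le> walk_sup k powr \<theta> * (X * Y + X + Y)"
  proof (intro mult_left_mono add_mono)
    show "(\<Sum>x\<in>A. f x powr expo) * (\<Sum>y\<in>B. g y powr expo) \<le> X * Y"
      using sf sg pow_boundedD(3)[OF f] by (intro mult_mono sum_nonneg) auto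
    have "(\<Sum>x\<in>A. f x powr expo * (\<Sum>y\<in>B. ?w x y)) \<le> (\<Sum>x\<in>A. f x powr expo * 1)"
      using A B by (intro sum_mono mult_left_mono sum_walk_row_le_1) auto
    then show "(\<Sum>x\<in>A. f x powr expo * (\<Sum>y\<in>B. ?w x y)) \<le> X" using sf by simp
    have "(\<Sum>y\<in>B. g y powr expo * (\<Sum>x\<in>A. ?w x y)) \<le> (\<Sum>y\<in>B. g y powr expo * 1)"
      using A B by (intro sum_mono mult_left_mono sum_walk_column_le_1) auto
    then show "(\<Sum>y\<in>B. g y powr expo * (\<Sum>x\<in>A. ?w x y)) \<le> Y" using sg by simp
  qed simp
  finally show ?thesis .
qed

text \<open>Setting the diagonal to 0 turns the omission of \<open>y = x\<close> into a property of
  the kernel, so that all sums run over the whole group and translations can be substituted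
  freely.\<close>

definition kern :: "'a \<Rightarrow> 'a \<Rightarrow> real" where
  "kern x y = (if x = y then 0 else frac_green G S \<alpha> x y)"

lemma green_term_nonneg: "x \<in> carrier G \<Longrightarrow> 0 \<le> green_coeff k * walk k x"
  using green_coeff_pos[of k] walk_nonneg[of x k] by simp

lemma frac_green_nonneg: "x \<in> carrier G \<Longrightarrow> y \<in> carrier G \<Longrightarrow> 0 \<le> frac_green G S \<alpha> x y"
  by (auto simp: frac_green_eq intro!: suminf_nonneg summable_green_term green_term_nonneg)

lemma kern_nonneg: "x \<in> carrier G \<Longrightarrow> y \<in> carrier G \<Longrightarrow> 0 \<le> kern x y"
  by (simp add: kern_def frac_green_nonneg)

lemma kern_sym: "x \<in> carrier G \<Longrightarrow> y \<in> carrier G \<Longrightarrow> kern x y = kern y x"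
  using walk_inv[of "inv y \<otimes> x"] by (simp add: kern_def frac_green_eq inv_mult_group)

lemma kern_left_mult:
  assumes "g \<in> carrier G" "x \<in> carrier G" "y \<in> carrier G"
  shows "kern (g \<otimes> x) (g \<otimes> y) = kern x y"
proof -
  have "inv (g \<otimes> y) \<otimes> (g \<otimes> x) = inv y \<otimes> (inv g \<otimes> g \<otimes> x)"
    using assms by (simp only: inv_mult_group m_assoc inv_closed m_closed)
  then show ?thesis using assms by (simp add: kern_def frac_green_eq)
qed

text \<open>The one-step term alone is positive; it comes from the step \<open>inv s\<close>, which
  leads from \<open>s\<close> back to \<open>\<one>\<close>.\<close>

lemma kern_generator_pos:
  assumes "s \<in> S" "s \<noteq> \<one>"
  shows "kern s \<one> > 0"
proof -
  have s: "s \<in> carrier G" using assms by simp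
  have "1 \<le> (\<Sum>t\<in>S. walk 0 s + walk 0 (s \<otimes> t))"
  proof -
    have "1 = (\<Sum>t\<in>{inv s}. walk 0 s + walk 0 (s \<otimes> t))"
      using assms by (simp add: walk_0)
    also have "\<dots> \<le> (\<Sum>t\<in>S. walk 0 s + walk 0 (s \<otimes> t))"
      using assms by (intro sum_mono2) (auto simp: finite_S inv_S walk_0)
    finally show ?thesis .
  qed
  then have "walk 1 s > 0" using s deg_pos by (simp add: walk_Suc)
  then have "0 < green_coeff 1 * walk 1 s" using green_coeff_pos by simp
  also have "\<dots> = (\<Sum>k\<in>{1}. green_coeff k * walk k s)" by simp
  also have "\<dots> \<le> (\<Sum>k. green_coeff k * walk k s)"
    using s by (intro sum_le_suminf summable_green_term green_term_nonneg) auto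
  finally show ?thesis using s assms by (simp add: kern_def frac_green_eq)
qed

text \<open>Green's series is exchanged with the finite double sum. The majorant \<open>c\<close> is
  left free so that it can be the full series of weights or one whose first terms vanish.\<close>

lemma kern_bilinear_walk:
  assumes f: "pow_bounded f X" and g: "pow_bounded g Y"
    and A: "finite A" "A \<subseteq> carrier G" and B: "finite B" "B \<subseteq> carrier G"
    and c: "summable c"
      "\<And>k. green_coeff k * (\<Sum>x\<in>A. \<Sum>y\<in>B. walk k (inv y \<otimes> x) * f x * g y) \<le> c k"
  shows "(\<Sum>x\<in>A. \<Sum>y\<in>B. kern x y * f x * g y) \<le> suminf c"
proof -
  have f0: "0 \<le> f x" and g0: "0 \<le> g x" if "x \<in> carrier G" for x
    using pow_boundedD(1)[OF f that] pow_boundedD(1)[OF g that] by auto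
  have "(\<Sum>x\<in>A. \<Sum>y\<in>B. kern x y * f x * g y) \<le> (\<Sum>x\<in>A. \<Sum>y\<in>B. frac_green G S \<alpha> x y * f x * g y)"
    using A B f0 g0 by (intro sum_mono mult_right_mono) (auto simp: kern_def subset_iff frac_green_nonneg)
  also have "\<dots> \<le> suminf c"
  proof (rule sums_le)
    have "(\<lambda>k. green_coeff k * walk k (inv y \<otimes> x) * f x * g y) sums (frac_green G S \<alpha> x y * f x * g y)"
      if "x \<in> A" "y \<in> B" for x y
    proof -
      have "x \<in> carrier G" "y \<in> carrier G" using that A B by auto
      then show ?thesis
        by (intro sums_mult2) (simp add: frac_green_eq summable_sums summable_green_term)
    qed
    then show "(\<lambda>k. \<Sum>x\<in>A. \<Sum>y\<in>B. green_coeff k * walk k (inv y \<otimes> x) * f x * g y)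
        sums (\<Sum>x\<in>A. \<Sum>y\<in>B. frac_green G S \<alpha> x y * f x * g y)"
      by (intro sums_sum)
    show "c sums suminf c" using c by (simp add: summable_sums)
    show "(\<Sum>x\<in>A. \<Sum>y\<in>B. green_coeff k * walk k (inv y \<otimes> x) * f x * g y) \<le> c k" for k
      using c(2)[of k] by (simp add: sum_distrib_left mult.assoc)
  qed
  finally show ?thesis .
qed

lemma kern_bilinear_le:
  assumes f: "pow_bounded f X" and g: "pow_bounded g Y"
    and A: "finite A" "A \<subseteq> carrier G" and B: "finite B" "B \<subseteq> carrier G"
  shows "(\<Sum>x\<in>A. \<Sum>y\<in>B. kern x y * f x * g y) \<le> suminf green_weight * (X * Y + X + Y)"
proof -
  have "green_coeff k * (\<Sum>x\<in>A. \<Sum>y\<in>B. walk k (inv y \<otimes> x) * f x * g y)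
      \<le> green_weight k * (X * Y + X + Y)" for k
    using mult_left_mono[OF walk_bilinear_le[OF assms, of k] less_imp_le[OF green_coeff_pos[of k]]]
    by (simp add: green_weight_def mult.assoc)
  then have "(\<Sum>x\<in>A. \<Sum>y\<in>B. kern x y * f x * g y) \<le> (\<Sum>k. green_weight k * (X * Y + X + Y))"
    by (intro kern_bilinear_walk[OF assms] summable_mult2[OF summable_green_weight])
  then show ?thesis by (simp add: suminf_mult2[OF summable_green_weight, symmetric])
qed

text \<open>Walks of fewer than \<open>K\<close> steps have finite range, so outside
  \<open>F\<close> only the tail of the convergent series of weights contributes. \<open>F\<close>
  depends on \<open>x\<close>, \<open>X\<close> and \<open>\<epsilon>\<close> but not on
  \<open>f\<close>, which gives uniformity along a sequence.\<close>

lemma kern_tail: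
  assumes x: "x \<in> carrier G" and X: "0 \<le> X" and \<epsilon>: "\<epsilon> > 0"
  obtains F where "finite F" "F \<subseteq> carrier G"
    "\<And>f B. pow_bounded f X \<Longrightarrow> finite B \<Longrightarrow> B \<subseteq> carrier G - F \<Longrightarrow> (\<Sum>y\<in>B. kern x y * f y) \<le> \<epsilon>"
proof -
  \<comment> \<open>The bilinear bound with the point mass at \<open>x\<close> as first factor,
    whose power sum is bounded by 1.\<close>
  define c where "c k = green_weight k * (1 * X + 1 + X)" for k
  have c: "summable c" unfolding c_def by (intro summable_mult2 summable_green_weight)
  then obtain K where K: "norm (\<Sum>k. c (k + K)) < \<epsilon>"
    using suminf_exist_split[OF \<epsilon> c] by blast
  define F where "F = (\<Union>k<K. (\<lambda>z. x \<otimes> inv z) ` walk_support k)"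
  have F: "finite F" "F \<subseteq> carrier G"
    using x by (auto simp: F_def finite_walk_support) (auto simp: walk_support_def)
  have "(\<Sum>y\<in>B. kern x y * f y) \<le> \<epsilon>" if f: "pow_bounded f X" and B: "finite B" "B \<subseteq> carrier G - F" for f B
  proof -
    have Bc: "B \<subseteq> carrier G" using B by auto
    have x1: "pow_bounded (indicator {x}) 1" by (rule pow_bounded_indicator[OF x])
    have xc: "finite {x}" "{x} \<subseteq> carrier G" using x by auto
    define c' where "c' k = (if k < K then 0 else c k)" for k
    have c': "c' sums (\<Sum>k. c (k + K))"
    proof -
      have "(\<lambda>k. c' (k + K)) sums (\<Sum>k. c (k + K))"
        using c by (simp add: c'_def summable_sums)
      then show ?thesis by (subst (asm) sums_iff_shift) (simp add: c'_def)
    qed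
    have "(\<Sum>x'\<in>{x}. \<Sum>y\<in>B. kern x' y * indicator {x} x' * f y) \<le> suminf c'"
    proof (rule kern_bilinear_walk[OF x1 f xc B(1) Bc])
      show "summable c'" using c' by (simp add: sums_iff)
      fix k
      show "green_coeff k * (\<Sum>x'\<in>{x}. \<Sum>y\<in>B. walk k (inv y \<otimes> x') * indicator {x} x' * f y) \<le> c' k"
      proof (cases "k < K")
        case True
        have "walk k (inv y \<otimes> x) = 0" if y: "y \<in> B" for y
        proof (rule ccontr)
          assume "walk k (inv y \<otimes> x) \<noteq> 0"
          then have "inv y \<otimes> x \<in> walk_support k" using x y Bc by (auto simp: walk_support_def)
          moreover have "y = x \<otimes> inv (inv y \<otimes> x)"
            using x y Bc by (simp add: inv_mult_group m_assoc[symmetric] subset_iff)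
          ultimately have "y \<in> F" using True unfolding F_def by blast
          then show False using y B by auto
        qed
        then show ?thesis using True by (simp add: c'_def)
      next
        case False
        then show ?thesis
          using walk_bilinear_le[OF x1 f xc B(1) Bc, of k] green_coeff_pos[of k]
          by (simp add: c'_def c_def green_weight_def mult.assoc)
      qed
    qed
    also have "suminf c' = (\<Sum>k. c (k + K))" using c' by (simp add: sums_iff)
    also have "\<dots> \<le> \<epsilon>" using K by simp
    finally show ?thesis by simp
  qed
  with F show ?thesis using that by blast
qed

section \<open>Potentials and energy\<close>

definition pot :: "('a \<Rightarrow> real) \<Rightarrow> 'a \<Rightarrow> real" where
  "pot f x = (\<Sum>\<^sub>\<infinity>y\<in>carrier G. kern x y * f y)"

definition energy :: "('a \<Rightarrow> real) \<Rightarrow> real" where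
  "energy f = (\<Sum>\<^sub>\<infinity>x\<in>carrier G. pot f x * f x)"

lemma summable_pot:
  assumes f: "pow_bounded f X" and x: "x \<in> carrier G"
  shows "(\<lambda>y. kern x y * f y) summable_on carrier G"
proof (rule summable_on_bounded(1))
  fix y assume "y \<in> carrier G"
  then show "0 \<le> kern x y * f y" using kern_nonneg x pow_boundedD(1)[OF f] by simp
next
  fix B assume B: "finite B" "B \<subseteq> carrier G"
  have "(\<Sum>x'\<in>{x}. \<Sum>y\<in>B. kern x' y * indicator {x} x' * f y) \<le> suminf green_weight * (1 * X + 1 + X)"
    using x B by (intro kern_bilinear_le pow_bounded_indicator f) auto
  then show "(\<Sum>y\<in>B. kern x y * f y) \<le> suminf green_weight * (1 * X + 1 + X)" by simp
qed

lemma has_sum_pot: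
  "pow_bounded f X \<Longrightarrow> x \<in> carrier G \<Longrightarrow> ((\<lambda>y. kern x y * f y) has_sum pot f x) (carrier G)"
  unfolding pot_def by (intro has_sum_infsum summable_pot)

lemma pot_nonneg: "pow_bounded f X \<Longrightarrow> x \<in> carrier G \<Longrightarrow> 0 \<le> pot f x"
  unfolding pot_def by (intro infsum_nonneg mult_nonneg_nonneg kern_nonneg pow_boundedD(1))

lemma sum_energy_le:
  assumes f: "pow_bounded f X" and A: "finite A" "A \<subseteq> carrier G"
  shows "(\<Sum>x\<in>A. pot f x * f x) \<le> suminf green_weight * (X * X + X + X)"
proof (rule has_sum_le_finite_sums)
  show "((\<lambda>y. \<Sum>x\<in>A. kern x y * f y * f x) has_sum (\<Sum>x\<in>A. pot f x * f x)) (carrier G)"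
    using A by (intro has_sum_sum_finite has_sum_cmult_left has_sum_pot[OF f]) auto
  fix B assume B: "finite B" "B \<subseteq> carrier G"
  have "(\<Sum>y\<in>B. \<Sum>x\<in>A. kern x y * f y * f x) = (\<Sum>x\<in>A. \<Sum>y\<in>B. kern x y * f x * f y)"
    by (subst sum.swap) (simp only: mult_ac)
  then show "(\<Sum>y\<in>B. \<Sum>x\<in>A. kern x y * f y * f x) \<le> suminf green_weight * (X * X + X + X)"
    using kern_bilinear_le[OF f f A B] by simp
qed

lemma energy_term_nonneg: "pow_bounded f X \<Longrightarrow> x \<in> carrier G \<Longrightarrow> 0 \<le> pot f x * f x"
  using pot_nonneg pow_boundedD(1) by (intro mult_nonneg_nonneg) auto

lemma summable_energy:
  assumes "pow_bounded f X"
  shows "(\<lambda>x. pot f x * f x) summable_on carrier G"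
    and "energy f \<le> suminf green_weight * (X * X + X + X)"
  unfolding energy_def
  by (rule summable_on_bounded[OF energy_term_nonneg[OF assms] sum_energy_le[OF assms]]; assumption)+

lemma energy_nonneg: "pow_bounded f X \<Longrightarrow> 0 \<le> energy f"
  unfolding energy_def by (intro infsum_nonneg energy_term_nonneg)

lemma sum_le_energy:
  "pow_bounded f X \<Longrightarrow> finite A \<Longrightarrow> A \<subseteq> carrier G \<Longrightarrow> (\<Sum>x\<in>A. pot f x * f x) \<le> energy f"
  unfolding energy_def
  by (intro finite_sum_le_infsum summable_energy) (auto intro: energy_term_nonneg)

lemma energy_left_mult:
  assumes g: "g \<in> carrier G"
  shows "energy (\<lambda>x. f (g \<otimes> x)) = energy f"
proof -
  have "pot (\<lambda>x. f (g \<otimes> x)) x = pot f (g \<otimes> x)" if "x \<in> carrier G" for x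
  proof -
    have "pot f (g \<otimes> x) = (\<Sum>\<^sub>\<infinity>y\<in>carrier G. kern (g \<otimes> x) (g \<otimes> y) * f (g \<otimes> y))"
      unfolding pot_def by (rule infsum_left_mult[OF g, symmetric])
    then show ?thesis
      unfolding pot_def using g that by (simp add: kern_left_mult cong: infsum_cong)
  qed
  then have "energy (\<lambda>x. f (g \<otimes> x)) = (\<Sum>\<^sub>\<infinity>x\<in>carrier G. pot f (g \<otimes> x) * f (g \<otimes> x))"
    unfolding energy_def by (simp cong: infsum_cong)
  also have "\<dots> = energy f" unfolding energy_def by (rule infsum_left_mult[OF g])
  finally show ?thesis .
qed

lemma energy_scale: "energy (\<lambda>x. c * f x) = c\<^sup>2 * energy f"
proof -
  have "pot (\<lambda>x. c * f x) x = c * pot f x" for x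
    unfolding pot_def by (subst infsum_cmult_right'[symmetric]) (simp add: mult_ac)
  then show ?thesis
    unfolding energy_def by (subst infsum_cmult_right'[symmetric]) (simp add: power2_eq_square mult_ac)
qed

lemma HLS_energy_eq:
  assumes f: "pow_bounded (\<lambda>x. \<bar>u x\<bar> powr p) X"
  shows "HLS_energy G S \<alpha> p u = ennreal (energy (\<lambda>x. \<bar>u x\<bar> powr p))"
proof -
  let ?f = "\<lambda>x. \<bar>u x\<bar> powr p"
  have "green_conv G S \<alpha> ?f x = ennreal (pot ?f x)" if x: "x \<in> carrier G" for x
  proof -
    have "green_conv G S \<alpha> ?f x = (\<Sum>\<^sub>\<infinity>y\<in>carrier G. ennreal (kern x y * ?f y))"
      unfolding green_conv_def
      by (rule infsum_cong_neutral) (auto simp: kern_def)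
    also have "\<dots> = ennreal (pot ?f x)"
      unfolding pot_def using x
      by (intro ennreal_infsum summable_pot[OF f] mult_nonneg_nonneg kern_nonneg) auto
    finally show ?thesis .
  qed
  then have "HLS_energy G S \<alpha> p u = (\<Sum>\<^sub>\<infinity>x\<in>carrier G. ennreal (pot ?f x * ?f x))"
    unfolding HLS_energy_def by (intro infsum_cong) (simp add: ennreal_mult'')
  also have "\<dots> = ennreal (energy ?f)"
    unfolding energy_def by (intro ennreal_infsum summable_energy(1)[OF f] energy_term_nonneg[OF f])
  finally show ?thesis .
qed

text \<open>\<open>(1 - \<eta> x) * (1 - \<eta> y) \<ge> 1 - \<eta> x - \<eta> y\<close> linearises
  the double sum; by symmetry of the kernel the two linear parts agree, hence the factor 2. The loss
  of energy under damping is thus measured by potentials at points of \<open>F\<close> only.\<close>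

lemma energy_perturb:
  assumes f: "pow_bounded f X" and g: "pow_bounded g Y"
    and F: "finite F" "F \<subseteq> carrier G"
    and \<eta>: "\<And>x. x \<in> carrier G \<Longrightarrow> 0 \<le> \<eta> x \<and> \<eta> x \<le> 1" "\<And>x. x \<in> carrier G - F \<Longrightarrow> \<eta> x = 0"
    and fg: "\<And>x. x \<in> carrier G \<Longrightarrow> (1 - \<eta> x) * f x \<le> g x"
  shows "energy f \<le> energy g + 2 * (\<Sum>x\<in>F. \<eta> x * f x * pot f x)"
proof -
  have f0: "0 \<le> f x" if "x \<in> carrier G" for x using pow_boundedD(1)[OF f that] .
  have row: "pot f x * f x \<le> pot g x * g x + \<eta> x * f x * pot f x + f x * (\<Sum>y\<in>F. kern x y * (\<eta> y * f y))"
    if x: "x \<in> carrier G" for x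
  proof (rule has_sum_mono)
    show "((\<lambda>y. kern x y * f y * f x) has_sum (pot f x * f x)) (carrier G)"
      by (intro has_sum_cmult_left has_sum_pot[OF f x])
    have "((\<lambda>y. kern x y * (\<eta> y * f y)) has_sum (\<Sum>y\<in>F. kern x y * (\<eta> y * f y))) (carrier G)"
      using F \<eta>(2) by (intro has_sum_finite_neutralI) auto
    then show "((\<lambda>y. kern x y * g y * g x + \<eta> x * f x * (kern x y * f y) + f x * (kern x y * (\<eta> y * f y)))
      has_sum (pot g x * g x + \<eta> x * f x * pot f x + f x * (\<Sum>y\<in>F. kern x y * (\<eta> y * f y)))) (carrier G)"
      by (intro has_sum_add has_sum_cmult_left has_sum_cmult_right has_sum_pot[OF f x] has_sum_pot[OF g x])
    fix y assume y: "y \<in> carrier G"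
    have "(1 - \<eta> x - \<eta> y) * (f x * f y) \<le> (1 - \<eta> x) * (1 - \<eta> y) * (f x * f y)"
      using \<eta>(1)[OF x] \<eta>(1)[OF y] f0[OF x] f0[OF y] by (intro mult_right_mono) (auto simp: algebra_simps)
    also have "\<dots> = ((1 - \<eta> x) * f x) * ((1 - \<eta> y) * f y)" by simp
    also have "\<dots> \<le> g x * g y"
      using fg[OF x] fg[OF y] \<eta>(1)[OF x] \<eta>(1)[OF y] f0[OF x] f0[OF y] pow_boundedD(1)[OF g x]
      by (intro mult_mono) auto
    finally have "f x * f y \<le> g x * g y + \<eta> x * f x * f y + f x * (\<eta> y * f y)"
      by (simp add: algebra_simps)
    then have "kern x y * (f x * f y) \<le> kern x y * (g x * g y + \<eta> x * f x * f y + f x * (\<eta> y * f y))"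
      using kern_nonneg[OF x y] by (rule mult_left_mono)
    then show "kern x y * f y * f x \<le> kern x y * g y * g x + \<eta> x * f x * (kern x y * f y) + f x * (kern x y * (\<eta> y * f y))"
      by (simp add: algebra_simps)
  qed
  have "energy f \<le> energy g + (\<Sum>x\<in>F. \<eta> x * f x * pot f x) + (\<Sum>y\<in>F. \<eta> y * f y * pot f y)"
    unfolding energy_def
  proof (rule has_sum_mono)
    show "((\<lambda>x. pot f x * f x) has_sum (\<Sum>\<^sub>\<infinity>x\<in>carrier G. pot f x * f x)) (carrier G)"
      by (rule has_sum_infsum[OF summable_energy(1)[OF f]])
    have 1: "((\<lambda>x. pot g x * g x) has_sum (\<Sum>\<^sub>\<infinity>x\<in>carrier G. pot g x * g x)) (carrier G)"
      by (rule has_sum_infsum[OF summable_energy(1)[OF g]])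
    have 2: "((\<lambda>x. \<eta> x * f x * pot f x) has_sum (\<Sum>x\<in>F. \<eta> x * f x * pot f x)) (carrier G)"
      using F \<eta>(2) by (intro has_sum_finite_neutralI) auto
    have 3: "((\<lambda>x. \<Sum>y\<in>F. (\<eta> y * f y) * (kern x y * f x)) has_sum (\<Sum>y\<in>F. \<eta> y * f y * pot f y)) (carrier G)"
    proof (intro has_sum_sum_finite F(1) has_sum_cmult_right)
      fix y assume y: "y \<in> F"
      have "((\<lambda>x. kern y x * f x) has_sum pot f y) (carrier G)" using y F by (intro has_sum_pot[OF f]) auto
      then show "((\<lambda>x. kern x y * f x) has_sum pot f y) (carrier G)"
        by (rule has_sum_cong[THEN iffD1, rotated]) (use y F kern_sym in auto)
    qed
    show "((\<lambda>x. pot g x * g x + \<eta> x * f x * pot f x + (\<Sum>y\<in>F. (\<eta> y * f y) * (kern x y * f x))) has_sum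
      ((\<Sum>\<^sub>\<infinity>x\<in>carrier G. pot g x * g x) + (\<Sum>x\<in>F. \<eta> x * f x * pot f x) + (\<Sum>y\<in>F. \<eta> y * f y * pot f y))) (carrier G)"
      by (intro has_sum_add 1 2 3)
    fix x assume "x \<in> carrier G"
    from row[OF this] show "pot f x * f x
        \<le> pot g x * g x + \<eta> x * f x * pot f x + (\<Sum>y\<in>F. (\<eta> y * f y) * (kern x y * f x))"
      by (simp add: sum_distrib_left mult_ac)
  qed
  then show ?thesis by simp
qed

text \<open>Pointwise convergence handles a finite set, and \<open>kern_tail\<close> bounds the rest
  uniformly in \<open>n\<close>. This is the direction that fits \<open>energy_perturb\<close>,
  where potentials stand on the larger side.\<close>

lemma pot_upper_semicontinuous:
  assumes fn: "\<And>n. pow_bounded (fn n) X" and f: "pow_bounded f X"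
    and lim: "\<And>y. y \<in> carrier G \<Longrightarrow> (\<lambda>n. fn n y) \<longlonglongrightarrow> f y"
    and x: "x \<in> carrier G" and \<epsilon>: "\<epsilon> > 0"
  shows "eventually (\<lambda>n. pot (fn n) x \<le> pot f x + \<epsilon>) sequentially"
proof -
  have "\<epsilon> / 2 > 0" using \<epsilon> by simp
  then obtain F where F: "finite F" "F \<subseteq> carrier G" and
    tail: "\<And>f B. pow_bounded f X \<Longrightarrow> finite B \<Longrightarrow> B \<subseteq> carrier G - F \<Longrightarrow> (\<Sum>y\<in>B. kern x y * f y) \<le> \<epsilon> / 2"
    using kern_tail[OF x pow_boundedD(3)[OF f]] by metis
  have "(\<lambda>n. \<Sum>y\<in>F. kern x y * fn n y) \<longlonglongrightarrow> (\<Sum>y\<in>F. kern x y * f y)"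
    using F by (intro tendsto_intros lim) auto
  moreover have "(\<Sum>y\<in>F. kern x y * f y) \<le> pot f x"
    using F x has_sum_pot[OF f x] by (rule_tac finite_sum_le_has_sum)
      (auto intro!: mult_nonneg_nonneg kern_nonneg pow_boundedD(1)[OF f])
  ultimately have "eventually (\<lambda>n. (\<Sum>y\<in>F. kern x y * fn n y) < pot f x + \<epsilon> / 2) sequentially"
    using \<epsilon> by (intro order_tendstoD) auto
  then show ?thesis
  proof eventually_elim
    case (elim n)
    have "pot (fn n) x \<le> (\<Sum>y\<in>F. kern x y * fn n y) + \<epsilon> / 2"
    proof (rule has_sum_le_finite_sums[OF has_sum_pot[OF fn x]])
      fix B assume B: "finite B" "B \<subseteq> carrier G"
      have "(\<Sum>y\<in>B. kern x y * fn n y) = (\<Sum>y\<in>B \<inter> F. kern x y * fn n y) + (\<Sum>y\<in>B - F. kern x y * fn n y)"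
        by (rule sum.Int_Diff[OF B(1)])
      also have "\<dots> \<le> (\<Sum>y\<in>F. kern x y * fn n y) + \<epsilon> / 2"
      proof (rule add_mono)
        show "(\<Sum>y\<in>B \<inter> F. kern x y * fn n y) \<le> (\<Sum>y\<in>F. kern x y * fn n y)"
          using F x by (intro sum_mono2) (auto intro!: mult_nonneg_nonneg kern_nonneg pow_boundedD(1)[OF fn])
        show "(\<Sum>y\<in>B - F. kern x y * fn n y) \<le> \<epsilon> / 2"
          using B by (intro tail fn) auto
      qed
      finally show "(\<Sum>y\<in>B. kern x y * fn n y) \<le> (\<Sum>y\<in>F. kern x y * fn n y) + \<epsilon> / 2" .
    qed
    with elim show ?case by simp
  qed
qed

end

section \<open>Variations and weak convergence in the Dirichlet space\<close>

text \<open>The weighted mean inequality for \<open>(1 - x) powr p\<close> and 1, with weights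
  \<open>1 / p\<close> and \<open>1 - 1 / p\<close>.\<close>

lemma powr_bernoulli:
  fixes x p :: real
  assumes "1 < p" "0 \<le> x" "x \<le> 1"
  shows "1 - p * x \<le> (1 - x) powr p"
proof (cases "x = 1")
  case False
  then have "((1 - x) powr p) powr (1 / p) * 1 powr (1 - 1 / p) \<le> 1 / p * (1 - x) powr p + (1 - 1 / p) * 1"
    using assms by (intro Youngs_inequality_0) auto
  then have "1 - x \<le> 1 / p * (1 - x) powr p + (1 - 1 / p)" using assms by (simp add: powr_powr)
  then have "p * (1 - x) \<le> p * (1 / p * (1 - x) powr p + (1 - 1 / p))"
    using assms by (intro mult_left_mono) auto
  also have "\<dots> = (1 - x) powr p + p - 1" using assms by (simp add: algebra_simps)
  finally show ?thesis by (simp add: algebra_simps)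
qed (use assms in auto)

text \<open>The hypothesis would be an equality at \<open>t = 0\<close>, so its right-hand side
  cannot decrease initially; the derivative there is
  \<open>2 * p * (\<sigma> - K * a)\<close>.\<close>

lemma derivative_comparison:
  fixes K p a b \<sigma> t0 :: real
  assumes "t0 > 0" "p > 0"
    and le: "\<And>t. 0 < t \<Longrightarrow> t \<le> t0 \<Longrightarrow> K \<le> K * (1 - 2 * t * a + t\<^sup>2 * b) powr p + 2 * p * t * \<sigma>"
  shows "K * a \<le> \<sigma>"
proof (rule ccontr)
  assume "\<not> K * a \<le> \<sigma>"
  then have neg: "2 * p * (\<sigma> - K * a) < 0" using \<open>p > 0\<close> by (simp add: mult_pos_neg)
  define \<phi> where "\<phi> t = K * (1 - 2 * t * a + t\<^sup>2 * b) powr p + 2 * p * t * \<sigma>" for t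
  have "(\<phi> has_real_derivative 2 * p * (\<sigma> - K * a)) (at 0)"
    unfolding \<phi>_def by (auto intro!: derivative_eq_intros simp: algebra_simps)
  from DERIV_neg_dec_right[OF this neg] obtain d where d: "d > 0" "\<And>h. h > 0 \<Longrightarrow> h < d \<Longrightarrow> \<phi> (0 + h) < \<phi> 0"
    by blast
  define h where "h = min (d / 2) t0"
  have "0 < h" "h < d" "h \<le> t0" using d \<open>t0 > 0\<close> by (auto simp: h_def)
  then have "\<phi> h < \<phi> 0" "K \<le> \<phi> h" using d(2)[of h] le[of h] by (auto simp: \<phi>_def)
  then show False by (simp add: \<phi>_def)
qed

text \<open>Soft thresholding turns a function vanishing at infinity into a finitely supported one
  without increasing gradients.\<close>

definition soft :: "real \<Rightarrow> real \<Rightarrow> real" where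
  "soft \<epsilon> a = a - max (- \<epsilon>) (min \<epsilon> a)"

text \<open>Firm nonexpansiveness: \<open>soft \<epsilon>\<close> is monotone with slope at most 1.
  It makes the mixed Dirichlet sum of \<open>v\<close> and \<open>soft \<epsilon> v\<close> dominate
  the energy of the latter.\<close>

lemma soft_contraction:
  assumes "\<epsilon> > 0"
  shows "(soft \<epsilon> a - soft \<epsilon> b)\<^sup>2 \<le> (a - b) * (soft \<epsilon> a - soft \<epsilon> b)"
proof -
  have *: "0 \<le> soft \<epsilon> a - soft \<epsilon> b \<and> soft \<epsilon> a - soft \<epsilon> b \<le> a - b" if "b \<le> a" for a b
    using that assms unfolding soft_def by linarith
  have **: "(soft \<epsilon> a - soft \<epsilon> b)\<^sup>2 \<le> (a - b) * (soft \<epsilon> a - soft \<epsilon> b)" if "b \<le> a" for a b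
    unfolding power2_eq_square using *[OF that] by (intro mult_right_mono) auto
  show ?thesis
  proof (cases "b \<le> a")
    case False
    then show ?thesis using **[of a b] by (simp add: power2_commute algebra_simps)
  qed (rule **)
qed

lemma soft_eq_0: "\<bar>a\<bar> \<le> \<epsilon> \<Longrightarrow> soft \<epsilon> a = 0"
  unfolding soft_def by linarith

lemma soft_approx: "\<epsilon> > 0 \<Longrightarrow> \<bar>soft \<epsilon> a - a\<bar> \<le> \<epsilon>"
  unfolding soft_def by linarith

text \<open>At \<open>a = 0\<close> the quotient is 0 by convention, which agrees with
  \<open>soft \<epsilon> 0 = 0\<close>; thresholding is thus multiplication by a factor between 0
  and 1 at every point.\<close>

lemma soft_quotient:
  assumes "\<epsilon> > 0"
  shows "0 \<le> soft \<epsilon> a / a" and "soft \<epsilon> a / a \<le> 1" and "soft \<epsilon> a / a * a = soft \<epsilon> a"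
proof -
  have "a > 0 \<Longrightarrow> 0 \<le> soft \<epsilon> a \<and> soft \<epsilon> a \<le> a" "a < 0 \<Longrightarrow> soft \<epsilon> a \<le> 0 \<and> a \<le> soft \<epsilon> a"
    using assms unfolding soft_def by linarith+
  then show "0 \<le> soft \<epsilon> a / a" "soft \<epsilon> a / a \<le> 1"
    by (cases a "0 :: real" rule: linorder_cases; simp add: divide_nonpos_neg neg_divide_le_eq)+
  show "soft \<epsilon> a / a * a = soft \<epsilon> a"
    using soft_eq_0[of a \<epsilon>] assms by (cases "a = 0") auto
qed

lemma summable_on_finite_change:
  fixes f g :: "'a \<Rightarrow> real"
  assumes f: "f summable_on A" and F: "finite F" "F \<subseteq> A" and eq: "\<And>x. x \<in> A - F \<Longrightarrow> g x = f x"
  shows "g summable_on A" and "infsum g A = infsum f A + (\<Sum>x\<in>F. g x - f x)"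
proof -
  have "((\<lambda>x. g x - f x) has_sum (\<Sum>x\<in>F. g x - f x)) A"
    using F eq by (intro has_sum_finite_neutralI) auto
  with has_sum_infsum[OF f] have "((\<lambda>x. f x + (g x - f x)) has_sum (infsum f A + (\<Sum>x\<in>F. g x - f x))) A"
    by (rule has_sum_add)
  then show "g summable_on A" "infsum g A = infsum f A + (\<Sum>x\<in>F. g x - f x)"
    by (auto simp: has_sum_iff)
qed

section \<open>Local changes of a function and strong convergence\<close>

context cayley_graph
begin

text \<open>The vertices at which \<open>grad_sq\<close> can depend on values in \<open>F\<close>: a
  gradient looks from \<open>x\<close> to \<open>x \<otimes> s\<close>, hence the inverses.\<close>

definition nbhd :: "'a set \<Rightarrow> 'a set" where
  "nbhd F = F \<union> (\<Union>s\<in>S. (\<lambda>x. x \<otimes> inv s) ` F)"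

lemma nbhd: "finite F \<Longrightarrow> finite (nbhd F)" "F \<subseteq> carrier G \<Longrightarrow> nbhd F \<subseteq> carrier G"
  using finite_S by (auto simp: nbhd_def)

lemma grad_sq_off_nbhd:
  assumes eq: "\<And>x. x \<in> carrier G - F \<Longrightarrow> w x = u x" and x: "x \<in> carrier G - nbhd F"
  shows "grad_sq G S w x = grad_sq G S u x"
proof -
  have xc: "x \<in> carrier G" and "x \<notin> F" using x by (auto simp: nbhd_def)
  moreover have "x \<otimes> s \<notin> F" if s: "s \<in> S" for s
  proof
    assume "x \<otimes> s \<in> F"
    moreover have "x = x \<otimes> s \<otimes> inv s" using xc s by (simp add: m_assoc)
    ultimately show False using x s by (auto simp: nbhd_def)
  qed
  ultimately show ?thesis using eq by (simp add: grad_sq_eq)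
qed

lemma grad_sq_left_mult:
  "g \<in> carrier G \<Longrightarrow> x \<in> carrier G \<Longrightarrow> grad_sq G S (\<lambda>x. u (g \<otimes> x)) x = grad_sq G S u (g \<otimes> x)"
  by (simp add: grad_sq_eq m_assoc)

lemma tendsto_grad_sq:
  assumes "\<And>x. x \<in> carrier G \<Longrightarrow> (\<lambda>n. un n x) \<longlonglongrightarrow> v x" "x \<in> carrier G"
  shows "(\<lambda>n. grad_sq G S (un n) x) \<longlonglongrightarrow> grad_sq G S v x"
  using assms by (auto simp: grad_sq_eq intro!: tendsto_intros)

lemma grad_sq_diff_le:
  assumes x: "x \<in> carrier G"
  shows "grad_sq G S (\<lambda>y. u y - v y) x \<le> 2 * grad_sq G S u x + 2 * grad_sq G S v x"
proof -
  have "(a - b - (c - d))\<^sup>2 \<le> 2 * (a - c)\<^sup>2 + 2 * (b - d)\<^sup>2" for a b c d :: real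
    using zero_le_power2[of "(a - c) + (b - d)"] by (simp add: power2_eq_square algebra_simps)
  then show ?thesis
    unfolding grad_sq_eq[OF x] sum_distrib_left sum.distrib[symmetric] by (intro sum_mono)
qed

text \<open>A Radon-Riesz argument: since the norms agree, outside a finite set carrying almost all
  energy of \<open>v\<close> the functions \<open>un n\<close> eventually have little energy too,
  and inside it pointwise convergence suffices.\<close>

lemma D12_norm_diff_tendsto_0:
  assumes lim: "\<And>x. x \<in> carrier G \<Longrightarrow> (\<lambda>n. un n x) \<longlonglongrightarrow> v x"
    and un: "\<And>n. grad_sq G S (un n) summable_on carrier G" "\<And>n. D12_norm G S (un n) = 1"
    and v: "grad_sq G S v summable_on carrier G" "D12_norm G S v = 1"
  shows "(\<lambda>n. D12_norm G S (\<lambda>y. un n y - v y)) \<longlonglongrightarrow> 0"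
proof -
  have "(\<lambda>n. (D12_norm G S (\<lambda>y. un n y - v y))\<^sup>2) \<longlonglongrightarrow> 0"
  proof (rule LIMSEQ_I)
    fix \<epsilon> :: real assume "\<epsilon> > 0"
    \<comment> \<open>The limit of \<open>b\<close> is four times the energy of \<open>v\<close>
      missing from \<open>A\<close>, hence below \<open>\<epsilon> / 2\<close>.\<close>
    have "\<exists>A. finite A \<and> A \<subseteq> carrier G \<and> 1 - \<epsilon> / 8 < (\<Sum>x\<in>A. grad_sq G S v x)"
    proof (rule ccontr)
      assume "\<not> ?thesis"
      then have "\<And>A. finite A \<Longrightarrow> A \<subseteq> carrier G \<Longrightarrow> (\<Sum>x\<in>A. grad_sq G S v x) \<le> 1 - \<epsilon> / 8"
        by (meson not_le)
      then have "(D12_norm G S v)\<^sup>2 \<le> 1 - \<epsilon> / 8"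
        unfolding D12_norm_power2 by (rule infsum_le_finite_sums[OF v(1)])
      then show False using v(2) \<open>\<epsilon> > 0\<close> by simp
    qed
    then obtain A where A: "finite A" "A \<subseteq> carrier G" "1 - \<epsilon> / 8 < (\<Sum>x\<in>A. grad_sq G S v x)" by blast
    define b where "b n = (\<Sum>x\<in>A. grad_sq G S (\<lambda>y. un n y - v y) x)
      + 2 * (1 - (\<Sum>x\<in>A. grad_sq G S (un n) x)) + 2 * (1 - (\<Sum>x\<in>A. grad_sq G S v x))" for n
    have le: "(D12_norm G S (\<lambda>y. un n y - v y))\<^sup>2 \<le> b n" for n
      unfolding D12_norm_power2
    proof (rule summable_on_bounded(2))
      fix B assume B: "finite B" "B \<subseteq> carrier G"
      have tail: "(\<Sum>x\<in>B - A. grad_sq G S w x) \<le> 1 - (\<Sum>x\<in>A. grad_sq G S w x)"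
        if "grad_sq G S w summable_on carrier G" "D12_norm G S w = 1" for w
      proof -
        have "(\<Sum>x\<in>A. grad_sq G S w x) + (\<Sum>x\<in>B - A. grad_sq G S w x) = (\<Sum>x\<in>A \<union> (B - A). grad_sq G S w x)"
          using A B by (intro sum.union_disjoint[symmetric]) auto
        also have "\<dots> \<le> (D12_norm G S w)\<^sup>2"
          using A B that by (intro finite_sum_grad_sq_le) auto
        finally show ?thesis using that by simp
      qed
      have "(\<Sum>x\<in>B. grad_sq G S (\<lambda>y. un n y - v y) x) \<le> (\<Sum>x\<in>A \<union> (B - A). grad_sq G S (\<lambda>y. un n y - v y) x)"
        using A B by (intro sum_mono2) auto
      also have "\<dots> = (\<Sum>x\<in>A. grad_sq G S (\<lambda>y. un n y - v y) x) + (\<Sum>x\<in>B - A. grad_sq G S (\<lambda>y. un n y - v y) x)"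
        using A B by (intro sum.union_disjoint) auto
      also have "(\<Sum>x\<in>B - A. grad_sq G S (\<lambda>y. un n y - v y) x)
          \<le> (\<Sum>x\<in>B - A. 2 * grad_sq G S (un n) x + 2 * grad_sq G S v x)"
        using B by (intro sum_mono grad_sq_diff_le) auto
      also have "\<dots> = 2 * (\<Sum>x\<in>B - A. grad_sq G S (un n) x) + 2 * (\<Sum>x\<in>B - A. grad_sq G S v x)"
        by (simp add: sum.distrib sum_distrib_left)
      also have "\<dots> \<le> 2 * (1 - (\<Sum>x\<in>A. grad_sq G S (un n) x)) + 2 * (1 - (\<Sum>x\<in>A. grad_sq G S v x))"
        using tail[OF un] tail[OF v] by (intro add_mono mult_left_mono) auto
      finally show "(\<Sum>x\<in>B. grad_sq G S (\<lambda>y. un n y - v y) x) \<le> b n" by (simp add: b_def add.assoc)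
    qed simp
    have "(\<lambda>n. grad_sq G S (\<lambda>y. un n y - v y) x) \<longlonglongrightarrow> 0" if "x \<in> carrier G" for x
    proof -
      have "(\<lambda>n. grad_sq G S (\<lambda>y. un n y - v y) x) \<longlonglongrightarrow> grad_sq G S (\<lambda>y. 0) x"
        using lim that by (intro tendsto_grad_sq) (auto intro: LIM_zero)
      then show ?thesis using that by (simp add: grad_sq_eq)
    qed
    then have "b \<longlonglongrightarrow> (\<Sum>x\<in>A. 0) + 2 * (1 - (\<Sum>x\<in>A. grad_sq G S v x)) + 2 * (1 - (\<Sum>x\<in>A. grad_sq G S v x))"
      unfolding b_def using A by (intro tendsto_intros tendsto_grad_sq lim) auto
    moreover have "(\<Sum>x\<in>A. 0) + 2 * (1 - (\<Sum>x\<in>A. grad_sq G S v x)) + 2 * (1 - (\<Sum>x\<in>A. grad_sq G S v x)) < \<epsilon>"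
      using A \<open>\<epsilon> > 0\<close> by simp
    ultimately have "eventually (\<lambda>n. b n < \<epsilon>) sequentially" by (rule order_tendstoD)
    then obtain n0 where "\<And>n. n \<ge> n0 \<Longrightarrow> b n < \<epsilon>" by (auto simp: eventually_sequentially)
    then have "norm ((D12_norm G S (\<lambda>y. un n y - v y))\<^sup>2 - 0) < \<epsilon>" if "n \<ge> n0" for n
      using that le[of n] by (smt (verit) real_norm_def zero_le_power2)
    then show "\<exists>n0. \<forall>n\<ge>n0. norm ((D12_norm G S (\<lambda>y. un n y - v y))\<^sup>2 - 0) < \<epsilon>" by blast
  qed
  from tendsto_real_sqrt[OF this] show ?thesis by simp
qed

end

section \<open>Operations and bounds in the Dirichlet space\<close>

context polynomial_growth_cayley_graph
begin

lemma D12_D: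
  assumes "u \<in> D12 G S N"
  shows "(\<lambda>x. \<bar>u x\<bar> powr crit) summable_on carrier G" and "grad_sq G S u summable_on carrier G"
  using assms by (auto simp: D12_def ell_def)

text \<open>The change of energy is a finite sum, so it passes to the limit under mere pointwise
  convergence although the energies themselves may not.\<close>

lemma D12_finite_change:
  assumes u: "u \<in> D12 G S N" and F: "finite F" "F \<subseteq> carrier G"
    and eq: "\<And>x. x \<in> carrier G - F \<Longrightarrow> w x = u x"
  shows "w \<in> D12 G S N"
    and "(D12_norm G S w)\<^sup>2 = (D12_norm G S u)\<^sup>2 + (\<Sum>x\<in>nbhd F. grad_sq G S w x - grad_sq G S u x)"
proof -
  have "(\<lambda>x. \<bar>w x\<bar> powr crit) summable_on carrier G"
    by (rule summable_on_finite_change(1)[OF D12_D(1)[OF u] F]) (simp add: eq)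
  moreover have off: "grad_sq G S w x = grad_sq G S u x" if "x \<in> carrier G - nbhd F" for x
    by (rule grad_sq_off_nbhd[OF eq that])
  ultimately show "w \<in> D12 G S N"
    using summable_on_finite_change(1)[OF D12_D(2)[OF u] nbhd(1)[OF F(1)] nbhd(2)[OF F(2)] off]
    by (simp add: D12_def ell_def)
  show "(D12_norm G S w)\<^sup>2 = (D12_norm G S u)\<^sup>2 + (\<Sum>x\<in>nbhd F. grad_sq G S w x - grad_sq G S u x)"
    unfolding D12_norm_power2
    by (rule summable_on_finite_change(2)[OF D12_D(2)[OF u] nbhd(1)[OF F(1)] nbhd(2)[OF F(2)] off])
qed

lemma D12_left_mult:
  assumes u: "u \<in> D12 G S N" and g: "g \<in> carrier G"
  shows "(\<lambda>x. u (g \<otimes> x)) \<in> D12 G S N"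
    and "D12_norm G S (\<lambda>x. u (g \<otimes> x)) = D12_norm G S u"
proof -
  have "(\<lambda>x. \<bar>u (g \<otimes> x)\<bar> powr crit) summable_on carrier G"
    using summable_on_left_mult[OF g, of "\<lambda>x. \<bar>u x\<bar> powr crit"] D12_D(1)[OF u] by simp
  moreover have "grad_sq G S (\<lambda>x. u (g \<otimes> x)) summable_on carrier G"
    using summable_on_left_mult[OF g, of "grad_sq G S u"] D12_D(2)[OF u] g
    by (simp add: grad_sq_left_mult cong: summable_on_cong)
  ultimately show "(\<lambda>x. u (g \<otimes> x)) \<in> D12 G S N" by (simp add: D12_def ell_def)
  show "D12_norm G S (\<lambda>x. u (g \<otimes> x)) = D12_norm G S u"
    unfolding D12_norm_def using infsum_left_mult[OF g, of "grad_sq G S u"] g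
    by (simp add: grad_sq_left_mult cong: infsum_cong)
qed

lemma D12_scale:
  assumes u: "u \<in> D12 G S N"
  shows "(\<lambda>x. c * u x) \<in> D12 G S N"
    and "D12_norm G S (\<lambda>x. c * u x) = \<bar>c\<bar> * D12_norm G S u"
proof -
  have g: "grad_sq G S (\<lambda>x. c * u x) x = c\<^sup>2 * grad_sq G S u x" if "x \<in> carrier G" for x
    using that by (simp add: grad_sq_eq sum_distrib_left power_mult_distrib[symmetric] right_diff_distrib)
  have "(\<lambda>x. \<bar>c * u x\<bar> powr crit) summable_on carrier G"
    using summable_on_cmult_right[OF D12_D(1)[OF u], of "\<bar>c\<bar> powr crit"] by (simp add: abs_mult powr_mult)
  moreover have "grad_sq G S (\<lambda>x. c * u x) summable_on carrier G"
    using summable_on_cmult_right[OF D12_D(2)[OF u], of "c\<^sup>2"] by (simp add: g cong: summable_on_cong)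
  ultimately show "(\<lambda>x. c * u x) \<in> D12 G S N" by (simp add: D12_def ell_def)
  show "D12_norm G S (\<lambda>x. c * u x) = \<bar>c\<bar> * D12_norm G S u"
    unfolding D12_norm_def
    by (simp add: g infsum_cmult_right' real_sqrt_mult cong: infsum_cong)
qed

lemma abs_powr_le_infsum:
  assumes u: "u \<in> D12 G S N" and x: "x \<in> carrier G"
  shows "\<bar>u x\<bar> powr crit \<le> (\<Sum>\<^sub>\<infinity>x\<in>carrier G. \<bar>u x\<bar> powr crit)"
  using finite_sum_le_infsum[OF D12_D(1)[OF u], of "{x}"] x by simp

lemma D12_abs_le:
  assumes u: "u \<in> D12 G S N" and Z: "(\<Sum>\<^sub>\<infinity>x\<in>carrier G. \<bar>u x\<bar> powr crit) \<le> Z" and x: "x \<in> carrier G"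
  shows "\<bar>u x\<bar> \<le> Z powr (1 / crit)"
proof -
  have c: "crit > 0" using crit_gt_2 by linarith
  then have c': "0 \<le> 1 / crit" by (rule divide_nonneg_pos[OF zero_le_one])
  have "\<bar>u x\<bar> powr crit \<le> Z" using abs_powr_le_infsum[OF u x] Z by linarith
  then have "(\<bar>u x\<bar> powr crit) powr (1 / crit) \<le> Z powr (1 / crit)" by (rule powr_mono2[OF c' powr_ge_zero])
  moreover have "crit * (1 / crit) = 1" using c N3 by simp
  ultimately show ?thesis by (simp only: powr_powr powr_one abs_ge_zero)
qed

lemma D12_norm_eq_0:
  assumes u: "u \<in> D12 G S N" and "D12_norm G S u = 0" and x: "x \<in> carrier G"
  shows "u x = 0"
proof -
  obtain C where "\<And>u. u \<in> D12 G S N \<Longrightarrow>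
       (\<Sum>\<^sub>\<infinity>x\<in>carrier G. \<bar>u x\<bar> powr crit) \<le> C * ((D12_norm G S u)\<^sup>2) powr (real N / (real N - 2))"
    using sobolev by blast
  from this[OF u] have "(\<Sum>\<^sub>\<infinity>x\<in>carrier G. \<bar>u x\<bar> powr crit) \<le> 0" using assms by simp
  then have "\<bar>u x\<bar> powr crit = 0"
    using abs_powr_le_infsum[OF u x] powr_ge_zero[of "\<bar>u x\<bar>" crit] by linarith
  then show ?thesis by (simp only: powr_eq_0_iff abs_eq_0)
qed

lemma unit_ball_bounds:
  obtains Z M where "Z \<ge> 0" "M > 0"
    "\<And>u. u \<in> D12 G S N \<Longrightarrow> D12_norm G S u \<le> 1 \<Longrightarrow> (\<Sum>\<^sub>\<infinity>x\<in>carrier G. \<bar>u x\<bar> powr crit) \<le> Z"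
    "\<And>u x. u \<in> D12 G S N \<Longrightarrow> D12_norm G S u \<le> 1 \<Longrightarrow> x \<in> carrier G \<Longrightarrow> \<bar>u x\<bar> \<le> M"
proof -
  obtain C where C: "C > 0" "\<And>u. u \<in> D12 G S N \<Longrightarrow>
       (\<Sum>\<^sub>\<infinity>x\<in>carrier G. \<bar>u x\<bar> powr crit) \<le> C * ((D12_norm G S u)\<^sup>2) powr (real N / (real N - 2))"
    using sobolev by blast
  have 1: "(\<Sum>\<^sub>\<infinity>x\<in>carrier G. \<bar>u x\<bar> powr crit) \<le> C" if u: "u \<in> D12 G S N" "D12_norm G S u \<le> 1" for u
  proof -
    have "(D12_norm G S u)\<^sup>2 \<le> 1" using u(2) by (simp add: power_le_one)
    then have "((D12_norm G S u)\<^sup>2) powr (real N / (real N - 2)) \<le> 1 powr (real N / (real N - 2))"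
      using N3 by (intro powr_mono2) auto
    then have "C * ((D12_norm G S u)\<^sup>2) powr (real N / (real N - 2)) \<le> C * 1"
      using C(1) by (intro mult_left_mono) auto
    with C(2)[OF u(1)] show ?thesis by linarith
  qed
  show ?thesis
  proof (rule that[of C "C powr (1 / crit)"])
    show "\<bar>u x\<bar> \<le> C powr (1 / crit)"
      if "u \<in> D12 G S N" "D12_norm G S u \<le> 1" "x \<in> carrier G" for u x
      by (rule D12_abs_le[OF that(1) 1[OF that(1,2)] that(3)])
  qed (use C 1 in auto)
qed

text \<open>Needed for the diagonal choice of a subsequence converging at every point.\<close>

lemma countable_carrier: "countable (carrier G)"
proof -
  have "carrier G = (\<Union>n\<in>{1..}. word_ball n)"
  proof
    show "carrier G \<subseteq> (\<Union>n\<in>{1..}. word_ball n)"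
    proof
      fix x assume "x \<in> carrier G"
      then have "x \<in> word_ball (Suc (word_dist G S \<one> x))" by (simp add: word_ball_def)
      then show "x \<in> (\<Union>n\<in>{1..}. word_ball n)" by force
    qed
  qed (auto simp: word_ball_def)
  moreover have "countable (\<Union>n\<in>{1..}. word_ball n)"
    by (rule countable_UN) (auto intro!: countable_finite finite_word_ball)
  ultimately show ?thesis by simp
qed

end

section \<open>Maximizing sequences\<close>

context hls_setting
begin

abbreviation pw :: "('a \<Rightarrow> real) \<Rightarrow> 'a \<Rightarrow> real" where
  "pw u \<equiv> \<lambda>x. \<bar>u x\<bar> powr p"

lemma p_gt_1: "p > 1"
proof -
  have "1 < (real N + \<alpha>) / (real N - 2)" using N3 \<alpha> by (simp add: field_simps)
  then show ?thesis using p by linarith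
qed

lemma pow_bounded_mono: "pow_bounded f X \<Longrightarrow> X \<le> Y \<Longrightarrow> pow_bounded f Y"
  unfolding pow_bounded_def by (meson order_trans)

text \<open>The excess of \<open>p * expo\<close> over \<open>crit\<close> is spent on the uniform
  bound \<open>m\<close>, the rest on the Sobolev sum. The positive power of \<open>m\<close> is
  what makes the energy of uniformly small functions small.\<close>

lemma pow_bounded_pw:
  assumes u: "u \<in> D12 G S N" and m: "\<And>x. x \<in> carrier G \<Longrightarrow> \<bar>u x\<bar> \<le> m"
    and Z: "(\<Sum>\<^sub>\<infinity>x\<in>carrier G. \<bar>u x\<bar> powr crit) \<le> Z"
  shows "pow_bounded (pw u) (m powr (p * expo - crit) * Z)"
  unfolding pow_bounded_def
proof (intro conjI ballI allI impI)
  fix A assume A: "finite A \<and> A \<subseteq> carrier G"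
  have "(\<Sum>x\<in>A. pw u x powr expo) \<le> (\<Sum>x\<in>A. m powr (p * expo - crit) * \<bar>u x\<bar> powr crit)"
  proof (rule sum_mono)
    fix x assume "x \<in> A"
    then have x: "x \<in> carrier G" using A by auto
    have "pw u x powr expo = \<bar>u x\<bar> powr ((p * expo - crit) + crit)" by (simp only: powr_powr diff_add_cancel)
    also have "\<dots> = \<bar>u x\<bar> powr (p * expo - crit) * \<bar>u x\<bar> powr crit" by (simp only: powr_add)
    also have "\<dots> \<le> m powr (p * expo - crit) * \<bar>u x\<bar> powr crit"
      using m[OF x] expo(3) by (intro mult_right_mono powr_mono2) auto
    finally show "pw u x powr expo \<le> m powr (p * expo - crit) * \<bar>u x\<bar> powr crit" .
  qed
  also have "\<dots> = m powr (p * expo - crit) * (\<Sum>x\<in>A. \<bar>u x\<bar> powr crit)" by (rule sum_distrib_left[symmetric])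
  also have "\<dots> \<le> m powr (p * expo - crit) * Z"
    using A finite_sum_le_infsum[OF D12_D(1)[OF u], of A] Z by (intro mult_left_mono) auto
  finally show "(\<Sum>x\<in>A. pw u x powr expo) \<le> m powr (p * expo - crit) * Z" .
qed simp

lemma pow_bounded_pw_ex: "u \<in> D12 G S N \<Longrightarrow> \<exists>X. pow_bounded (pw u) X"
  by (rule exI, rule pow_bounded_pw, assumption, rule D12_abs_le[OF _ order_refl], assumption+, rule order_refl)

lemma HLS_energy_D12: "u \<in> D12 G S N \<Longrightarrow> HLS_energy G S \<alpha> p u = ennreal (energy (pw u))"
  using pow_bounded_pw_ex HLS_energy_eq by blast

lemma energy_pw_nonneg: "u \<in> D12 G S N \<Longrightarrow> 0 \<le> energy (pw u)"
  using pow_bounded_pw_ex energy_nonneg by blast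

text \<open>The bilinear bound on the unit sphere makes the supremum finite; scaling, of degree
  \<open>2 * p\<close> for the energy, then restores the homogeneity that the bilinear bound
  lacks.\<close>

lemma best_constant:
  obtains K where "K > 0" "HLS_sup G S N \<alpha> p = ennreal K"
    "\<And>u. u \<in> D12 G S N \<Longrightarrow> energy (pw u) \<le> K * ((D12_norm G S u)\<^sup>2) powr p"
proof -
  obtain Z M where ZM: "Z \<ge> 0" "M > 0"
    "\<And>u. u \<in> D12 G S N \<Longrightarrow> D12_norm G S u \<le> 1 \<Longrightarrow> (\<Sum>\<^sub>\<infinity>x\<in>carrier G. \<bar>u x\<bar> powr crit) \<le> Z"
    "\<And>u x. u \<in> D12 G S N \<Longrightarrow> D12_norm G S u \<le> 1 \<Longrightarrow> x \<in> carrier G \<Longrightarrow> \<bar>u x\<bar> \<le> M"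
    using unit_ball_bounds by blast
  define X where "X = M powr (p * expo - crit) * Z"
  have "HLS_sup G S N \<alpha> p \<le> ennreal (suminf green_weight * (X * X + X + X))"
    unfolding HLS_sup_def
  proof (rule SUP_least)
    fix u assume "u \<in> {u \<in> D12 G S N. D12_norm G S u = 1}"
    then have u: "u \<in> D12 G S N" "D12_norm G S u \<le> 1" by auto
    have "pow_bounded (pw u) X" unfolding X_def by (intro pow_bounded_pw u ZM)
    then show "HLS_energy G S \<alpha> p u \<le> ennreal (suminf green_weight * (X * X + X + X))"
      unfolding HLS_energy_D12[OF u(1)] by (intro ennreal_leI summable_energy(2))
  qed
  then obtain K where K: "K \<ge> 0" "HLS_sup G S N \<alpha> p = ennreal K"
    by (cases "HLS_sup G S N \<alpha> p") (auto simp: top_unique)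
  have unit: "energy (pw u) \<le> K" if "u \<in> D12 G S N" "D12_norm G S u = 1" for u
  proof -
    have "HLS_energy G S \<alpha> p u \<le> HLS_sup G S N \<alpha> p"
      unfolding HLS_sup_def using that by (intro SUP_upper) auto
    then show ?thesis using K that by (simp add: HLS_energy_D12)
  qed
  have gen: "energy (pw u) \<le> K * ((D12_norm G S u)\<^sup>2) powr p" if u: "u \<in> D12 G S N" for u
  proof (cases "D12_norm G S u = 0")
    case True
    then have "energy (pw u) = (\<Sum>\<^sub>\<infinity>x\<in>carrier G. 0)"
      unfolding energy_def using D12_norm_eq_0[OF u] by (intro infsum_cong) simp
    then show ?thesis using K by simp
  next
    case False
    define c where "c = D12_norm G S u"
    have c: "c > 0" using False D12_norm_nonneg[of u] unfolding c_def by linarith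
    have "energy (pw (\<lambda>x. 1 / c * u x)) \<le> K"
      using c D12_scale[OF u, of "1 / c"] by (intro unit) (auto simp: c_def)
    also have "pw (\<lambda>x. 1 / c * u x) = (\<lambda>x. (1 / c) powr p * pw u x)"
      using c by (simp add: abs_mult powr_mult powr_divide)
    also have "energy \<dots> = energy (pw u) / (c powr p)\<^sup>2"
      unfolding energy_scale using c by (simp add: powr_divide power_divide)
    finally have "energy (pw u) \<le> K * (c powr p)\<^sup>2"
      using c by (simp add: field_simps)
    also have "(c powr p)\<^sup>2 = (c\<^sup>2) powr p" using c by (simp add: power2_eq_square powr_mult)
    finally show ?thesis by (simp add: c_def)
  qed
  obtain s where s: "s \<in> S" "s \<noteq> \<one>" using nontrivial_generator by blast
  \<comment> \<open>Two adjacent points are used because a point mass has energy 0, the diagonal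
    being omitted.\<close>
  define u0 where "u0 = indicat_real {\<one>, s}"
  have "grad_sq G S (\<lambda>x. 0) = (\<lambda>x. 0)" by (simp add: grad_sq_def fun_eq_iff)
  then have "(\<lambda>x. 0) \<in> D12 G S N" by (simp add: D12_def ell_def)
  then have u0: "u0 \<in> D12 G S N"
    by (rule D12_finite_change(1)[where F = "{\<one>, s}"]) (use s in \<open>auto simp: u0_def\<close>)
  obtain X0 where X0: "pow_bounded (pw u0) X0" using pow_bounded_pw_ex[OF u0] by blast
  have sc: "s \<in> carrier G" using s by simp
  have "0 < kern s \<one>" by (rule kern_generator_pos[OF s])
  also have "\<dots> = (\<Sum>y\<in>{\<one>}. kern s y * pw u0 y)" by (simp add: u0_def)
  also have "\<dots> \<le> pot (pw u0) s"
    using sc by (intro finite_sum_le_has_sum[OF has_sum_pot[OF X0 sc]]) (auto intro!: mult_nonneg_nonneg kern_nonneg)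
  also have "\<dots> = (\<Sum>x\<in>{s}. pot (pw u0) x * pw u0 x)" by (simp add: u0_def)
  also have "\<dots> \<le> energy (pw u0)" using sc by (intro sum_le_energy[OF X0]) auto
  also have "\<dots> \<le> K * ((D12_norm G S u0)\<^sup>2) powr p" by (rule gen[OF u0])
  finally have "K \<noteq> 0" by auto
  then show ?thesis using that[of K] K gen by simp
qed

lemma nonvanishing:
  assumes "K > 0"
  obtains c where "c > 0"
    "\<And>u. u \<in> D12 G S N \<Longrightarrow> D12_norm G S u \<le> 1 \<Longrightarrow> K / 2 \<le> energy (pw u) \<Longrightarrow> \<exists>x\<in>carrier G. c \<le> \<bar>u x\<bar>"
proof -
  obtain Z M where ZM: "Z \<ge> 0" "M > 0"
    "\<And>u. u \<in> D12 G S N \<Longrightarrow> D12_norm G S u \<le> 1 \<Longrightarrow> (\<Sum>\<^sub>\<infinity>x\<in>carrier G. \<bar>u x\<bar> powr crit) \<le> Z"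
    "\<And>u x. u \<in> D12 G S N \<Longrightarrow> D12_norm G S u \<le> 1 \<Longrightarrow> x \<in> carrier G \<Longrightarrow> \<bar>u x\<bar> \<le> M"
    using unit_ball_bounds by blast
  define W where "W = suminf green_weight + 1"
  have W: "W > 0" "suminf green_weight \<le> W"
    using suminf_nonneg[OF summable_green_weight green_weight_nonneg] by (auto simp: W_def)
  \<comment> \<open>For \<open>X \<le> 1\<close> the bound \<open>X * X + X + X\<close> is at most
    \<open>3 * X\<close>, and the factor 8 brings the energy to \<open>3 * K / 8\<close>, strictly
    below \<open>K / 2\<close>.\<close>
  define X where "X = min 1 (K / (8 * W))"
  have X: "0 < X" "X \<le> 1" "W * X \<le> K / 8"
  proof -
    have "W * X \<le> W * (K / (8 * W))" using W by (intro mult_left_mono) (auto simp: X_def)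
    then show "W * X \<le> K / 8" using W by simp
  qed (use assms W in \<open>auto simp: X_def\<close>)
  define \<beta> where "\<beta> = p * expo - crit"
  have \<beta>: "\<beta> > 0" using expo(3) by (simp only: \<beta>_def diff_gt_0_iff_gt)
  \<comment> \<open>Chosen so that \<open>c powr \<beta> * (Z + 1) = X\<close>; the summand 1 avoids
    division by 0.\<close>
  define c where "c = (X / (Z + 1)) powr (1 / \<beta>)"
  have c: "c > 0" using X ZM by (simp add: c_def)
  have cZ: "c powr \<beta> * Z \<le> X"
  proof -
    have "c powr \<beta> = X / (Z + 1)" using X ZM \<beta> by (simp add: c_def powr_powr)
    moreover have "X / (Z + 1) * Z \<le> X" using X ZM by (simp add: field_simps)
    ultimately show ?thesis by simp
  qed
  have "\<exists>x\<in>carrier G. c \<le> \<bar>u x\<bar>"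
    if u: "u \<in> D12 G S N" "D12_norm G S u \<le> 1" and e: "K / 2 \<le> energy (pw u)" for u
  proof (rule ccontr)
    assume "\<not> ?thesis"
    then have "\<bar>u x\<bar> \<le> c" if "x \<in> carrier G" for x using that by force
    then have "pow_bounded (pw u) (c powr (p * expo - crit) * Z)"
      by (intro pow_bounded_pw u ZM)
    then have "pow_bounded (pw u) X" using cZ unfolding \<beta>_def by (rule pow_bounded_mono)
    then have "energy (pw u) \<le> suminf green_weight * (X * X + X + X)" by (rule summable_energy(2))
    also have "\<dots> \<le> W * (X * X + X + X)" using W X by (intro mult_right_mono) auto
    also have "\<dots> \<le> W * (3 * X)"
    proof (rule mult_left_mono)
      have "X * X \<le> 1 * X" using X by (intro mult_right_mono) auto
      then show "X * X + X + X \<le> 3 * X" by simp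
    qed (use W in auto)
    also have "\<dots> \<le> 3 * (K / 8)" using X by simp
    finally show False using e \<open>K > 0\<close> by simp
  qed
  then show ?thesis using that c by blast
qed

text \<open>The maximality of \<open>un\<close> up to \<open>o(1)\<close> is tested against the variations
  \<open>(1 - t * \<zeta>) * un\<close>, where \<open>\<zeta> = soft \<epsilon> v / v\<close> is finitely supported, so that only
  pointwise convergence matters. As \<open>n \<rightarrow> \<infinity>\<close> and then \<open>t \<rightarrow> 0\<close> this gives the
  Euler--Lagrange inequality \<open>K * E(soft \<epsilon> v) \<le> energy (pw v)\<close>, where \<open>E\<close> is the squared norm.\<close>

lemma euler_lagrange:
  assumes K: "K > 0" "\<And>u. u \<in> D12 G S N \<Longrightarrow> energy (pw u) \<le> K * ((D12_norm G S u)\<^sup>2) powr p"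
    and un: "\<And>n. un n \<in> D12 G S N" "\<And>n. D12_norm G S (un n) = 1"
    and max: "(\<lambda>n. energy (pw (un n))) \<longlonglongrightarrow> K"
    and lim: "\<And>x. x \<in> carrier G \<Longrightarrow> (\<lambda>n. un n x) \<longlonglongrightarrow> v x"
    and X: "\<And>n. pow_bounded (pw (un n)) X" "pow_bounded (pw v) X"
    and v: "(\<lambda>x. \<bar>v x\<bar> powr crit) summable_on carrier G"
    and A: "finite A" "A \<subseteq> carrier G" and \<epsilon>: "\<epsilon> > 0"
  shows "K * (\<Sum>x\<in>A. grad_sq G S (\<lambda>x. soft \<epsilon> (v x)) x) \<le> energy (pw v)"
proof -
  define h where "h x = soft \<epsilon> (v x)" for x
  define \<zeta> where "\<zeta> x = h x / v x" for x
  have \<zeta>: "0 \<le> \<zeta> x" "\<zeta> x \<le> 1" "\<zeta> x * v x = h x" for x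
    using soft_quotient[OF \<epsilon>, of "v x"] by (auto simp: \<zeta>_def h_def)
  define F where "F = {x \<in> carrier G. \<epsilon> powr crit \<le> \<bar>v x\<bar> powr crit}"
  have F: "finite F" "F \<subseteq> carrier G"
    unfolding F_def using summable_on_finite_super_level(1)[OF v] \<epsilon> by auto
  have hF: "h x = 0" if "x \<in> carrier G - F" for x
  proof -
    have "\<bar>v x\<bar> powr crit < \<epsilon> powr crit" using that by (auto simp: F_def)
    then have "\<bar>v x\<bar> \<le> \<epsilon>"
      using crit_gt_2 \<epsilon> powr_mono2[of crit \<epsilon> "\<bar>v x\<bar>"] by linarith
    then show ?thesis by (simp add: h_def soft_eq_0)
  qed
  have \<zeta>F: "\<zeta> x = 0" if "x \<in> carrier G - F" for x using hF[OF that] by (simp add: \<zeta>_def)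
  let ?n = "nbhd F"
  have n: "finite ?n" "?n \<subseteq> carrier G" using nbhd F by auto
  \<comment> \<open>\<open>- 2 * t * a + t\<^sup>2 * b\<close> will be the change of the squared
    norm when \<open>v\<close> is replaced by \<open>v - t * h\<close>. The sums stop at
    \<open>nbhd F\<close> because the gradient of \<open>h\<close> vanishes elsewhere.\<close>
  define a where "a = (\<Sum>x\<in>?n. \<Sum>s\<in>S. (v (x \<otimes> s) - v x) * (h (x \<otimes> s) - h x))"
  define b where "b = (\<Sum>x\<in>?n. grad_sq G S h x)"
  define B where "B = (\<Sum>x\<in>F. \<zeta> x * pw v x)"
  have B: "B \<ge> 0" using \<zeta> by (simp add: B_def sum_nonneg)
  \<comment> \<open>The slack \<open>\<delta>\<close> from upper semicontinuity enters multiplied by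
    \<open>t\<close>; it survives in the derivative as \<open>\<delta> * B\<close> and is removed
    only afterwards.\<close>
  have *: "K * a \<le> energy (pw v) + \<delta> * B" if \<delta>: "\<delta> > 0" for \<delta>
  proof (rule derivative_comparison[of "1 / p" p])
    show "1 / p > 0" "p > 0" using p_gt_1 by auto
    \<comment> \<open>The range \<open>t \<le> 1 / p\<close> keeps \<open>p * t * \<zeta> x\<close>
      at most 1, as \<open>energy_perturb\<close> demands of its weight.\<close>
    fix t :: real assume t: "0 < t" "t \<le> 1 / p"
    have pt: "p * t \<le> 1" "t \<le> 1"
    proof -
      show "p * t \<le> 1" using t p_gt_1 by (simp add: field_simps)
      moreover have "1 * t \<le> p * t" using t p_gt_1 by (intro mult_right_mono) auto
      ultimately show "t \<le> 1" by simp
    qed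
    define w where "w n x = (1 - t * \<zeta> x) * un n x" for n x
    have tx: "0 \<le> t * \<zeta> x" "t * \<zeta> x \<le> 1" "0 \<le> p * t * \<zeta> x" "p * t * \<zeta> x \<le> 1" for x
    proof -
      show "0 \<le> t * \<zeta> x" "0 \<le> p * t * \<zeta> x" using \<zeta>[of x] t p_gt_1 by auto
      have "t * \<zeta> x \<le> 1 * 1" using \<zeta>[of x] t pt by (intro mult_mono) auto
      then show "t * \<zeta> x \<le> 1" by simp
      have "(p * t) * \<zeta> x \<le> 1 * 1" using \<zeta>[of x] pt by (intro mult_mono) auto
      then show "p * t * \<zeta> x \<le> 1" by simp
    qed
    have wu: "w n x = un n x" if "x \<in> carrier G - F" for n x using \<zeta>F[OF that] by (simp add: w_def)
    have w: "w n \<in> D12 G S N" for n by (rule D12_finite_change(1)[OF un(1) F wu])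
    define g where "g n = (\<Sum>x\<in>?n. grad_sq G S (w n) x - grad_sq G S (un n) x)" for n
    have nw: "(D12_norm G S (w n))\<^sup>2 = 1 + g n" for n
      using D12_finite_change(2)[OF un(1)[of n] F, where w = "w n"] wu un(2) by (simp add: g_def)
    \<comment> \<open>Bernoulli's inequality bounds the damped power below by
      \<open>(1 - p * t * \<zeta> x) * pw (un n) x\<close>, so \<open>energy_perturb\<close> applies
      with weight \<open>p * t * \<zeta> x\<close>; no infinite sum is differentiated.\<close>
    have e: "energy (pw (un n)) \<le> K * (1 + g n) powr p + 2 * (\<Sum>x\<in>F. p * t * \<zeta> x * pw (un n) x * pot (pw (un n)) x)" for n
    proof -
      obtain Y where Y: "pow_bounded (pw (w n)) Y" using pow_bounded_pw_ex[OF w] by blast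
      have "(1 - p * t * \<zeta> x) * pw (un n) x \<le> pw (w n) x" for x
      proof -
        have "1 - p * (t * \<zeta> x) \<le> (1 - t * \<zeta> x) powr p" using p_gt_1 tx by (intro powr_bernoulli) auto
        then have "(1 - p * t * \<zeta> x) * pw (un n) x \<le> (1 - t * \<zeta> x) powr p * pw (un n) x"
          by (intro mult_right_mono) (auto simp: mult.assoc)
        also have "\<dots> = pw (w n) x" using tx[of x] by (simp add: w_def abs_mult powr_mult)
        finally show ?thesis .
      qed
      then have "energy (pw (un n)) \<le> energy (pw (w n)) + 2 * (\<Sum>x\<in>F. p * t * \<zeta> x * pw (un n) x * pot (pw (un n)) x)"
        using tx \<zeta>F by (intro energy_perturb[OF X(1) Y F]) auto
      with K(2)[OF w[of n]] show ?thesis by (simp add: nw)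
    qed
    let ?R = "\<lambda>n. K * (1 + g n) powr p + 2 * (\<Sum>x\<in>F. p * t * \<zeta> x * pw (un n) x * (pot (pw v) x + \<delta>))"
    have limpw: "(\<lambda>n. pw (un n) x) \<longlonglongrightarrow> pw v x" if "x \<in> carrier G" for x
      using p_gt_1 that by (intro tendsto_powr' tendsto_rabs lim tendsto_const) auto
    have "eventually (\<lambda>n. \<forall>x\<in>F. pot (pw (un n)) x \<le> pot (pw v) x + \<delta>) sequentially"
      using F by (intro eventually_ball_finite ballI pot_upper_semicontinuous[OF X limpw _ \<delta>]) auto
    then have ev: "eventually (\<lambda>n. energy (pw (un n)) \<le> ?R n) sequentially"
    proof eventually_elim
      case (elim n)
      have "(\<Sum>x\<in>F. p * t * \<zeta> x * pw (un n) x * pot (pw (un n)) x)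
          \<le> (\<Sum>x\<in>F. p * t * \<zeta> x * pw (un n) x * (pot (pw v) x + \<delta>))"
        using elim tx by (intro sum_mono mult_left_mono) auto
      with e[of n] show ?case by linarith
    qed
    let ?w = "\<lambda>x. v x - t * h x"
    have limw: "(\<lambda>n. w n x) \<longlonglongrightarrow> ?w x" if "x \<in> carrier G" for x
    proof -
      have "(\<lambda>n. w n x) \<longlonglongrightarrow> (1 - t * \<zeta> x) * v x"
        unfolding w_def by (intro tendsto_intros lim that)
      then show ?thesis by (simp add: left_diff_distrib \<zeta>(3) mult.assoc)
    qed
    have "g \<longlonglongrightarrow> (\<Sum>x\<in>?n. grad_sq G S ?w x - grad_sq G S v x)"
      unfolding g_def using n by (intro tendsto_sum tendsto_diff tendsto_grad_sq limw lim) auto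
    also have "(\<Sum>x\<in>?n. grad_sq G S ?w x - grad_sq G S v x) = - 2 * t * a + t\<^sup>2 * b"
    proof -
      have "grad_sq G S ?w x - grad_sq G S v x
          = - 2 * t * (\<Sum>s\<in>S. (v (x \<otimes> s) - v x) * (h (x \<otimes> s) - h x)) + t\<^sup>2 * grad_sq G S h x"
        if "x \<in> ?n" for x
      proof -
        have x: "x \<in> carrier G" using that n by auto
        have "(c - t * c' - (d - t * d'))\<^sup>2 - (c - d)\<^sup>2
            = - 2 * t * ((c - d) * (c' - d')) + t\<^sup>2 * (c' - d')\<^sup>2" for c c' d d'
          by (simp add: power2_eq_square algebra_simps)
        then show ?thesis
          unfolding grad_sq_eq[OF x] sum_distrib_left sum_subtractf[symmetric] sum.distrib[symmetric]
          by (intro sum.cong refl)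
      qed
      then show ?thesis
        unfolding a_def b_def by (simp add: sum.distrib sum_distrib_left)
    qed
    finally have limg: "(\<lambda>n. 1 + g n) \<longlonglongrightarrow> 1 + (- 2 * t * a + t\<^sup>2 * b)" by (intro tendsto_intros)
    have g0: "0 \<le> 1 + g n" for n using nw[of n] by (metis zero_le_power2)
    have "?R \<longlonglongrightarrow> K * (1 + (- 2 * t * a + t\<^sup>2 * b)) powr p
        + 2 * (\<Sum>x\<in>F. p * t * \<zeta> x * pw v x * (pot (pw v) x + \<delta>))"
      using F p_gt_1 g0
      by (intro tendsto_add tendsto_mult tendsto_const tendsto_sum limpw tendsto_powr' limg) auto
    then have "K \<le> K * (1 + (- 2 * t * a + t\<^sup>2 * b)) powr p
        + 2 * (\<Sum>x\<in>F. p * t * \<zeta> x * pw v x * (pot (pw v) x + \<delta>))"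
      using max ev by (intro tendsto_le[OF sequentially_bot])
    also have "(\<Sum>x\<in>F. p * t * \<zeta> x * pw v x * (pot (pw v) x + \<delta>))
        = p * t * ((\<Sum>x\<in>F. \<zeta> x * (pot (pw v) x * pw v x)) + \<delta> * B)"
      by (simp add: B_def sum_distrib_left distrib_left sum.distrib mult_ac)
    also have "\<dots> \<le> p * t * (energy (pw v) + \<delta> * B)"
    proof (intro mult_left_mono add_right_mono)
      have "(\<Sum>x\<in>F. \<zeta> x * (pot (pw v) x * pw v x)) \<le> (\<Sum>x\<in>F. 1 * (pot (pw v) x * pw v x))"
        using F \<zeta> energy_term_nonneg[OF X(2)] by (intro sum_mono mult_right_mono) auto
      also have "\<dots> \<le> energy (pw v)" using sum_le_energy[OF X(2) F] by simp
      finally show "(\<Sum>x\<in>F. \<zeta> x * (pot (pw v) x * pw v x)) \<le> energy (pw v)" .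
    qed (use t p_gt_1 in auto)
    finally show "K \<le> K * (1 - 2 * t * a + t\<^sup>2 * b) powr p + 2 * p * t * (energy (pw v) + \<delta> * B)"
      by (simp add: algebra_simps)
  qed
  have "K * a \<le> energy (pw v)"
  proof (rule field_le_epsilon)
    fix e :: real assume e: "e > 0"
    have "K * a \<le> energy (pw v) + e / (B + 1) * B" using e B by (intro *) auto
    also have "e / (B + 1) * B \<le> e" using e B by (simp add: field_simps)
    finally show "K * a \<le> energy (pw v) + e" by simp
  qed
  moreover have "(\<Sum>x\<in>A. grad_sq G S h x) \<le> a"
  proof -
    have "grad_sq G S h x = 0" if "x \<in> carrier G - ?n" for x
      using grad_sq_off_nbhd[of F h "\<lambda>x. 0", OF _ that] hF that by (simp add: grad_sq_eq)
    then have "(\<Sum>x\<in>A \<union> ?n. grad_sq G S h x) = (\<Sum>x\<in>?n. grad_sq G S h x)"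
      using A n by (intro sum.mono_neutral_right) auto
    moreover have "(\<Sum>x\<in>A. grad_sq G S h x) \<le> (\<Sum>x\<in>A \<union> ?n. grad_sq G S h x)"
      using A n by (intro sum_mono2) auto
    moreover have "(\<Sum>x\<in>?n. grad_sq G S h x) \<le> a"
      unfolding a_def
    proof (rule sum_mono)
      fix x assume "x \<in> ?n"
      then have x: "x \<in> carrier G" using n by auto
      show "grad_sq G S h x \<le> (\<Sum>s\<in>S. (v (x \<otimes> s) - v x) * (h (x \<otimes> s) - h x))"
        unfolding grad_sq_eq[OF x] h_def by (intro sum_mono soft_contraction \<epsilon>)
    qed
    ultimately show ?thesis by linarith
  qed
  ultimately show ?thesis
    using K(1) unfolding h_def by (meson mult_left_mono less_imp_le order_trans)
qed

lemma weak_limit_maximizer: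
  assumes K: "K > 0" "\<And>u. u \<in> D12 G S N \<Longrightarrow> energy (pw u) \<le> K * ((D12_norm G S u)\<^sup>2) powr p"
    and un: "\<And>n. un n \<in> D12 G S N" "\<And>n. D12_norm G S (un n) = 1"
    and max: "(\<lambda>n. energy (pw (un n))) \<longlonglongrightarrow> K"
    and lim: "\<And>x. x \<in> carrier G \<Longrightarrow> (\<lambda>n. un n x) \<longlonglongrightarrow> v x"
    and nz: "x0 \<in> carrier G" "v x0 \<noteq> 0"
  shows "v \<in> D12 G S N" and "D12_norm G S v = 1" and "energy (pw v) = K"
proof -
  obtain Z M where ZM: "Z \<ge> 0" "M > 0"
    "\<And>u. u \<in> D12 G S N \<Longrightarrow> D12_norm G S u \<le> 1 \<Longrightarrow> (\<Sum>\<^sub>\<infinity>x\<in>carrier G. \<bar>u x\<bar> powr crit) \<le> Z"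
    "\<And>u x. u \<in> D12 G S N \<Longrightarrow> D12_norm G S u \<le> 1 \<Longrightarrow> x \<in> carrier G \<Longrightarrow> \<bar>u x\<bar> \<le> M"
    using unit_ball_bounds by blast
  have v1: "(\<lambda>x. \<bar>v x\<bar> powr crit) summable_on carrier G"
  proof (rule summable_on_bounded(1))
    fix A assume A: "finite A" "A \<subseteq> carrier G"
    have "(\<lambda>n. \<Sum>x\<in>A. \<bar>un n x\<bar> powr crit) \<longlonglongrightarrow> (\<Sum>x\<in>A. \<bar>v x\<bar> powr crit)"
      using A crit_gt_2 N3 by (intro tendsto_sum tendsto_powr' tendsto_rabs lim tendsto_const) auto
    moreover have "(\<Sum>x\<in>A. \<bar>un n x\<bar> powr crit) \<le> Z" for n
      using finite_sum_le_infsum[OF D12_D(1)[OF un(1)[of n]] A] ZM(3)[OF un(1)[of n]] un(2)[of n] by fastforce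
    ultimately show "(\<Sum>x\<in>A. \<bar>v x\<bar> powr crit) \<le> Z"
      by (intro LIMSEQ_le_const2) auto
  qed simp
  have bound: "(\<Sum>x\<in>A. grad_sq G S v x) \<le> 1" if A: "finite A" "A \<subseteq> carrier G" for A
  proof (rule LIMSEQ_le_const2)
    show "(\<lambda>n. \<Sum>x\<in>A. grad_sq G S (un n) x) \<longlonglongrightarrow> (\<Sum>x\<in>A. grad_sq G S v x)"
      using A by (intro tendsto_sum tendsto_grad_sq lim) auto
    show "\<exists>n0. \<forall>n\<ge>n0. (\<Sum>x\<in>A. grad_sq G S (un n) x) \<le> 1"
      using finite_sum_grad_sq_le[OF D12_D(2)[OF un(1)] A] un(2) by simp
  qed
  have v2: "grad_sq G S v summable_on carrier G"
    by (rule summable_on_bounded(1)[OF _ bound]) auto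
  show v: "v \<in> D12 G S N" using v1 v2 by (simp add: D12_def ell_def)
  define E where "E = (D12_norm G S v)\<^sup>2"
  have E1: "E \<le> 1"
    unfolding E_def D12_norm_power2 by (rule summable_on_bounded(2)[OF _ bound]) auto
  then have nv: "D12_norm G S v \<le> 1" by (simp add: E_def power_le_one_iff abs_square_le_1)
  define X where "X = M powr (p * expo - crit) * Z"
  have X: "pow_bounded (pw (un n)) X" "pow_bounded (pw v) X" for n
    unfolding X_def using un(2)[of n] by (intro pow_bounded_pw un(1) v nv ZM; simp)+
  \<comment> \<open>The threshold is lowered to 0 on a fixed finite set, where pointwise convergence
    suffices; only then is the set enlarged.\<close>
  have A: "K * (\<Sum>x\<in>A. grad_sq G S v x) \<le> energy (pw v)" if A: "finite A" "A \<subseteq> carrier G" for A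
  proof (rule LIMSEQ_le_const2)
    have "(\<lambda>m. soft (inverse (real (Suc m))) (v x)) \<longlonglongrightarrow> v x" for x
    proof (rule LIM_zero_cancel, rule Lim_null_comparison)
      show "\<forall>\<^sub>F m in sequentially. norm (soft (inverse (real (Suc m))) (v x) - v x) \<le> inverse (real (Suc m))"
        using soft_approx by simp
      show "(\<lambda>m. inverse (real (Suc m))) \<longlonglongrightarrow> 0" by (rule LIMSEQ_inverse_real_of_nat)
    qed
    then show "(\<lambda>m. K * (\<Sum>x\<in>A. grad_sq G S (\<lambda>x. soft (inverse (real (Suc m))) (v x)) x))
        \<longlonglongrightarrow> K * (\<Sum>x\<in>A. grad_sq G S v x)"
      using A by (intro tendsto_mult tendsto_const tendsto_sum tendsto_grad_sq) auto
    show "\<exists>m0. \<forall>m\<ge>m0. K * (\<Sum>x\<in>A. grad_sq G S (\<lambda>x. soft (inverse (real (Suc m))) (v x)) x) \<le> energy (pw v)"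
      by (intro exI allI impI euler_lagrange[OF K un max lim X v1 A]) auto
  qed
  have "E \<le> energy (pw v) / K"
    unfolding E_def D12_norm_power2
    by (rule infsum_le_finite_sums[OF v2]) (use A K(1) in \<open>simp add: field_simps\<close>)
  then have KE: "K * E \<le> energy (pw v)" using K(1) by (simp add: field_simps)
  have Ep: "energy (pw v) \<le> K * E powr p" unfolding E_def by (rule K(2)[OF v])
  \<comment> \<open>\<open>E = 0\<close> also satisfies both inequalities; the nonzero value at
    \<open>x0\<close> is what excludes it.\<close>
  have "E > 0" using D12_norm_eq_0[OF v _ nz(1)] nz(2) by (auto simp: E_def)
  have "K * E \<le> K * E powr p" using KE Ep by linarith
  then have "E \<le> E powr p" using K(1) by simp
  have "E = 1"
  proof (rule ccontr)
    assume "E \<noteq> 1"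
    then have "E powr p < E powr 1" using E1 \<open>E > 0\<close> p_gt_1 by (intro powr_less_mono') auto
    then show False using \<open>E \<le> E powr p\<close> \<open>E > 0\<close> by simp
  qed
  then show "D12_norm G S v = 1" using D12_norm_nonneg[of v] by (simp add: E_def power2_eq_1_iff)
  show "energy (pw v) = K" using KE Ep \<open>E = 1\<close> by simp
qed

theorem maximizing_sequence_converges:
  assumes u: "\<And>n. u n \<in> D12 G S N" "\<And>n. D12_norm G S (u n) = 1"
    and max: "(\<lambda>n. HLS_energy G S \<alpha> p (u n)) \<longlonglongrightarrow> HLS_sup G S N \<alpha> p"
  shows "\<exists>x v. (\<forall>n. x n \<in> carrier G) \<and> v \<in> D12 G S N \<and>
     (\<exists>r :: nat \<Rightarrow> nat. strict_mono r \<and>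
        (\<lambda>k. D12_norm G S (\<lambda>y. u (r k) (x (r k) \<otimes> y) - v y)) \<longlonglongrightarrow> 0) \<and>
     D12_norm G S v = 1 \<and> HLS_energy G S \<alpha> p v = HLS_sup G S N \<alpha> p"
proof -
  obtain K where K: "K > 0" "HLS_sup G S N \<alpha> p = ennreal K"
    "\<And>u. u \<in> D12 G S N \<Longrightarrow> energy (pw u) \<le> K * ((D12_norm G S u)\<^sup>2) powr p"
    using best_constant by blast
  obtain c where c: "c > 0"
    "\<And>u. u \<in> D12 G S N \<Longrightarrow> D12_norm G S u \<le> 1 \<Longrightarrow> K / 2 \<le> energy (pw u) \<Longrightarrow> \<exists>x\<in>carrier G. c \<le> \<bar>u x\<bar>"
    using nonvanishing[OF K(1)] by blast
  have limK: "(\<lambda>n. energy (pw (u n))) \<longlonglongrightarrow> K"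
  proof (rule tendsto_ennrealD)
    show "(\<lambda>n. ennreal (energy (pw (u n)))) \<longlonglongrightarrow> ennreal K"
      using max by (simp add: K(2) HLS_energy_D12 u)
  qed (use K energy_pw_nonneg u in auto)
  \<comment> \<open>Early members of the sequence may have no point where the value reaches
    \<open>c\<close>; the unit element then serves as an arbitrary centre, which does not affect the
    limit.\<close>
  define x where "x n = (if \<exists>x\<in>carrier G. c \<le> \<bar>u n x\<bar> then SOME x. x \<in> carrier G \<and> c \<le> \<bar>u n x\<bar> else \<one>)" for n
  have xc: "x n \<in> carrier G" for n
    unfolding x_def by (auto intro: someI2)
  have "eventually (\<lambda>n. K / 2 < energy (pw (u n))) sequentially"
    using limK K(1) by (intro order_tendstoD) auto
  then have ev: "eventually (\<lambda>n. c \<le> \<bar>u n (x n)\<bar>) sequentially"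
  proof eventually_elim
    case (elim n)
    then have "\<exists>x\<in>carrier G. c \<le> \<bar>u n x\<bar>" using c(2)[OF u(1)] u(2) by simp
    then show ?case unfolding x_def by (auto intro: someI2)
  qed
  define vn where "vn n y = u n (x n \<otimes> y)" for n y
  have vn: "vn n \<in> D12 G S N" "D12_norm G S (vn n) = 1" for n
    unfolding vn_def using D12_left_mult[OF u(1) xc] u(2) by auto
  have evn: "energy (pw (vn n)) = energy (pw (u n))" for n
    unfolding vn_def by (rule energy_left_mult[OF xc])
  obtain Z M where ZM: "Z \<ge> 0" "M > 0"
    "\<And>u. u \<in> D12 G S N \<Longrightarrow> D12_norm G S u \<le> 1 \<Longrightarrow> (\<Sum>\<^sub>\<infinity>x\<in>carrier G. \<bar>u x\<bar> powr crit) \<le> Z"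
    "\<And>u x. u \<in> D12 G S N \<Longrightarrow> D12_norm G S u \<le> 1 \<Longrightarrow> x \<in> carrier G \<Longrightarrow> \<bar>u x\<bar> \<le> M"
    using unit_ball_bounds by blast
  have "norm (vn n y) \<le> M" if "y \<in> carrier G" for n y
    using ZM(4)[OF vn(1) _ that] vn(2) by simp
  then obtain r where r: "strict_mono (r :: nat \<Rightarrow> nat)"
    "\<And>y. y \<in> carrier G \<Longrightarrow> \<exists>l. (\<lambda>k. vn (r k) y) \<longlonglongrightarrow> l"
    using function_convergent_subsequence[OF countable_carrier] by metis
  then obtain v where v: "\<And>y. y \<in> carrier G \<Longrightarrow> (\<lambda>k. vn (r k) y) \<longlonglongrightarrow> v y" by metis
  \<comment> \<open>Since \<open>vn n \<one> = u n (x n)\<close>, the lower bound at the moving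
    centres becomes one at the unit element and survives in the limit.\<close>
  have "c \<le> \<bar>v \<one>\<bar>"
  proof (rule tendsto_lowerbound)
    show "(\<lambda>k. \<bar>vn (r k) \<one>\<bar>) \<longlonglongrightarrow> \<bar>v \<one>\<bar>" by (intro tendsto_rabs v) simp
    show "\<forall>\<^sub>F k in sequentially. c \<le> \<bar>vn (r k) \<one>\<bar>"
      using eventually_subseq[OF r(1) ev] xc by (simp add: vn_def)
  qed simp
  then have v1: "v \<one> \<noteq> 0" using c(1) by auto
  have "(\<lambda>k. energy (pw (vn (r k)))) \<longlonglongrightarrow> K"
    using LIMSEQ_subseq_LIMSEQ[OF limK r(1)] by (simp add: evn comp_def)
  note vmax = weak_limit_maximizer[OF K(1,3) vn this v one_closed v1]
  have "(\<lambda>k. D12_norm G S (\<lambda>y. vn (r k) y - v y)) \<longlonglongrightarrow> 0"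
    by (rule D12_norm_diff_tendsto_0[OF v D12_D(2)[OF vn(1)] vn(2) D12_D(2)[OF vmax(1)] vmax(2)])
  moreover have "HLS_energy G S \<alpha> p v = HLS_sup G S N \<alpha> p"
    using HLS_energy_D12[OF vmax(1)] vmax(3) K(2) by simp
  ultimately show ?thesis
    using xc vmax(1,2) r(1) unfolding vn_def by blast
qed

end

theorem theorem1p1:
  fixes G :: "('a, 'b) monoid_scheme" and S :: "'a set" and N :: nat
    and \<alpha> p :: real and u :: "nat \<Rightarrow> 'a \<Rightarrow> real"
  assumes "group G"
    and "S \<subseteq> carrier G" and "finite S"
    and "\<And>s. s \<in> S \<Longrightarrow> inv\<^bsub>G\<^esub> s \<in> S"
    and "generate G S = carrier G"
    and "polynomial_growth G S N" and "N \<ge> 3"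
    and "0 < \<alpha>" and "\<alpha> < real N"
    and "p > (real N + \<alpha>) / (real N - 2)"
    and "\<And>n. u n \<in> D12 G S N"
    and "\<And>n. D12_norm G S (u n) = 1"
    and "(\<lambda>n. HLS_energy G S \<alpha> p (u n)) \<longlonglongrightarrow> HLS_sup G S N \<alpha> p"
  shows "\<exists>(x :: nat \<Rightarrow> 'a) (v :: 'a \<Rightarrow> real).
           (\<forall>n. x n \<in> carrier G) \<and> v \<in> D12 G S N \<and>
           (\<exists>r :: nat \<Rightarrow> nat. strict_mono r \<and>
              (\<lambda>k. D12_norm G S (\<lambda>y. u (r k) (x (r k) \<otimes>\<^bsub>G\<^esub> y) - v y)) \<longlonglongrightarrow> 0) \<and>
           D12_norm G S v = 1 \<and>
           HLS_energy G S \<alpha> p v = HLS_sup G S N \<alpha> p"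
proof -
  interpret group G by fact
  interpret hls_setting G S N \<alpha> p
    by unfold_locales (use assms in auto)
  show ?thesis by (rule maximizing_sequence_converges) (use assms in auto)
qed

end
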